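(* Let $d\ge 2$ be an integer. For any $\theta\in(0,1)$ and $q\in[1,\infty)$, the real interpolation space $X_{\theta,q}:=(L^{\infty},H^{d/2})_{\theta,q}$ on $\mathbb{T}^d$ is a $BB$ space.
   Context: All function spaces are on the torus $\mathbb{T}^{d}$, $d\ge 2$. For a function space $X$ on $\mathbb{T}^d$ and a vector field $u=(u_1,\dots,u_d)$ on $\mathbb{T}^d$, one writes $u\in X$ if every component $u_j$ belongs to $X$ (that is, $u\in X^d$). A Banach function space $X$ on $\mathbb{T}^{d}$ is called a Bourgain-Brezis space ($BB$ space) if for any vector field $v\in X$ there exists a vector field $u\in L^{\infty}\cap X$ such that $\operatorname{div}u=\operatorname{div}v$ in the sense of distributions on $\mathbb{T}^{d}$. $H^{s}=W^{s,2}$ denotes the usual $L^2$-based Sobolev space on $\mathbb{T}^d$. $(A_0,A_1)_{\theta,q}$ denotes the usual real interpolation space (e.g. by the $K$-method). *)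

theory Defs
  imports "HOL-Analysis.Analysis" "HOL-Probability.Essential_Supremum"
begin

text \<open>
  The torus is \<open>\<real>\<^sup>d / \<int>\<^sup>d\<close> with \<open>d = CARD('n)\<close>: functions on it are functions on
  \<open>real ^ 'n\<close> that are 1-periodic in every coordinate, and integration over the torus is
  integration over the unit cube. Functions are not quotiented by equality almost everywhere;
  instead, all function spaces below are closed under changes on null sets, and norms vanish
  exactly on the functions that are zero almost everywhere.
\<close>

definition torus :: "(real ^ 'n) measure" where
  "torus = lebesgue_on (cbox 0 1)"

definition periodic :: "(real ^ 'n \<Rightarrow> 'a) \<Rightarrow> bool" where
  "periodic f \<longleftrightarrow> (\<forall>x i. f (x + axis i 1) = f x)"

definition torus_fun :: "(real ^ 'n \<Rightarrow> real) set" where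
  "torus_fun = {f. periodic f \<and> f \<in> borel_measurable lebesgue}"

definition L1 :: "(real ^ 'n \<Rightarrow> real) set" where
  "L1 = {f \<in> torus_fun. integrable torus f}"

definition L2 :: "(real ^ 'n \<Rightarrow> real) set" where
  "L2 = {f \<in> torus_fun. integrable torus (\<lambda>x. (f x)\<^sup>2)}"

definition Linf :: "(real ^ 'n \<Rightarrow> real) set" where
  "Linf = {f \<in> torus_fun. esssup torus (\<lambda>x. ereal \<bar>f x\<bar>) < \<infinity>}"

definition Linf_norm :: "(real ^ 'n \<Rightarrow> real) \<Rightarrow> real" where
  "Linf_norm f = real_of_ereal (esssup torus (\<lambda>x. ereal \<bar>f x\<bar>))"

definition fourier_coeff :: "(real ^ 'n \<Rightarrow> real) \<Rightarrow> int ^ 'n \<Rightarrow> complex" where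
  "fourier_coeff f k =
     (LINT x|torus. cis (- (2 * pi * (\<Sum>i\<in>UNIV. of_int (k $ i) * x $ i))) * complex_of_real (f x))"

text \<open>
  Only orders \<open>s \<ge> 0\<close> are meant: \<open>Hs s\<close> consists of functions in \<open>L2\<close>.
\<close>

definition sobolev_term :: "real \<Rightarrow> (real ^ 'n \<Rightarrow> real) \<Rightarrow> int ^ 'n \<Rightarrow> real" where
  "sobolev_term s f k =
     (1 + (\<Sum>i\<in>UNIV. (of_int (k $ i))\<^sup>2)) powr s * (cmod (fourier_coeff f k))\<^sup>2"

definition Hs :: "real \<Rightarrow> (real ^ 'n \<Rightarrow> real) set" where
  "Hs s = {f \<in> L2. sobolev_term s f summable_on UNIV}"

definition Hs_norm :: "real \<Rightarrow> (real ^ 'n \<Rightarrow> real) \<Rightarrow> real" where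
  "Hs_norm s f = sqrt (\<Sum>\<^sub>\<infinity>k. sobolev_term s f k)"

text \<open>
  A normed space of functions is given by its carrier \<open>A\<close> and its norm \<open>N\<close>, of which only the
  values on \<open>A\<close> matter.
\<close>

definition K_decomps :: "('a \<Rightarrow> real) set \<Rightarrow> ('a \<Rightarrow> real) set \<Rightarrow> ('a \<Rightarrow> real)
    \<Rightarrow> (('a \<Rightarrow> real) \<times> ('a \<Rightarrow> real)) set" where
  "K_decomps A0 A1 f = {(g, h). g \<in> A0 \<and> h \<in> A1 \<and> f = (\<lambda>x. g x + h x)}"

definition K_functional :: "('a \<Rightarrow> real) set \<Rightarrow> (('a \<Rightarrow> real) \<Rightarrow> real)
    \<Rightarrow> ('a \<Rightarrow> real) set \<Rightarrow> (('a \<Rightarrow> real) \<Rightarrow> real) \<Rightarrow> real \<Rightarrow> ('a \<Rightarrow> real) \<Rightarrow> real" where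
  "K_functional A0 N0 A1 N1 t f = (INF (g, h)\<in>K_decomps A0 A1 f. N0 g + t * N1 h)"

definition interp_integral :: "('a \<Rightarrow> real) set \<Rightarrow> (('a \<Rightarrow> real) \<Rightarrow> real)
    \<Rightarrow> ('a \<Rightarrow> real) set \<Rightarrow> (('a \<Rightarrow> real) \<Rightarrow> real) \<Rightarrow> real \<Rightarrow> real \<Rightarrow> ('a \<Rightarrow> real) \<Rightarrow> ennreal" where
  "interp_integral A0 N0 A1 N1 \<theta> q f =
     (\<integral>\<^sup>+t\<in>{0<..}. ennreal ((t powr (- \<theta>) * K_functional A0 N0 A1 N1 t f) powr q / t) \<partial>lborel)"

text \<open>
  Membership in \<open>A0 + A1\<close> is required explicitly, because the infimum over an empty set of
  decompositions is an unspecified real number rather than infinity.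
\<close>

definition interp_space :: "('a \<Rightarrow> real) set \<Rightarrow> (('a \<Rightarrow> real) \<Rightarrow> real)
    \<Rightarrow> ('a \<Rightarrow> real) set \<Rightarrow> (('a \<Rightarrow> real) \<Rightarrow> real) \<Rightarrow> real \<Rightarrow> real \<Rightarrow> ('a \<Rightarrow> real) set" where
  "interp_space A0 N0 A1 N1 \<theta> q =
     {f. K_decomps A0 A1 f \<noteq> {} \<and> interp_integral A0 N0 A1 N1 \<theta> q f < \<infinity>}"

definition interp_norm :: "('a \<Rightarrow> real) set \<Rightarrow> (('a \<Rightarrow> real) \<Rightarrow> real)
    \<Rightarrow> ('a \<Rightarrow> real) set \<Rightarrow> (('a \<Rightarrow> real) \<Rightarrow> real) \<Rightarrow> real \<Rightarrow> real \<Rightarrow> ('a \<Rightarrow> real) \<Rightarrow> real" where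
  "interp_norm A0 N0 A1 N1 \<theta> q f = enn2real (interp_integral A0 N0 A1 N1 \<theta> q f) powr (1 / q)"

definition partial :: "'n \<Rightarrow> (real ^ 'n \<Rightarrow> real) \<Rightarrow> real ^ 'n \<Rightarrow> real" where
  "partial i f x = frechet_derivative f (at x) (axis i 1)"

primrec C_k :: "nat \<Rightarrow> (real ^ 'n \<Rightarrow> real) \<Rightarrow> bool" where
  "C_k 0 f \<longleftrightarrow> continuous_on UNIV f"
| "C_k (Suc m) f \<longleftrightarrow> (\<forall>x. f differentiable (at x)) \<and> (\<forall>i. C_k m (partial i f))"

definition test_functions :: "(real ^ 'n \<Rightarrow> real) set" where
  "test_functions = {\<phi>. periodic \<phi> \<and> (\<forall>m. C_k m \<phi>)}"

definition distr_div :: "(real ^ 'n \<Rightarrow> real ^ 'n) \<Rightarrow> (real ^ 'n \<Rightarrow> real) \<Rightarrow> real" where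
  "distr_div u \<phi> = - (LINT x|torus. (\<Sum>j\<in>UNIV. u x $ j * partial j \<phi> x))"

definition same_div :: "(real ^ 'n \<Rightarrow> real ^ 'n) \<Rightarrow> (real ^ 'n \<Rightarrow> real ^ 'n) \<Rightarrow> bool" where
  "same_div u v \<longleftrightarrow> (\<forall>\<phi>\<in>test_functions. distr_div u \<phi> = distr_div v \<phi>)"

text \<open>
  ``Banach function space'' means a Banach space of (classes of) integrable functions.
  No lattice property is imposed, since Sobolev spaces and their interpolation spaces do not
  have it.
\<close>

definition banach_function_space ::
    "(real ^ 'n \<Rightarrow> real) set \<Rightarrow> ((real ^ 'n \<Rightarrow> real) \<Rightarrow> real) \<Rightarrow> bool" where
  "banach_function_space X N \<longleftrightarrow>
     X \<subseteq> L1 \<and>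
     (\<lambda>x. 0) \<in> X \<and>
     (\<forall>f\<in>X. \<forall>g\<in>X. (\<lambda>x. f x + g x) \<in> X \<and> N (\<lambda>x. f x + g x) \<le> N f + N g) \<and>
     (\<forall>f\<in>X. \<forall>c. (\<lambda>x. c * f x) \<in> X \<and> N (\<lambda>x. c * f x) = \<bar>c\<bar> * N f) \<and>
     (\<forall>f\<in>X. \<forall>g\<in>torus_fun. (AE x in torus. f x = g x) \<longrightarrow> g \<in> X) \<and>
     (\<forall>f\<in>X. 0 \<le> N f \<and> (N f = 0 \<longleftrightarrow> (AE x in torus. f x = 0))) \<and>
     (\<forall>F. (\<forall>n. F n \<in> X) \<and>
          (\<forall>e>0. \<exists>M. \<forall>m\<ge>M. \<forall>n\<ge>M. N (\<lambda>x. F m x - F n x) < e) \<longrightarrow>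
        (\<exists>f\<in>X. (\<lambda>n::nat. N (\<lambda>x. F n x - f x)) \<longlonglongrightarrow> 0))"

definition vector_field_in :: "(real ^ 'n \<Rightarrow> real) set \<Rightarrow> (real ^ 'n \<Rightarrow> real ^ 'n) set" where
  "vector_field_in X = {u. \<forall>j. (\<lambda>x. u x $ j) \<in> X}"

definition BB_space ::
    "(real ^ 'n \<Rightarrow> real) set \<Rightarrow> ((real ^ 'n \<Rightarrow> real) \<Rightarrow> real) \<Rightarrow> bool" where
  "BB_space X N \<longleftrightarrow>
     banach_function_space X N \<and>
     (\<forall>v\<in>vector_field_in X. \<exists>u\<in>vector_field_in (Linf \<inter> X). same_div u v)"

end

theory Submission
  imports Defs "HOL-Probability.Probability_Measure" "HOL-Library.Diagonal_Subsequence"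
begin

text \<open>
  Write \<open>v = g + h\<close> with \<open>g\<close> bounded and \<open>h\<close> in \<open>H\<^sup>d\<^sup>/\<^sup>2\<close>. Then \<open>h\<close> lies in the interpolation space, too:
  its \<open>K\<close>-functional is \<open>O(t)\<close> for small \<open>t\<close> and differs from that of \<open>v\<close> by a bounded amount for large
  \<open>t\<close>. Hence it suffices to find a bounded field \<open>w\<close> in \<open>H\<^sup>d\<^sup>/\<^sup>2\<close> with the divergence of \<open>h\<close>, and then
  \<open>u = g + w\<close>.

  For \<open>H\<^sup>d\<^sup>/\<^sup>2\<close>, minimise \<open>\<parallel>w\<parallel>\<^sup>2 / 2 + \<Sum>\<^sub>j \<integral> w\<^sub>j\<^sup>p / p\<close> over trigonometric polynomials with the divergence of \<open>h\<close>
  (scaled to be small), where \<open>p\<close> is even. The first variation is a gradient and the sum of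
  \<open>f\<^sub>j = w\<^sub>j\<^sup>p\<^sup>-\<^sup>1\<close> and the Riesz image of \<open>w\<close>. Following Maz'ya, the quadratic form with matrix symbol
  \<open>(k\<^sub>j k\<^sub>l - \<delta>\<^sub>j\<^sub>l |k|\<^sup>2 / d) |k|\<^sup>-\<^sup>d\<^sup>-\<^sup>2\<close> is definite on gradients, while its convolution kernel is bounded,
  so that on \<open>f\<close> it is controlled by the \<open>L\<^sup>1\<close> norm. This bounds \<open>\<parallel>w\<parallel>\<close> and \<open>\<integral> w\<^sub>j\<^sup>p\<close> independently of \<open>p\<close>
  and of the frequency cutoff. In the limit the first bound gives \<open>w \<in> H\<^sup>d\<^sup>/\<^sup>2\<close> and the second \<open>|w\<^sub>j| \<le> 1\<close>.
\<close>

section \<open>The real interpolation method\<close>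

text \<open>The critical space just fails to embed into L^\<infinity>, so the gradient field with
  the given divergence need not be bounded; a correction has to be found by a nonlinear argument.
  The obstacle in it is that a multiplier of degree -d usually has a logarithmically unbounded
  kernel. Subtracting the trace |k|^2/d from k k^T gives mean zero over symmetric frequency sets,
  which removes the logarithm. The price is the factor 1 - 1/d on gradients, positive because d
  \<ge> 2.

  For bounds uniform in the cutoff, |k|^(-d-2) is replaced by a finite sum of Lipschitz tents at the
  scales 2^i. The same truncated weight enters the energy, so the norm of the first variation
  controlled by the kernel is exactly dual to the norm in the energy.

  Scaling the data helps because the divergence equation is linear while the estimate is not
  homogeneous: the L^1 norm of w_j^(p-1) is at most 1 + \<integral> w_j^p, so small data leave a
  right-hand side that is at most half of the left one plus a constant depending only on d.\<close>

locale fun_seminorm =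
  fixes A :: "('a \<Rightarrow> real) set" and N :: "('a \<Rightarrow> real) \<Rightarrow> real"
  assumes zero_mem: "(\<lambda>x. 0) \<in> A"
    and add_mem: "f \<in> A \<Longrightarrow> g \<in> A \<Longrightarrow> (\<lambda>x. f x + g x) \<in> A"
    and scale_mem: "f \<in> A \<Longrightarrow> (\<lambda>x. c * f x) \<in> A"
    and nonneg: "f \<in> A \<Longrightarrow> 0 \<le> N f"
    and triangle: "f \<in> A \<Longrightarrow> g \<in> A \<Longrightarrow> N (\<lambda>x. f x + g x) \<le> N f + N g"
    and homog: "f \<in> A \<Longrightarrow> N (\<lambda>x. c * f x) = \<bar>c\<bar> * N f"
begin

lemma N_zero: "N (\<lambda>x. 0) = 0"
  using homog[OF zero_mem, of 0] by simp

lemma diff_mem: "f \<in> A \<Longrightarrow> g \<in> A \<Longrightarrow> (\<lambda>x. f x - g x) \<in> A"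
  using add_mem[OF _ scale_mem[of g "-1"], of f] by simp

lemma minus_mem: "f \<in> A \<Longrightarrow> (\<lambda>x. - f x) \<in> A"
  using scale_mem[of f "-1"] by simp

lemma N_minus: "f \<in> A \<Longrightarrow> N (\<lambda>x. - f x) = N f"
  using homog[of f "-1"] by simp

lemma N_diff_commute:
  assumes "f \<in> A" "g \<in> A"
  shows "N (\<lambda>x. f x - g x) = N (\<lambda>x. g x - f x)"
  using N_minus[OF diff_mem[OF assms]] by simp

lemma sum_mem: "(\<And>i. i < n \<Longrightarrow> g i \<in> A) \<Longrightarrow> (\<lambda>x. \<Sum>i<n. g i x) \<in> A" for n :: nat
  by (induction n) (auto simp: zero_mem intro!: add_mem)

lemma N_sum_le: "(\<And>i. i < n \<Longrightarrow> g i \<in> A) \<Longrightarrow> N (\<lambda>x. \<Sum>i<n. g i x) \<le> (\<Sum>i<n. N (g i))" for n :: nat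
proof (induction n)
  case (Suc n)
  then show ?case
    using triangle[OF sum_mem[of n g] , of "g n"] by fastforce
qed (simp add: N_zero)

end

text \<open>\<open>N\<close> is only a seminorm, since functions equal almost everywhere are not
  identified; limits are therefore not unique. The shape is that of the completeness clause in
  \<open>banach_function_space\<close>.\<close>

definition seminorm_complete :: "('a \<Rightarrow> real) set \<Rightarrow> (('a \<Rightarrow> real) \<Rightarrow> real) \<Rightarrow> bool" where
  "seminorm_complete A N \<longleftrightarrow>
     (\<forall>F. (\<forall>n. F n \<in> A) \<and> (\<forall>e>0. \<exists>M. \<forall>m\<ge>M. \<forall>n\<ge>M. N (\<lambda>x. F m x - F n x) < e)
       \<longrightarrow> (\<exists>f\<in>A. (\<lambda>n::nat. N (\<lambda>x. F n x - f x)) \<longlonglongrightarrow> 0))"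

lemma (in fun_seminorm) series_converges:
  assumes "seminorm_complete A N" and g: "\<And>i. g i \<in> A" and summ: "summable (\<lambda>i. N (g i))"
  shows "\<exists>f\<in>A. (\<lambda>n. N (\<lambda>x. (\<Sum>i<n. g i x) - f x)) \<longlonglongrightarrow> 0"
proof -
  have "\<exists>M. \<forall>m\<ge>M. \<forall>n\<ge>M. N (\<lambda>x. (\<Sum>i<m. g i x) - (\<Sum>i<n. g i x)) < e" if "e > 0" for e
  proof -
    obtain M where M: "\<And>m n. m \<ge> M \<Longrightarrow> norm (\<Sum>i=m..<n. N (g i)) < e"
      using summ[unfolded summable_Cauchy] \<open>e > 0\<close> by blast
    have le: "N (\<lambda>x. (\<Sum>i<m. g i x) - (\<Sum>i<n. g i x)) < e" if "M \<le> n" "n \<le> m" for m n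
    proof -
      have "(\<Sum>i<m. g i x) - (\<Sum>i<n. g i x) = (\<Sum>i<m-n. g (i+n) x)" for x
        using that sum.shift_bounds_nat_ivl[of "\<lambda>i. g i x" 0 n "m - n"]
          sum_diff_nat_ivl[of 0 n m "\<lambda>i. g i x"] by (simp add: lessThan_atLeast0)
      then have "N (\<lambda>x. (\<Sum>i<m. g i x) - (\<Sum>i<n. g i x)) \<le> (\<Sum>i<m-n. N (g (i+n)))"
        using N_sum_le[of "m-n" "\<lambda>i. g (i+n)"] g by simp
      also have "\<dots> = (\<Sum>i=n..<m. N (g i))"
        using that sum.shift_bounds_nat_ivl[of "\<lambda>i. N (g i)" 0 n "m - n"]
        by (simp add: lessThan_atLeast0)
      also have "\<dots> < e" using M[OF that(1), of m] by simp
      finally show ?thesis .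
    qed
    have "N (\<lambda>x. (\<Sum>i<m. g i x) - (\<Sum>i<n. g i x)) < e" if "M \<le> n" "M \<le> m" for m n
      using le[of n m] le[of m n] that N_diff_commute[OF sum_mem sum_mem, of m g n g] g
      by (cases "n \<le> m") auto
    then show ?thesis by blast
  qed
  then show ?thesis
    using assms(1)[unfolded seminorm_complete_def, rule_format, of "\<lambda>n x. \<Sum>i<n. g i x"] sum_mem g
    by blast
qed

text \<open>Thins a Cauchy sequence until consecutive distances are summable. \<open>D\<close> is a
  bare function so that one statement serves both \<open>K 1\<close> on the sum space and the L^2
  distance.\<close>

lemma fast_subseq:
  fixes D :: "nat \<Rightarrow> nat \<Rightarrow> real"
  assumes "\<And>e. e > 0 \<Longrightarrow> \<exists>M. \<forall>m\<ge>M. \<forall>n\<ge>M. D m n < e"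
  obtains r where "strict_mono r" "\<And>i m n. m \<ge> r i \<Longrightarrow> n \<ge> r i \<Longrightarrow> D m n < (1/2)^i"
proof -
  have "\<forall>i. \<exists>M. \<forall>m\<ge>M. \<forall>n\<ge>M. D m n < (1/2)^i"
    using assms by simp
  then obtain M where M: "\<And>i m n. m \<ge> M i \<Longrightarrow> n \<ge> M i \<Longrightarrow> D m n < (1/2)^i"
    by metis
  \<comment> \<open>Adding up the thresholds makes \<open>r i\<close> dominate \<open>M i\<close>,
    and the summand \<open>i\<close> makes \<open>r\<close> strictly increasing.\<close>
  define r where "r i = (\<Sum>j\<le>i. M j) + i" for i
  have "strict_mono r"
    unfolding strict_mono_Suc_iff r_def by simp
  moreover have "M i \<le> r i" for i
    using member_le_sum[of i "{..i}" M] by (simp add: r_def trans_le_add1)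
  then have "D m n < (1/2)^i" if "m \<ge> r i" "n \<ge> r i" for i m n
    using that by (intro M) (meson le_trans)+
  ultimately show ?thesis by (rule that)
qed

section \<open>The sum of two seminormed spaces and the K-functional\<close>

locale interp_couple = A0: fun_seminorm A0 N0 + A1: fun_seminorm A1 N1
  for A0 :: "('a \<Rightarrow> real) set" and N0 and A1 :: "('a \<Rightarrow> real) set" and N1
begin

abbreviation "K \<equiv> K_functional A0 N0 A1 N1"

definition sum_space :: "('a \<Rightarrow> real) set" where
  "sum_space = {f. K_decomps A0 A1 f \<noteq> {}}"

lemma sum_spaceI: "g \<in> A0 \<Longrightarrow> h \<in> A1 \<Longrightarrow> f = (\<lambda>x. g x + h x) \<Longrightarrow> f \<in> sum_space"
  by (auto simp: sum_space_def K_decomps_def)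

lemma sum_spaceE:
  assumes "f \<in> sum_space"
  obtains g h where "g \<in> A0" "h \<in> A1" "f = (\<lambda>x. g x + h x)"
  using assms by (auto simp: sum_space_def K_decomps_def)

lemma K_le:
  assumes "g \<in> A0" "h \<in> A1" "f = (\<lambda>x. g x + h x)" "t \<ge> 0"
  shows "K t f \<le> N0 g + t * N1 h"
proof -
  have "bdd_below ((\<lambda>(g, h). N0 g + t * N1 h) ` K_decomps A0 A1 f)"
    using assms(4) A0.nonneg A1.nonneg by (intro bdd_belowI[of _ 0]) (auto simp: K_decomps_def)
  then have "K t f \<le> (case (g, h) of (g, h) \<Rightarrow> N0 g + t * N1 h)"
    unfolding K_functional_def by (rule cINF_lower) (use assms in \<open>auto simp: K_decomps_def\<close>)
  then show ?thesis by simp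
qed

lemma K_greatest:
  assumes "f \<in> sum_space"
    and "\<And>g h. g \<in> A0 \<Longrightarrow> h \<in> A1 \<Longrightarrow> f = (\<lambda>x. g x + h x) \<Longrightarrow> m \<le> N0 g + t * N1 h"
  shows "m \<le> K t f"
  unfolding K_functional_def
  by (rule cINF_greatest) (use assms in \<open>auto simp: K_decomps_def sum_space_def\<close>)

lemma K_approx:
  assumes "f \<in> sum_space" "e > 0" "t \<ge> 0"
  obtains g h where "g \<in> A0" "h \<in> A1" "f = (\<lambda>x. g x + h x)" "N0 g + t * N1 h < K t f + e"
proof -
  have "\<exists>g h. g \<in> A0 \<and> h \<in> A1 \<and> f = (\<lambda>x. g x + h x) \<and> N0 g + t * N1 h < K t f + e"
  proof (rule ccontr)
    assume "\<not> ?thesis"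
    then have "K t f + e \<le> K t f"
      by (intro K_greatest[OF assms(1)]) (metis not_less)
    with assms show False by simp
  qed
  then show ?thesis using that by blast
qed

lemma K_nonneg: "f \<in> sum_space \<Longrightarrow> t \<ge> 0 \<Longrightarrow> 0 \<le> K t f"
  by (rule K_greatest) (auto intro!: add_nonneg_nonneg A0.nonneg A1.nonneg mult_nonneg_nonneg)

lemma sum_space_add:
  assumes "f \<in> sum_space" "g \<in> sum_space"
  shows "(\<lambda>x. f x + g x) \<in> sum_space"
proof -
  obtain a b c d where "a \<in> A0" "b \<in> A1" "f = (\<lambda>x. a x + b x)"
    and "c \<in> A0" "d \<in> A1" "g = (\<lambda>x. c x + d x)"
    using assms by (elim sum_spaceE)
  then show ?thesis
    by (intro sum_spaceI[OF A0.add_mem[of a c] A1.add_mem[of b d]]) (auto simp: fun_eq_iff)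
qed

lemma sum_space_scale:
  assumes "f \<in> sum_space"
  shows "(\<lambda>x. c * f x) \<in> sum_space"
proof -
  obtain a b where "a \<in> A0" "b \<in> A1" "f = (\<lambda>x. a x + b x)"
    using assms by (elim sum_spaceE)
  then show ?thesis
    by (intro sum_spaceI[OF A0.scale_mem[of a c] A1.scale_mem[of b c]])
      (auto simp: fun_eq_iff algebra_simps)
qed

lemma sum_space_0: "A0 \<subseteq> sum_space" and sum_space_1: "A1 \<subseteq> sum_space"
  using sum_spaceI[OF _ A1.zero_mem] sum_spaceI[OF A0.zero_mem] by auto

lemma K_add:
  assumes "f \<in> sum_space" "g \<in> sum_space" "t \<ge> 0"
  shows "K t (\<lambda>x. f x + g x) \<le> K t f + K t g"
proof (rule field_le_epsilon)
  fix e :: real assume "e > 0"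
  obtain a b where ab: "a \<in> A0" "b \<in> A1" "f = (\<lambda>x. a x + b x)" "N0 a + t * N1 b < K t f + e/2"
    using K_approx[OF assms(1) _ assms(3), of "e/2"] \<open>e > 0\<close> by auto
  obtain c d where cd: "c \<in> A0" "d \<in> A1" "g = (\<lambda>x. c x + d x)" "N0 c + t * N1 d < K t g + e/2"
    using K_approx[OF assms(2) _ assms(3), of "e/2"] \<open>e > 0\<close> by auto
  have "K t (\<lambda>x. f x + g x) \<le> N0 (\<lambda>x. a x + c x) + t * N1 (\<lambda>x. b x + d x)"
    using ab cd assms by (intro K_le A0.add_mem A1.add_mem) (auto simp: fun_eq_iff)
  also have "\<dots> \<le> (N0 a + N0 c) + t * (N1 b + N1 d)"
    using ab cd assms(3) by (intro add_mono mult_left_mono A0.triangle A1.triangle)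
  also have "\<dots> \<le> K t f + K t g + e"
    using ab(4) cd(4) by (simp add: algebra_simps)
  finally show "K t (\<lambda>x. f x + g x) \<le> K t f + K t g + e" .
qed

lemma K_scale_le:
  assumes "f \<in> sum_space" "t \<ge> 0"
  shows "K t (\<lambda>x. c * f x) \<le> \<bar>c\<bar> * K t f"
proof (cases "c = 0")
  case True
  then show ?thesis
    using K_le[OF A0.zero_mem A1.zero_mem _ assms(2), of "\<lambda>x. 0"]
    by (simp add: A0.N_zero A1.N_zero)
next
  case False
  have "K t (\<lambda>x. c * f x) / \<bar>c\<bar> \<le> K t f"
  proof (rule K_greatest[OF assms(1)])
    fix g h assume gh: "g \<in> A0" "h \<in> A1" "f = (\<lambda>x. g x + h x)"
    have "K t (\<lambda>x. c * f x) \<le> N0 (\<lambda>x. c * g x) + t * N1 (\<lambda>x. c * h x)"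
      using gh assms by (intro K_le A0.scale_mem A1.scale_mem) (auto simp: fun_eq_iff algebra_simps)
    also have "\<dots> = \<bar>c\<bar> * (N0 g + t * N1 h)"
      using gh by (simp add: A0.homog A1.homog algebra_simps)
    finally show "K t (\<lambda>x. c * f x) / \<bar>c\<bar> \<le> N0 g + t * N1 h"
      using False by (simp add: divide_le_eq mult.commute)
  qed
  then show ?thesis using False by (simp add: divide_le_eq mult.commute)
qed

lemma K_scale:
  assumes "f \<in> sum_space" "t \<ge> 0"
  shows "K t (\<lambda>x. c * f x) = \<bar>c\<bar> * K t f"
proof (cases "c = 0")
  case True
  then show ?thesis
    using K_scale_le[OF assms, of c] K_nonneg[OF sum_space_scale[OF assms(1), of c] assms(2)] by simp
next
  case False
  have "K t f \<le> \<bar>1/c\<bar> * K t (\<lambda>x. c * f x)"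
    using K_scale_le[OF sum_space_scale[OF assms(1), of c] assms(2), of "1/c"] False by simp
  then have "\<bar>c\<bar> * K t f \<le> K t (\<lambda>x. c * f x)"
    using False by (simp add: field_simps)
  with K_scale_le[OF assms, of c] show ?thesis by simp
qed

lemma K_mono:
  assumes "f \<in> sum_space" "0 \<le> s" "s \<le> t"
  shows "K s f \<le> K t f"
proof (rule K_greatest[OF assms(1)])
  fix g h assume gh: "g \<in> A0" "h \<in> A1" "f = (\<lambda>x. g x + h x)"
  have "s * N1 h \<le> t * N1 h"
    using assms gh by (intro mult_right_mono A1.nonneg)
  then show "K s f \<le> N0 g + t * N1 h"
    using K_le[OF gh assms(2)] by linarith
qed

text \<open>Convergence in the single norm \<open>K 1\<close> therefore forces convergence of
  \<open>K t\<close> for every \<open>t\<close>, as needed for completeness of the interpolation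
  space.\<close>

lemma K_le_max:
  assumes "f \<in> sum_space" "0 \<le> t"
  shows "K t f \<le> max 1 t * K 1 f"
proof -
  have "K t f / max 1 t \<le> K 1 f"
  proof (rule K_greatest[OF assms(1)])
    fix g h assume gh: "g \<in> A0" "h \<in> A1" "f = (\<lambda>x. g x + h x)"
    have "K t f \<le> N0 g + t * N1 h"
      using K_le[OF gh assms(2)] .
    also have "\<dots> \<le> max 1 t * N0 g + max 1 t * N1 h"
      using gh assms mult_right_mono[of 1 "max 1 t" "N0 g"] A0.nonneg[OF gh(1)] A1.nonneg[OF gh(2)]
      by (intro add_mono mult_right_mono) auto
    finally show "K t f / max 1 t \<le> N0 g + 1 * N1 h"
      by (simp add: divide_le_eq algebra_simps)
  qed
  moreover have "0 < max 1 t" by simp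
  ultimately show ?thesis by (simp only: pos_divide_le_eq mult.commute)
qed

text \<open>Monotone functions are Borel. The restriction to positive \<open>t\<close> is made
  because for negative \<open>t\<close> the infimum may run over a set unbounded below and then has
  no usable value.\<close>

lemma measurable_K:
  assumes "f \<in> sum_space"
  shows "(\<lambda>t. indicator {0<..} t * K t f) \<in> borel_measurable borel"
proof -
  have "mono (\<lambda>t. if t \<le> 0 then 0 else K t f)"
    by (auto simp: mono_def intro: K_mono[OF assms] K_nonneg[OF assms])
  then have "(\<lambda>t. if t \<le> 0 then 0 else K t f) \<in> borel_measurable borel"
    by (rule borel_measurable_mono)
  moreover have "(\<lambda>t. indicator {0<..} t * K t f) = (\<lambda>t. if t \<le> 0 then 0 else K t f)"
    by (auto simp: fun_eq_iff indicator_def)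
  ultimately show ?thesis by simp
qed

lemma sum_space_diff:
  assumes "f \<in> sum_space" "g \<in> sum_space"
  shows "(\<lambda>x. f x - g x) \<in> sum_space"
  using sum_space_add[OF assms(1) sum_space_scale[OF assms(2), of "-1"]] by simp

lemma K_diff_commute:
  assumes "f \<in> sum_space" "g \<in> sum_space" "t \<ge> 0"
  shows "K t (\<lambda>x. f x - g x) = K t (\<lambda>x. g x - f x)"
  using K_scale[OF sum_space_diff[OF assms(1,2)] assms(3), of "-1"] by simp

lemma K_diff_triangle:
  assumes "f \<in> sum_space" "g \<in> sum_space" "h \<in> sum_space" "t \<ge> 0"
  shows "K t (\<lambda>x. f x - h x) \<le> K t (\<lambda>x. f x - g x) + K t (\<lambda>x. g x - h x)"
  using K_add[OF sum_space_diff[OF assms(1,2)] sum_space_diff[OF assms(2,3)] assms(4)] by simp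

text \<open>Near-optimal decompositions of the increments of a fast subsequence give absolutely
  convergent series in \<open>A0\<close> and in \<open>A1\<close>, and their sums assemble the
  limit. A Cauchy sequence with a convergent subsequence converges.\<close>

lemma sum_space_complete:
  assumes c0: "seminorm_complete A0 N0" and c1: "seminorm_complete A1 N1"
    and F: "\<And>n. F n \<in> sum_space"
    and cauchy: "\<And>e. e > 0 \<Longrightarrow> \<exists>M. \<forall>m\<ge>M. \<forall>n\<ge>M. K 1 (\<lambda>x. F m x - F n x) < e"
  shows "\<exists>f\<in>sum_space. (\<lambda>n::nat. K 1 (\<lambda>x. F n x - f x)) \<longlonglongrightarrow> 0"
proof -
  obtain r where r: "strict_mono r"
    "\<And>i m n. m \<ge> r i \<Longrightarrow> n \<ge> r i \<Longrightarrow> K 1 (\<lambda>x. F m x - F n x) < (1/2)^i"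
  proof (rule fast_subseq[of "\<lambda>m n. K 1 (\<lambda>x. F m x - F n x)", OF cauchy])
    fix r :: "nat \<Rightarrow> nat"
    assume "strict_mono r"
      and "\<And>i m n. m \<ge> r i \<Longrightarrow> n \<ge> r i \<Longrightarrow> K 1 (\<lambda>x. F m x - F n x) < (1/2)^i"
    then show thesis by (rule that)
  qed
  have "\<exists>g h. g \<in> A0 \<and> h \<in> A1 \<and> (\<lambda>x. F (r (Suc i)) x - F (r i) x) = (\<lambda>x. g x + h x)
      \<and> N0 g + 1 * N1 h < 2 * (1/2)^i" for i
  proof -
    have "r i \<le> r (Suc i)" using r(1) by (simp add: strict_mono_less_eq)
    then have "K 1 (\<lambda>x. F (r (Suc i)) x - F (r i) x) < (1/2)^i"
      by (intro r(2)) auto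
    moreover obtain g h where "g \<in> A0" "h \<in> A1"
      "(\<lambda>x. F (r (Suc i)) x - F (r i) x) = (\<lambda>x. g x + h x)"
      "N0 g + 1 * N1 h < K 1 (\<lambda>x. F (r (Suc i)) x - F (r i) x) + (1/2)^i"
      using K_approx[OF sum_space_diff[OF F F], of "(1/2)^i" 1 "r (Suc i)" "r i"] by auto
    ultimately show ?thesis by (intro exI[of _ g] exI[of _ h]) auto
  qed
  then obtain g h where g: "\<And>i. g i \<in> A0" and h: "\<And>i. h i \<in> A1"
    and eq: "\<And>i. (\<lambda>x. F (r (Suc i)) x - F (r i) x) = (\<lambda>x. g i x + h i x)"
    and less: "\<And>i. N0 (g i) + 1 * N1 (h i) < 2 * (1/2)^i"
    by metis
  have geo: "summable (\<lambda>i. 2 * (1/2)^i :: real)"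
    by (intro summable_mult summable_geometric) auto
  have "norm (N0 (g i)) \<le> 2 * (1/2)^i" "norm (N1 (h i)) \<le> 2 * (1/2)^i" for i
    using less[of i] A0.nonneg[OF g, of i] A1.nonneg[OF h, of i] by simp_all
  then have "summable (\<lambda>i. N0 (g i))" "summable (\<lambda>i. N1 (h i))"
    by (auto intro!: summable_comparison_test'[OF geo, of 0] simp del: real_norm_def)
  note summs = this
  obtain G where G: "G \<in> A0" "(\<lambda>n. N0 (\<lambda>x. (\<Sum>i<n. g i x) - G x)) \<longlonglongrightarrow> 0"
    using A0.series_converges[of g, OF c0 g summs(1)] by (elim bexE)
  obtain H where H: "H \<in> A1" "(\<lambda>n. N1 (\<lambda>x. (\<Sum>i<n. h i x) - H x)) \<longlonglongrightarrow> 0"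
    using A1.series_converges[of h, OF c1 h summs(2)] by (elim bexE)
  define f where "f = (\<lambda>x. F (r 0) x + (G x + H x))"
  have f: "f \<in> sum_space"
    unfolding f_def by (intro sum_space_add F sum_spaceI[OF G(1) H(1)]) auto
  have tele: "F (r n) x = F (r 0) x + (\<Sum>i<n. g i x) + (\<Sum>i<n. h i x)" for n x
  proof (induction n)
    case (Suc n)
    with eq[of n] show ?case by (simp add: fun_eq_iff algebra_simps)
  qed simp
  define Z where "Z n = N0 (\<lambda>x. (\<Sum>i<n. g i x) - G x) + 1 * N1 (\<lambda>x. (\<Sum>i<n. h i x) - H x)" for n
  have "K 1 (\<lambda>x. F (r n) x - f x) \<le> Z n" for n
    unfolding Z_def
    by (rule K_le[OF A0.diff_mem[OF A0.sum_mem[of n g, OF g] G(1)]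
          A1.diff_mem[OF A1.sum_mem[of n h, OF h] H(1)]])
      (simp_all add: f_def tele[of n] fun_eq_iff)
  then have "norm (K 1 (\<lambda>x. F (r n) x - f x)) \<le> Z n" for n
    using K_nonneg[OF sum_space_diff[OF F f], of 1 "r n"] by simp
  moreover have "Z \<longlonglongrightarrow> 0"
    using tendsto_add[OF G(2) H(2)] by (simp add: Z_def[abs_def])
  ultimately have lim: "(\<lambda>n. K 1 (\<lambda>x. F (r n) x - f x)) \<longlonglongrightarrow> 0"
    by (rule Lim_null_comparison[OF always_eventually, OF allI])
  have "(\<lambda>n. K 1 (\<lambda>x. F n x - f x)) \<longlonglongrightarrow> 0"
  proof (rule LIMSEQ_I)
    fix e :: real assume "e > 0"
    obtain M where M: "\<And>m n. m \<ge> M \<Longrightarrow> n \<ge> M \<Longrightarrow> K 1 (\<lambda>x. F m x - F n x) < e/2"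
      using cauchy[of "e/2"] \<open>e > 0\<close> by auto
    obtain M' where M': "\<And>n. n \<ge> M' \<Longrightarrow> norm (K 1 (\<lambda>x. F (r n) x - f x) - 0) < e/2"
      using LIMSEQ_D[OF lim, of "e/2"] \<open>e > 0\<close> by auto
    have "norm (K 1 (\<lambda>x. F n x - f x) - 0) < e" if "n \<ge> M" for n
    proof -
      let ?k = "max M M'"
      have "r ?k \<ge> M" using seq_suble[OF r(1), of ?k] by simp
      then have "K 1 (\<lambda>x. F n x - F (r ?k) x) < e/2" using M that by blast
      moreover have "K 1 (\<lambda>x. F (r ?k) x - f x) < e/2" using M'[of ?k] by simp
      ultimately show ?thesis
        using K_diff_triangle[OF F F f, of 1 n "r ?k"] K_nonneg[OF sum_space_diff[OF F f], of 1 n]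
        by simp
    qed
    then show "\<exists>no. \<forall>n\<ge>no. norm (K 1 (\<lambda>x. F n x - f x) - 0) < e" by blast
  qed
  with f show ?thesis by blast
qed

end

section \<open>Minkowski's inequality and the real interpolation space\<close>

lemma powr_convex_nonneg:
  fixes x y u v q :: real
  assumes "q \<ge> 1" "x \<ge> 0" "y \<ge> 0" "u \<ge> 0" "v \<ge> 0" "u + v = 1"
  shows "(u * x + v * y) powr q \<le> u * x powr q + v * y powr q"
proof -
  have le: "w powr q \<le> w" if "0 \<le> w" "w \<le> 1" for w
    using powr_mono'[of 1 q w] that assms by (cases "w = 0") auto
  have u: "u \<le> 1" and v: "v \<le> 1" using assms by auto
  consider "x = 0" | "y = 0" | "x > 0" "y > 0" using assms by fastforce
  then show ?thesis
  proof cases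
    case 1
    then show ?thesis using assms le[OF assms(5) v] by (simp add: powr_mult mult_right_mono)
  next
    case 2
    then show ?thesis using assms le[OF assms(4) u] by (simp add: powr_mult mult_right_mono)
  next
    case 3
    have "1 - v = u" using assms by simp
    with 3 show ?thesis
      using convex_onD[OF powr_convex[OF assms(1)], of v x y] v assms(5) by simp
  qed
qed

text \<open>Convexity applied to \<open>x / a\<close> and \<open>y / b\<close> with weights
  \<open>a / (a + b)\<close> and \<open>b / (a + b)\<close>. When \<open>a\<close> and
  \<open>b\<close> bound two L^q norms, this is the pointwise form of Minkowski's
  inequality.\<close>

lemma powr_add_le_weighted:
  fixes a b x y q :: real
  assumes "q \<ge> 1" "x \<ge> 0" "y \<ge> 0" "a > 0" "b > 0"
  shows "(x + y) powr q \<le> (a + b) powr q * (a / (a + b) / a powr q) * x powr q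
    + (a + b) powr q * (b / (a + b) / b powr q) * y powr q"
proof -
  have eq: "(a / (a+b)) * (x/a) + (b / (a+b)) * (y/b) = (x + y) / (a + b)"
    using assms by (simp add: add_divide_distrib)
  have "(x + y) powr q = (a + b) powr q * ((a / (a+b)) * (x/a) + (b / (a+b)) * (y/b)) powr q"
    unfolding eq using assms by (simp add: powr_divide)
  also have "\<dots> \<le> (a + b) powr q * ((a / (a+b)) * (x/a) powr q + (b / (a+b)) * (y/b) powr q)"
    using assms add_divide_distrib[of a b "a + b"] by (intro mult_left_mono powr_convex_nonneg) simp_all
  finally show ?thesis using assms by (simp add: powr_divide algebra_simps)
qed

locale real_interp = interp_couple +
  fixes \<theta> q :: real
  assumes theta: "0 < \<theta>" "\<theta> < 1" and q1: "1 \<le> q"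
begin

abbreviation "I \<equiv> interp_integral A0 N0 A1 N1 \<theta> q"
abbreviation "X \<equiv> interp_space A0 N0 A1 N1 \<theta> q"
abbreviation "NX \<equiv> interp_norm A0 N0 A1 N1 \<theta> q"

definition W :: "('a \<Rightarrow> real) \<Rightarrow> real \<Rightarrow> real" where
  "W f t = (if t > 0 then (t powr (- \<theta>) * K t f) powr q / t else 0)"

lemma I_eq: "I f = (\<integral>\<^sup>+t. ennreal (W f t) \<partial>lborel)"
  unfolding interp_integral_def W_def by (intro nn_integral_cong) (auto simp: indicator_def)

lemma W_nonneg: "0 \<le> W f t"
  by (simp add: W_def)

lemma measurable_W [measurable]:
  assumes "f \<in> sum_space"
  shows "W f \<in> borel_measurable borel"
proof -
  note measurable_K[OF assms, measurable]
  have "W f = (\<lambda>t. indicator {0<..} t * ((t powr (- \<theta>) * (indicator {0<..} t * K t f)) powr q / t))"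
    by (auto simp: W_def fun_eq_iff indicator_def)
  also have "\<dots> \<in> borel_measurable borel" by measurable
  finally show ?thesis .
qed

lemma W_eq_weight:
  assumes "t > 0" "f \<in> sum_space"
  shows "W f t = t powr (- \<theta> * q - 1) * K t f powr q"
  using assms K_nonneg[OF assms(2), of t]
  by (simp add: W_def powr_mult powr_powr powr_diff powr_one)

text \<open>Integrates \<open>powr_add_le_weighted\<close>: its coefficients are such that
  \<open>?c * a powr q + ?d * b powr q\<close> collapses to \<open>(a + b) powr q\<close>.\<close>

lemma I_add:
  assumes f: "f \<in> sum_space" and g: "g \<in> sum_space"
    and a: "a > 0" and b: "b > 0"
    and If: "I f \<le> ennreal (a powr q)" and Ig: "I g \<le> ennreal (b powr q)"
  shows "I (\<lambda>x. f x + g x) \<le> ennreal ((a + b) powr q)"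
proof -
  let ?c = "(a + b) powr q * (a / (a + b) / a powr q)"
  let ?d = "(a + b) powr q * (b / (a + b) / b powr q)"
  note [measurable] = measurable_W[OF f] measurable_W[OF g]
  have c: "?c \<ge> 0" and d: "?d \<ge> 0" using a b by auto
  have le: "W (\<lambda>x. f x + g x) t \<le> ?c * W f t + ?d * W g t" for t
  proof (cases "t > 0")
    case True
    have "K t (\<lambda>x. f x + g x) powr q \<le> (K t f + K t g) powr q"
      using True q1 K_nonneg[OF sum_space_add[OF f g]] by (intro powr_mono2 K_add f g) auto
    also have "\<dots> \<le> ?c * K t f powr q + ?d * K t g powr q"
      using True by (intro powr_add_le_weighted q1 K_nonneg f g a b) auto
    finally have "t powr (- \<theta> * q - 1) * K t (\<lambda>x. f x + g x) powr q
        \<le> t powr (- \<theta> * q - 1) * (?c * K t f powr q + ?d * K t g powr q)"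
      by (intro mult_left_mono) auto
    then show ?thesis
      using True f g by (simp only: W_eq_weight sum_space_add[OF f g]) (simp add: algebra_simps)
  qed (simp add: W_def)
  have "ennreal (W (\<lambda>x. f x + g x) t) \<le> ennreal ?c * ennreal (W f t) + ennreal ?d * ennreal (W g t)" for t
  proof -
    have "ennreal (W (\<lambda>x. f x + g x) t) \<le> ennreal (?c * W f t + ?d * W g t)"
      by (rule ennreal_leI[OF le])
    also have "\<dots> = ennreal (?c * W f t) + ennreal (?d * W g t)"
      by (intro ennreal_plus mult_nonneg_nonneg c d W_nonneg)
    also have "\<dots> = ennreal ?c * ennreal (W f t) + ennreal ?d * ennreal (W g t)"
      by (simp only: ennreal_mult[OF c W_nonneg] ennreal_mult[OF d W_nonneg])
    finally show ?thesis .
  qed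
  then have "I (\<lambda>x. f x + g x) \<le> (\<integral>\<^sup>+t. ennreal ?c * ennreal (W f t) + ennreal ?d * ennreal (W g t) \<partial>lborel)"
    unfolding I_eq by (intro nn_integral_mono)
  also have "\<dots> = ennreal ?c * I f + ennreal ?d * I g"
    unfolding I_eq by (subst nn_integral_add) (auto simp: nn_integral_cmult)
  also have "\<dots> \<le> ennreal ?c * ennreal (a powr q) + ennreal ?d * ennreal (b powr q)"
    by (intro add_mono mult_left_mono If Ig) auto
  also have "\<dots> = ennreal (?c * a powr q) + ennreal (?d * b powr q)"
    by (simp only: ennreal_mult[OF c powr_ge_zero] ennreal_mult[OF d powr_ge_zero])
  also have "\<dots> = ennreal (?c * a powr q + ?d * b powr q)"
    by (intro ennreal_plus[symmetric] mult_nonneg_nonneg c d powr_ge_zero)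
  also have "?c * a powr q + ?d * b powr q = (a + b) powr q * (a / (a+b) + b / (a+b))"
    using a b by (simp add: distrib_left)
  also have "\<dots> = (a + b) powr q"
    using a b by (simp add: add_divide_distrib[symmetric])
  finally show ?thesis .
qed

lemma X_iff: "f \<in> X \<longleftrightarrow> f \<in> sum_space \<and> I f < \<infinity>"
  by (auto simp: interp_space_def sum_space_def)

lemma NX_nonneg: "0 \<le> NX f"
  by (simp add: interp_norm_def)

lemma I_eq_NX:
  assumes "f \<in> X"
  shows "I f = ennreal (NX f powr q)"
proof -
  have "NX f powr q = enn2real (I f)"
    using q1 by (simp add: interp_norm_def powr_powr)
  then show ?thesis using assms by (simp add: X_iff)
qed

lemma NX_le:
  assumes "I f \<le> ennreal (a powr q)" "a \<ge> 0"
  shows "NX f \<le> a"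
proof -
  have "enn2real (I f) \<le> a powr q"
    using assms enn2real_mono[of "I f" "ennreal (a powr q)"] by simp
  then have "NX f \<le> (a powr q) powr (1/q)"
    unfolding interp_norm_def using q1 by (intro powr_mono2) auto
  also have "\<dots> = a" using assms q1 by (simp add: powr_powr)
  finally show ?thesis .
qed

lemma X_add:
  assumes "f \<in> X" "g \<in> X"
  shows "(\<lambda>x. f x + g x) \<in> X" "NX (\<lambda>x. f x + g x) \<le> NX f + NX g"
proof -
  have fg: "f \<in> sum_space" "g \<in> sum_space" using assms by (auto simp: X_iff)
  \<comment> \<open>\<open>I_add\<close> asks for positive \<open>a\<close> and \<open>b\<close>,
    while a norm may vanish; hence the slack \<open>e\<close>.\<close>
  have bound: "I (\<lambda>x. f x + g x) \<le> ennreal (((NX f + e) + (NX g + e)) powr q)" if "e > 0" for e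
    using that NX_nonneg[of f] NX_nonneg[of g] q1 assms
    by (intro I_add fg) (auto simp: I_eq_NX intro!: ennreal_leI powr_mono2)
  show "(\<lambda>x. f x + g x) \<in> X"
    using sum_space_add[OF fg] bound[of 1] by (auto simp: X_iff intro: le_less_trans)
  show "NX (\<lambda>x. f x + g x) \<le> NX f + NX g"
  proof (rule field_le_epsilon)
    fix e :: real assume "e > 0"
    then show "NX (\<lambda>x. f x + g x) \<le> NX f + NX g + e"
      using NX_le[OF bound[of "e/2"]] NX_nonneg[of f] NX_nonneg[of g] by simp
  qed
qed

lemma I_scale:
  assumes "f \<in> sum_space"
  shows "I (\<lambda>x. c * f x) = ennreal (\<bar>c\<bar> powr q) * I f"
proof -
  note [measurable] = measurable_W[OF assms]
  have "W (\<lambda>x. c * f x) t = \<bar>c\<bar> powr q * W f t" for t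
  proof (cases "t > 0")
    case True
    then show ?thesis
      using assms K_nonneg[OF assms, of t]
      by (simp only: W_eq_weight sum_space_scale K_scale less_imp_le) (simp add: powr_mult)
  qed (simp add: W_def)
  then show ?thesis
    unfolding I_eq by (simp add: ennreal_mult W_nonneg nn_integral_cmult)
qed

lemma X_scale:
  assumes "f \<in> X"
  shows "(\<lambda>x. c * f x) \<in> X" "NX (\<lambda>x. c * f x) = \<bar>c\<bar> * NX f"
proof -
  have f: "f \<in> sum_space" "I f < \<infinity>" using assms by (auto simp: X_iff)
  have eq: "I (\<lambda>x. c * f x) = ennreal (\<bar>c\<bar> powr q) * I f" by (rule I_scale[OF f(1)])
  show "(\<lambda>x. c * f x) \<in> X"
    using f eq by (auto simp: X_iff sum_space_scale ennreal_mult_less_top)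
  show "NX (\<lambda>x. c * f x) = \<bar>c\<bar> * NX f"
    using q1 by (simp add: interp_norm_def eq enn2real_mult powr_mult powr_powr)
qed

text \<open>By monotonicity of \<open>K\<close>, the integrand on [1, 2] is bounded below by a
  multiple of \<open>K 1 f powr q\<close>. This embedding into the sum space transports Cauchy
  sequences and yields definiteness of the norm.\<close>

lemma K1_le_NX:
  assumes "f \<in> X"
  shows "K 1 f \<le> 2 powr \<theta> * 2 powr (1/q) * NX f"
proof -
  have f: "f \<in> sum_space" using assms by (simp add: X_iff)
  note [measurable] = measurable_W[OF f]
  let ?c = "(2 powr (- \<theta>) * K 1 f) powr q / 2"
  have K1: "K 1 f \<ge> 0" by (rule K_nonneg[OF f]) simp
  have "ennreal ?c * indicator {1..2} t \<le> ennreal (W f t)" for t :: real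
  proof (cases "t \<in> {1..2}")
    case True
    then have "2 powr (- \<theta>) * K 1 f \<le> t powr (- \<theta>) * K t f"
      using theta K1 by (intro mult_mono powr_mono2' K_mono f) auto
    then have "(2 powr (- \<theta>) * K 1 f) powr q \<le> (t powr (- \<theta>) * K t f) powr q"
      using K1 q1 by (intro powr_mono2) auto
    then have "?c \<le> (t powr (- \<theta>) * K t f) powr q / t"
      using True by (intro frac_le) auto
    then have "?c \<le> W f t" using True by (simp add: W_def)
    with True show ?thesis by (simp add: ennreal_leI)
  qed simp
  then have "(\<integral>\<^sup>+t. ennreal ?c * indicator {1..2::real} t \<partial>lborel) \<le> I f"
    unfolding I_eq by (intro nn_integral_mono)
  then have "ennreal ?c \<le> ennreal (NX f powr q)"
    using I_eq_NX[OF assms] by (simp add: nn_integral_cmult_indicator)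
  then have "(2 powr (- \<theta>) * K 1 f) powr q \<le> 2 * NX f powr q" by simp
  then have "((2 powr (- \<theta>) * K 1 f) powr q) powr (1/q) \<le> (2 * NX f powr q) powr (1/q)"
    using q1 by (intro powr_mono2) auto
  then have "2 powr (- \<theta>) * K 1 f \<le> 2 powr (1/q) * NX f"
    using q1 K1 NX_nonneg[of f] by (simp add: powr_powr powr_mult)
  then show ?thesis by (simp add: powr_minus field_simps)
qed

text \<open>The limit is found in the sum space, where \<open>K t\<close> of the differences
  converges for each \<open>t > 0\<close>. Fatou's lemma in \<open>t\<close> then carries the Cauchy
  bound over to the limit.\<close>

lemma X_complete:
  assumes c0: "seminorm_complete A0 N0" and c1: "seminorm_complete A1 N1"
  shows "seminorm_complete X NX"
  unfolding seminorm_complete_def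
proof (intro allI impI, elim conjE)
  fix F :: "nat \<Rightarrow> 'a \<Rightarrow> real"
  assume FX: "\<forall>n. F n \<in> X"
    and cauchy: "\<forall>e>0. \<exists>M. \<forall>m\<ge>M. \<forall>n\<ge>M. NX (\<lambda>x. F m x - F n x) < e"
  have F: "F n \<in> sum_space" for n using FX by (simp add: X_iff)
  have diffX: "(\<lambda>x. F m x - F n x) \<in> X" for m n
    using X_add(1)[OF _ X_scale(1)[of _ "-1"], of "F m" "F n"] FX by simp
  let ?C = "2 powr \<theta> * 2 powr (1/q)"
  have C: "?C > 0" by simp
  have Kcauchy: "\<exists>M. \<forall>m\<ge>M. \<forall>n\<ge>M. K 1 (\<lambda>x. F m x - F n x) < e" if "e > 0" for e
  proof -
    obtain M where M: "\<And>m n. m \<ge> M \<Longrightarrow> n \<ge> M \<Longrightarrow> NX (\<lambda>x. F m x - F n x) < e / ?C"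
      using cauchy[rule_format, OF divide_pos_pos[OF \<open>e > 0\<close> C]] by blast
    have "K 1 (\<lambda>x. F m x - F n x) < e" if "m \<ge> M" "n \<ge> M" for m n
      using K1_le_NX[OF diffX, of m n] M[OF that] C by (simp add: field_simps)
    then show ?thesis by blast
  qed
  obtain f where f: "f \<in> sum_space" and lim: "(\<lambda>n. K 1 (\<lambda>x. F n x - f x)) \<longlonglongrightarrow> 0"
    using bexE[OF sum_space_complete[of F, OF c0 c1 F Kcauchy]] by blast
  have Klim: "(\<lambda>n. K t (\<lambda>x. F m x - F n x)) \<longlonglongrightarrow> K t (\<lambda>x. F m x - f x)" if "t > 0" for t m
  proof -
    have "norm (K t (\<lambda>x. F m x - F n x) - K t (\<lambda>x. F m x - f x)) \<le> max 1 t * K 1 (\<lambda>x. F n x - f x)" for n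
    proof -
      have "K t (\<lambda>x. F m x - F n x) \<le> K t (\<lambda>x. F m x - f x) + K t (\<lambda>x. f x - F n x)"
        "K t (\<lambda>x. F m x - f x) \<le> K t (\<lambda>x. F m x - F n x) + K t (\<lambda>x. F n x - f x)"
        using that by (intro K_diff_triangle F f; simp)+
      moreover have "K t (\<lambda>x. f x - F n x) = K t (\<lambda>x. F n x - f x)"
        using that by (intro K_diff_commute F f) auto
      moreover have "K t (\<lambda>x. F n x - f x) \<le> max 1 t * K 1 (\<lambda>x. F n x - f x)"
        using that by (intro K_le_max sum_space_diff F f) auto
      ultimately show ?thesis unfolding real_norm_def by linarith
    qed
    moreover have "(\<lambda>n. max 1 t * K 1 (\<lambda>x. F n x - f x)) \<longlonglongrightarrow> 0"
      using tendsto_mult[OF tendsto_const lim] by simp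
    ultimately have "(\<lambda>n. K t (\<lambda>x. F m x - F n x) - K t (\<lambda>x. F m x - f x)) \<longlonglongrightarrow> 0"
      by (rule Lim_null_comparison[OF always_eventually, OF allI])
    then show ?thesis by (simp add: LIM_zero_iff)
  qed
  have bound: "I (\<lambda>x. F m x - f x) \<le> ennreal (e powr q)"
    if "e > 0" and M: "\<And>n. n \<ge> M \<Longrightarrow> NX (\<lambda>x. F m x - F n x) < e" for e m M
  proof -
    have meas: "W (\<lambda>x. F m x - F n x) \<in> borel_measurable lborel" for n
      using measurable_W[OF sum_space_diff[OF F F]] by simp
    have Wlim: "(\<lambda>n. ennreal (W (\<lambda>x. F m x - F n x) t)) \<longlonglongrightarrow> ennreal (W (\<lambda>x. F m x - f x) t)" for t
    proof (cases "t > 0")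
      case True
      have "(\<lambda>n. t powr (- \<theta> * q - 1) * K t (\<lambda>x. F m x - F n x) powr q)
          \<longlonglongrightarrow> t powr (- \<theta> * q - 1) * K t (\<lambda>x. F m x - f x) powr q"
        using True q1 K_nonneg[OF sum_space_diff[OF F F], of t]
        by (intro tendsto_mult tendsto_const tendsto_powr2 Klim) auto
      with True show ?thesis
        by (intro tendsto_ennrealI) (simp only: W_eq_weight sum_space_diff F f)
    qed (simp add: W_def)
    have "I (\<lambda>x. F m x - f x) = (\<integral>\<^sup>+t. liminf (\<lambda>n. ennreal (W (\<lambda>x. F m x - F n x) t)) \<partial>lborel)"
      unfolding I_eq by (intro nn_integral_cong lim_imp_Liminf[symmetric] Wlim) auto
    also have "\<dots> \<le> liminf (\<lambda>n. I (\<lambda>x. F m x - F n x))"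
      unfolding I_eq by (intro nn_integral_liminf) (use meas in measurable)
    also have "\<dots> \<le> liminf (\<lambda>n. ennreal (e powr q))"
    proof (intro Liminf_mono eventually_sequentiallyI[of M])
      fix n assume "n \<ge> M"
      with M have "NX (\<lambda>x. F m x - F n x) powr q \<le> e powr q"
        using q1 by (intro powr_mono2) (auto simp: NX_nonneg less_imp_le)
      then show "I (\<lambda>x. F m x - F n x) \<le> ennreal (e powr q)"
        unfolding I_eq_NX[OF diffX] by (rule ennreal_leI)
    qed
    also have "\<dots> = ennreal (e powr q)" by (intro lim_imp_Liminf) auto
    finally show ?thesis .
  qed
  obtain M where M: "\<And>m n. m \<ge> M \<Longrightarrow> n \<ge> M \<Longrightarrow> NX (\<lambda>x. F m x - F n x) < 1"
    using cauchy[rule_format, of 1] by auto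
  have "I (\<lambda>x. F M x - f x) < \<infinity>"
    using bound[of 1 M M] M by (auto intro: le_less_trans)
  then have "(\<lambda>x. F M x - f x) \<in> X" by (simp add: X_iff sum_space_diff F f)
  then have "f \<in> X"
    using X_add(1)[OF FX[rule_format, of M] X_scale(1)[of "\<lambda>x. F M x - f x" "-1"]] by simp
  moreover have "(\<lambda>n. NX (\<lambda>x. F n x - f x)) \<longlonglongrightarrow> 0"
  proof (rule LIMSEQ_I)
    fix e :: real assume "e > 0"
    then obtain M where M: "\<And>m n. m \<ge> M \<Longrightarrow> n \<ge> M \<Longrightarrow> NX (\<lambda>x. F m x - F n x) < e/2"
      using cauchy[rule_format, of "e/2"] by auto
    have "norm (NX (\<lambda>x. F m x - f x) - 0) < e" if "m \<ge> M" for m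
      using NX_le[OF bound[of "e/2" M m]] M[OF that] \<open>e > 0\<close> NX_nonneg[of "\<lambda>x. F m x - f x"] by auto
    then show "\<exists>no. \<forall>n\<ge>no. norm (NX (\<lambda>x. F n x - f x) - 0) < e" by blast
  qed
  ultimately show "\<exists>f\<in>X. (\<lambda>n. NX (\<lambda>x. F n x - f x)) \<longlonglongrightarrow> 0" by blast
qed

text \<open>Near 0 the bound \<open>c * t\<close> is integrable against the weight because \<theta>
  < 1; at infinity a constant excess over \<open>K t v\<close> is integrable because \<theta> >
  0.\<close>

lemma X_memI:
  assumes f: "f \<in> sum_space" and v: "v \<in> X"
    and small: "\<And>t. 0 < t \<Longrightarrow> t \<le> 1 \<Longrightarrow> K t f \<le> c * t"
    and large: "\<And>t. 1 \<le> t \<Longrightarrow> K t f \<le> K t v + c"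
  shows "f \<in> X"
proof -
  have vs: "v \<in> sum_space" "I v < \<infinity>" using v by (auto simp: X_iff)
  note [measurable] = measurable_W[OF f] measurable_W[OF vs(1)]
  let ?e = "- \<theta> * q - 1"
  have c: "c \<ge> 0" using small[of 1] K_nonneg[OF f, of 1] by simp
  define A B where "A = (\<lambda>t. indicator {0..1} t * t powr (?e + q) :: real)"
    and "B = (\<lambda>t. indicator {1..} t * t powr ?e :: real)"
  have [measurable]: "A \<in> borel_measurable borel" "B \<in> borel_measurable borel"
    unfolding A_def B_def by measurable
  have fin: "(\<integral>\<^sup>+t. ennreal (A t) \<partial>lborel) < \<infinity>" "(\<integral>\<^sup>+t. ennreal (B t) \<partial>lborel) < \<infinity>"
  proof -
    have "\<theta> * q < 1 * q" using theta q1 by (intro mult_strict_right_mono) auto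
    then have "?e + q > -1" by simp
    from nn_integral_has_integral_lebesgue[OF _ has_integral_powr_from_0[OF this, of 1]]
    show "(\<integral>\<^sup>+t. ennreal (A t) \<partial>lborel) < \<infinity>" unfolding A_def by simp
    have "?e < -1" using theta q1 by simp
    from nn_integral_has_integral_lebesgue[OF _ has_integral_powr_to_inf[OF this, of 1]]
    show "(\<integral>\<^sup>+t. ennreal (B t) \<partial>lborel) < \<infinity>" unfolding B_def by simp
  qed
  have le: "W f t \<le> c powr q * A t + (2 powr q * W v t + 2 powr q * c powr q * B t)" for t
  proof -
    consider "t \<le> 0" | "0 < t" "t \<le> 1" | "1 < t" by linarith
    then show ?thesis
    proof cases
      case 1
      then show ?thesis by (simp add: W_def A_def B_def)
    next
      case 2
      have "K t f powr q \<le> (c * t) powr q"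
        using 2 q1 K_nonneg[OF f, of t] by (intro powr_mono2 small) auto
      then have "W f t \<le> c powr q * A t"
        using 2 c mult_left_mono[of "K t f powr q" "c powr q * t powr q" "t powr ?e"]
        by (simp add: W_eq_weight f A_def powr_mult powr_add mult_ac)
      moreover have "0 \<le> B t" by (simp add: B_def)
      ultimately show ?thesis
        using W_nonneg[of v t] by (simp add: add_increasing2)
    next
      case 3
      have Kv: "K t v \<ge> 0" using 3 by (intro K_nonneg vs) auto
      have "K t f powr q \<le> (K t v + c) powr q"
        using 3 q1 K_nonneg[OF f, of t] by (intro powr_mono2 large) auto
      also have "\<dots> \<le> (2 * max (K t v) c) powr q"
        using Kv c q1 by (intro powr_mono2) auto
      also have "\<dots> \<le> 2 powr q * (K t v powr q + c powr q)"
        using Kv c by (auto simp: powr_mult max_def)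
      finally have "t powr ?e * K t f powr q \<le> t powr ?e * (2 powr q * (K t v powr q + c powr q))"
        by (intro mult_left_mono) auto
      then show ?thesis
        using 3 by (simp only: W_eq_weight f vs) (simp add: A_def B_def algebra_simps)
    qed
  qed
  have "I f \<le> (\<integral>\<^sup>+t. ennreal (c powr q) * ennreal (A t) + (ennreal (2 powr q) * ennreal (W v t)
      + ennreal (2 powr q * c powr q) * ennreal (B t)) \<partial>lborel)"
    unfolding I_eq
  proof (intro nn_integral_mono)
    fix t
    have "0 \<le> A t" "0 \<le> B t" by (auto simp: A_def B_def)
    then show "ennreal (W f t) \<le> ennreal (c powr q) * ennreal (A t) + (ennreal (2 powr q) * ennreal (W v t)
      + ennreal (2 powr q * c powr q) * ennreal (B t))"
      using le[of t] W_nonneg[of v t]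
      by (simp add: ennreal_mult[symmetric] ennreal_plus[symmetric] del: ennreal_plus)
  qed
  also have "\<dots> = ennreal (c powr q) * (\<integral>\<^sup>+t. ennreal (A t) \<partial>lborel) + (ennreal (2 powr q) * I v
      + ennreal (2 powr q * c powr q) * (\<integral>\<^sup>+t. ennreal (B t) \<partial>lborel))"
    unfolding I_eq by (simp add: nn_integral_add nn_integral_cmult)
  also have "\<dots> < \<infinity>" using fin vs(2) by (auto simp: ennreal_mult_less_top)
  finally show ?thesis using f by (simp add: X_iff)
qed

lemma zero_X: "(\<lambda>x. 0) \<in> X"
proof -
  have z: "(\<lambda>x. 0) \<in> sum_space" using sum_space_0 A0.zero_mem by auto
  show ?thesis using I_scale[OF z, of 0] z by (simp add: X_iff)
qed

text \<open>\<open>X_memI\<close> with comparison function 0: for small \<open>t\<close> all of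
  \<open>f\<close> is put into \<open>A1\<close>, for large \<open>t\<close> all of it into
  \<open>A0\<close>.\<close>

lemma inter_subset_X: "A0 \<inter> A1 \<subseteq> X"
proof
  fix f assume f: "f \<in> A0 \<inter> A1"
  have fs: "f \<in> sum_space" using f sum_space_0 by auto
  have Kz: "K t (\<lambda>x. 0) \<ge> 0" if "t \<ge> 0" for t
    using that zero_X by (intro K_nonneg) (simp_all add: X_iff)
  show "f \<in> X"
  proof (rule X_memI[OF fs zero_X, of "max (N0 f) (N1 f)"])
    fix t :: real assume t: "0 < t" "t \<le> 1"
    have "K t f \<le> N0 (\<lambda>x. 0) + t * N1 f" using f t by (intro K_le A0.zero_mem) auto
    also have "\<dots> \<le> max (N0 f) (N1 f) * t"
      using t by (simp add: A0.N_zero mult.commute)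
    finally show "K t f \<le> max (N0 f) (N1 f) * t" .
  next
    fix t :: real assume t: "1 \<le> t"
    have "K t f \<le> N0 f + t * N1 (\<lambda>x. 0)" using f t by (intro K_le A1.zero_mem) auto
    then show "K t f \<le> K t (\<lambda>x. 0) + max (N0 f) (N1 f)"
      using Kz[of t] t by (simp add: A1.N_zero)
  qed
qed

text \<open>
  Since the remainder \<open>g\<close> lies in \<open>A0\<close> it only affects large \<open>t\<close> by a bounded amount, while for
  small \<open>t\<close> the functional of \<open>h \<in> A1\<close> is linear in \<open>t\<close>.
\<close>
lemma A1_part_in_X:
  assumes v: "v \<in> X" and g: "g \<in> A0" and h: "h \<in> A1" and eq: "v = (\<lambda>x. g x + h x)"
  shows "h \<in> X"
proof (rule X_memI[OF _ v, of h "max (N0 g) (N1 h)"])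
  have vs: "v \<in> sum_space" using v by (simp add: X_iff)
  show hs: "h \<in> sum_space" using h sum_space_1 by auto
  {
    fix t :: real assume t: "0 < t" "t \<le> 1"
    have "K t h \<le> N0 (\<lambda>x. 0) + t * N1 h" using h t by (intro K_le A0.zero_mem) auto
    also have "\<dots> \<le> max (N0 g) (N1 h) * t"
      using t by (simp add: A0.N_zero mult.commute)
    finally show "K t h \<le> max (N0 g) (N1 h) * t" .
  next
    fix t :: real assume t: "1 \<le> t"
    have "K t (\<lambda>x. - g x) \<le> N0 (\<lambda>x. - g x) + t * N1 (\<lambda>x. 0)"
      using g t by (intro K_le A0.minus_mem A1.zero_mem) auto
    moreover have "K t h \<le> K t v + K t (\<lambda>x. - g x)"
      using K_add[OF vs sum_spaceI[OF A0.minus_mem[OF g] A1.zero_mem], of "\<lambda>x. - g x" t] t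
      by (simp add: eq)
    ultimately show "K t h \<le> K t v + max (N0 g) (N1 h)"
      using g by (simp add: A0.N_minus A1.N_zero)
  }
qed

end

section \<open>The torus\<close>

lemma space_torus [simp]: "space torus = cbox 0 1"
  by (simp add: torus_def)

lemma emeasure_torus: "emeasure (torus :: (real ^ 'n) measure) (cbox 0 1) = 1"
proof -
  have "emeasure (torus :: (real ^ 'n) measure) (cbox 0 1) = emeasure lborel (cbox 0 1 :: (real ^ 'n) set)"
    by (simp add: torus_def emeasure_restrict_space)
  also have "\<dots> = ennreal (\<Prod>b\<in>Basis. (1 - 0 :: real ^ 'n) \<bullet> b)"
    by (subst emeasure_lborel_cbox) (auto simp: Basis_vec_def inner_axis)
  also have "(\<Prod>b\<in>Basis. (1 - 0 :: real ^ 'n) \<bullet> b) = 1"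
    by (intro prod.neutral) (auto simp: Basis_vec_def inner_axis)
  finally show ?thesis by simp
qed

lemma prob_space_torus: "prob_space (torus :: (real ^ 'n) measure)"
  by standard (simp add: emeasure_torus)

interpretation torus: prob_space "torus :: (real ^ 'n) measure"
  by (rule prob_space_torus)

lemma measurable_torusI: "f \<in> borel_measurable lebesgue \<Longrightarrow> f \<in> borel_measurable torus"
  unfolding torus_def by (rule measurable_restrict_space1)

lemma borel_measurable_torusI: "f \<in> borel_measurable borel \<Longrightarrow> f \<in> borel_measurable torus"
  by (intro measurable_torusI measurable_completion) simp

lemma continuous_measurable_lebesgue:
  "continuous_on UNIV f \<Longrightarrow> f \<in> borel_measurable lebesgue"
  by (intro measurable_completion) (simp add: borel_measurable_continuous_onI)

lemma continuous_measurable_torus: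
  "continuous_on UNIV f \<Longrightarrow> f \<in> borel_measurable torus"
  by (intro measurable_torusI continuous_measurable_lebesgue)

lemma continuous_integrable_torus:
  fixes f :: "real ^ 'n \<Rightarrow> 'b::{banach, second_countable_topology}"
  assumes "continuous_on UNIV f"
  shows "integrable torus f"
proof -
  have "compact (f ` cbox 0 1)"
    by (intro compact_continuous_image continuous_on_subset[OF assms]) auto
  then have "bounded (f ` cbox 0 1)" by (rule compact_imp_bounded)
  then obtain B where "\<forall>y\<in>f ` cbox 0 1. norm y \<le> B"
    unfolding bounded_iff by auto
  then have "AE x in torus. norm (f x) \<le> B" by (intro AE_I2) simp
  then show ?thesis
    by (rule torus.integrable_const_bound[OF _ continuous_measurable_torus[OF assms]])
qed

lemma LINT_torus_lborel:
  fixes f :: "real ^ 'n \<Rightarrow> 'b::{banach, second_countable_topology}"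
  assumes "f \<in> borel_measurable borel"
  shows "(LINT x|torus. f x) = (LINT x|lborel. indicator (cbox 0 1) x *\<^sub>R f x)"
  using assms unfolding torus_def
  by (subst integral_restrict_space) (auto intro!: integral_completion)

text \<open>Cut the cube at \<open>x $ j = 1 - t\<close>. The lower piece \<open>A\<close> moves by
  \<open>t\<close> onto \<open>A'\<close>; the upper piece \<open>B\<close>, wrapped around by
  periodicity, moves by \<open>t - 1\<close> onto \<open>B'\<close>; and the images fill the cube up
  to null sets. Both the vanishing integrals of characters and integration by parts rest on
  this.\<close>

lemma LINT_torus_translate:
  fixes f :: "real ^ 'n \<Rightarrow> 'b::{banach, second_countable_topology}"
  assumes cont: "continuous_on UNIV f" and per: "periodic f" and t: "0 \<le> t" "t \<le> 1"
  shows "(LINT x|torus. f (x + axis j t)) = (LINT x|torus. f x)"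
proof -
  have fm [measurable]: "f \<in> borel_measurable borel"
    using cont by (rule borel_measurable_continuous_onI)
  let ?C = "cbox 0 1 :: (real ^ 'n) set"
  define A B A' B' where "A = {x \<in> ?C. x $ j < 1 - t}" and "B = {x \<in> ?C. 1 - t \<le> x $ j}"
    and "A' = {x \<in> ?C. t \<le> x $ j \<and> x $ j < 1}" and "B' = {x \<in> ?C. x $ j \<le> t}"
  have [measurable]: "A \<in> sets borel" "B \<in> sets borel" "A' \<in> sets borel" "B' \<in> sets borel"
    unfolding A_def B_def A'_def B'_def by measurable
  have int: "integrable lborel (\<lambda>x. indicator S x *\<^sub>R f (x + c))"
    if [measurable]: "S \<in> sets borel" and "S \<subseteq> ?C" for S c
  proof -
    have "continuous_on UNIV (\<lambda>x. f (x + c))"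
      by (intro continuous_on_compose2[OF cont] continuous_intros) auto
    then have "continuous_on ?C (\<lambda>x. f (x + c))"
      by (rule continuous_on_subset) simp
    then have "integrable lborel (\<lambda>x. indicator ?C x *\<^sub>R f (x + c))"
      by (rule borel_integrable_compact[OF compact_cbox])
    from integrable_mult_indicator[OF _ this, of S] that(1)
    have "integrable lborel (\<lambda>x. indicat_real S x *\<^sub>R indicat_real ?C x *\<^sub>R f (x + c))" by simp
    moreover have "(\<lambda>x. indicat_real S x *\<^sub>R indicat_real ?C x *\<^sub>R f (x + c)) = (\<lambda>x. indicator S x *\<^sub>R f (x + c))"
      using that(2) by (auto simp: indicator_def fun_eq_iff)
    ultimately show ?thesis by (simp only:)
  qed
  have shift: "(LINT x|lborel. indicator S (x + c) *\<^sub>R f (x + c)) = (LINT x|lborel. indicator S x *\<^sub>R f x)"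
    if [measurable]: "S \<in> sets borel" for S and c :: "real ^ 'n"
  proof -
    have "(LINT x|lborel. indicator S x *\<^sub>R f x) = (LINT x|distr lborel borel ((+) c). indicator S x *\<^sub>R f x)"
      by (simp only: lborel_distr_plus)
    also have "\<dots> = (LINT x|lborel. indicator S (c + x) *\<^sub>R f (c + x))"
      by (rule integral_distr) measurable
    finally show ?thesis by (simp only: add.commute)
  qed
  have per1: "f (x + axis j t) = f (x + axis j (t - 1))" for x
  proof -
    have "axis j t = axis j (t - 1) + (axis j 1 :: real ^ 'n)"
      by (simp add: vec_eq_iff axis_def)
    then show ?thesis
      using per by (simp add: periodic_def add.assoc[symmetric])
  qed
  have C_iff: "y \<in> ?C \<longleftrightarrow> (0 \<le> y $ j \<and> y $ j \<le> 1) \<and> (\<forall>i. i \<noteq> j \<longrightarrow> 0 \<le> y $ i \<and> y $ i \<le> 1)" for y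
    unfolding mem_box_cart by (metis one_index zero_index)
  have comp: "(x + axis j s) $ j = x $ j + s" "i \<noteq> j \<Longrightarrow> (x + axis j s) $ i = x $ i" for x :: "real ^ 'n" and s i
    by (auto simp: axis_def)
  have "x \<in> A \<longleftrightarrow> x + axis j t \<in> A'" for x
    unfolding A_def A'_def mem_Collect_eq C_iff comp(1) using t comp(2)[of _ x t] by auto
  then have A: "(indicator A x :: real) = indicator A' (x + axis j t)" for x
    by (simp add: indicator_def)
  have "x \<in> B \<longleftrightarrow> x + axis j (t - 1) \<in> B'" for x
    unfolding B_def B'_def mem_Collect_eq C_iff comp(1) using t comp(2)[of _ x "t - 1"] by auto
  then have B: "(indicator B x :: real) = indicator B' (x + axis j (t - 1))" for x
    by (simp add: indicator_def)
  have "(LINT x|torus. f (x + axis j t)) = (LINT x|lborel. indicator A x *\<^sub>R f (x + axis j t) + indicator B x *\<^sub>R f (x + axis j t))"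
  proof -
    have "indicator ?C x *\<^sub>R f (x + axis j t) = indicator A x *\<^sub>R f (x + axis j t) + indicator B x *\<^sub>R f (x + axis j t)" for x
      by (cases "x $ j < 1 - t") (simp_all add: A_def B_def indicator_def)
    then show ?thesis by (subst LINT_torus_lborel) simp_all
  qed
  also have "\<dots> = (LINT x|lborel. indicator A x *\<^sub>R f (x + axis j t)) + (LINT x|lborel. indicator B x *\<^sub>R f (x + axis j t))"
    by (intro Bochner_Integration.integral_add int) (auto simp: A_def B_def)
  also have "(LINT x|lborel. indicator A x *\<^sub>R f (x + axis j t)) = (LINT x|lborel. indicator A' x *\<^sub>R f x)"
    unfolding A by (rule shift) measurable
  also have "(LINT x|lborel. indicator B x *\<^sub>R f (x + axis j t)) = (LINT x|lborel. indicator B' x *\<^sub>R f x)"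
    unfolding B per1 by (rule shift) measurable
  also have "(LINT x|lborel. indicator A' x *\<^sub>R f x) + (LINT x|lborel. indicator B' x *\<^sub>R f x)
      = (LINT x|lborel. indicator A' x *\<^sub>R f x + indicator B' x *\<^sub>R f x)"
    by (intro Bochner_Integration.integral_add[symmetric] int[of _ 0, simplified]) (auto simp: A'_def B'_def)
  \<comment> \<open>At worst the slice \<open>x $ j = t\<close> is counted twice and the face
    \<open>x $ j = 1\<close> is missed; both are null.\<close>
  also have "\<dots> = (LINT x|lborel. indicator ?C x *\<^sub>R f x)"
  proof (intro integral_cong_AE)
    have "negligible {x :: real ^ 'n. x $ j = s}" for s
      using negligible_standard_hyperplane[of "axis j 1 :: real ^ 'n" s] by (simp add: inner_axis axis_in_Basis_iff)
    then have "{x :: real ^ 'n. x $ j = t} \<in> null_sets lborel" "{x :: real ^ 'n. x $ j = 1} \<in> null_sets lborel"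
      by (auto simp: negligible_iff_null_sets null_sets_completion_iff)
    then have "AE x::real ^ 'n in lborel. x $ j \<noteq> t" "AE x::real ^ 'n in lborel. x $ j \<noteq> 1"
      by (auto dest!: AE_not_in)
    then show "AE x in lborel. indicator A' x *\<^sub>R f x + indicator B' x *\<^sub>R f x = indicator ?C x *\<^sub>R f x"
    proof eventually_elim
      case (elim x)
      then show ?case
        using t by (auto simp: A'_def B'_def indicator_def mem_box_cart dest: spec[of _ j])
    qed
  qed measurable
  also have "\<dots> = (LINT x|torus. f x)"
    by (rule LINT_torus_lborel[symmetric]) measurable
  finally show ?thesis .
qed

section \<open>Characters and Fourier coefficients\<close>

definition chr :: "int ^ 'n \<Rightarrow> real ^ 'n \<Rightarrow> complex" where
  "chr k x = cis (2 * pi * (\<Sum>i\<in>UNIV. of_int (k $ i) * x $ i))"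

lemma fourier_coeff_chr: "fourier_coeff f k = (LINT x|torus. chr (- k) x * complex_of_real (f x))"
  by (simp add: fourier_coeff_def chr_def sum_negf)

lemma norm_chr [simp]: "norm (chr k x) = 1"
  by (simp add: chr_def)

lemma chr_0 [simp]: "chr 0 x = 1"
  by (simp add: chr_def)

lemma chr_add: "chr (k + l) x = chr k x * chr l x"
  by (simp add: chr_def cis_mult distrib_left distrib_right sum.distrib)

lemma chr_minus: "chr (- k) x = cnj (chr k x)"
  by (simp add: chr_def cis_cnj sum_negf)

lemma chr_plus: "chr k (x + y) = chr k x * chr k y"
  by (simp add: chr_def cis_mult distrib_left sum.distrib)

lemma chr_axis: "chr k (axis j t) = cis (2 * pi * (of_int (k $ j) * t))"
proof -
  have "(\<Sum>i\<in>UNIV. of_int (k $ i) * axis j t $ i) = (\<Sum>i\<in>UNIV. if i = j then of_int (k $ j) * t else 0)"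
    by (intro sum.cong) (auto simp: axis_def)
  then show ?thesis by (simp add: chr_def)
qed

lemma periodic_chr: "periodic (chr k)"
  by (simp add: periodic_def chr_plus chr_axis cis_multiple_2pi Ints_of_int)

lemma continuous_on_chr [continuous_intros]: "continuous_on S (chr k)"
  unfolding chr_def by (intro continuous_intros)

lemma measurable_chr [measurable]: "chr k \<in> borel_measurable torus"
  by (intro continuous_measurable_torus continuous_intros)

text \<open>Shifting by half a period along a coordinate \<open>j\<close> with
  \<open>k $ j \<noteq> 0\<close> flips the sign of the character but preserves its
  integral.\<close>

lemma LINT_chr: "(LINT x|torus. chr k x) = (if k = 0 then 1 else 0)"
proof (cases "k = 0")
  case True
  then show ?thesis using torus.prob_space by (simp add: torus.prob_space[simplified])
next
  case False
  then obtain j where j: "k $ j \<noteq> 0" by (auto simp: vec_eq_iff)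
  define t where "t = 1 / (2 * \<bar>of_int (k $ j)\<bar> :: real)"
  have "\<bar>of_int (k $ j)\<bar> \<ge> (1::real)" using j by linarith
  then have t: "0 \<le> t" "t \<le> 1" by (auto simp: t_def)
  have "2 * pi * (of_int (k $ j) * t) = pi \<or> 2 * pi * (of_int (k $ j) * t) = - pi"
    using j by (auto simp: t_def field_simps abs_if)
  then have "chr k (axis j t) = -1"
    by (auto simp only: chr_axis complex_eq_iff cis.sel minus_complex.sel uminus_complex.sel
        one_complex.sel cos_minus sin_minus cos_pi sin_pi)
  then have "(LINT x|torus. chr k (x + axis j t)) = - (LINT x|torus. chr k x)"
    by (simp add: chr_plus)
  moreover have "(LINT x|torus. chr k (x + axis j t)) = (LINT x|torus. chr k x)"
    by (intro LINT_torus_translate periodic_chr t continuous_intros)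
  ultimately show ?thesis using False by simp
qed

lemma L1_integrable_chr:
  assumes "integrable torus f"
  shows "integrable torus (\<lambda>x. chr k x * complex_of_real (f x))"
proof (rule Bochner_Integration.integrable_bound[OF assms])
  have [measurable]: "f \<in> borel_measurable torus" using assms by simp
  show "(\<lambda>x. chr k x * complex_of_real (f x)) \<in> borel_measurable torus" by measurable
qed (simp add: norm_mult)

lemma fourier_coeff_add:
  assumes "integrable torus f" "integrable torus g"
  shows "fourier_coeff (\<lambda>x. f x + g x) k = fourier_coeff f k + fourier_coeff g k"
  unfolding fourier_coeff_chr
  using L1_integrable_chr[OF assms(1), of "-k"] L1_integrable_chr[OF assms(2), of "-k"]
  by (simp add: distrib_left)

lemma fourier_coeff_scale: "fourier_coeff (\<lambda>x. c * f x) k = of_real c * fourier_coeff f k"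
  unfolding fourier_coeff_chr by (simp add: mult.left_commute)

lemma fourier_coeff_diff:
  assumes "integrable torus f" "integrable torus g"
  shows "fourier_coeff (\<lambda>x. f x - g x) k = fourier_coeff f k - fourier_coeff g k"
  unfolding fourier_coeff_chr
  using L1_integrable_chr[OF assms(1), of "-k"] L1_integrable_chr[OF assms(2), of "-k"]
  by (simp add: right_diff_distrib)

lemma fourier_coeff_minus: "fourier_coeff f (- k) = cnj (fourier_coeff f k)"
  unfolding fourier_coeff_chr
  by (subst Bochner_Integration.integral_cnj[symmetric]) (simp add: chr_minus)

lemma norm_fourier_coeff_le:
  assumes "integrable torus f"
  shows "norm (fourier_coeff f k) \<le> (LINT x|torus. \<bar>f x\<bar>)"
proof -
  have "norm (fourier_coeff f k) \<le> (LINT x|torus. norm (chr (-k) x * complex_of_real (f x)))"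
    unfolding fourier_coeff_chr by (rule integral_norm_bound)
  then show ?thesis by (simp add: norm_mult)
qed

section \<open>An integrable function is determined by its Fourier coefficients\<close>

inductive trig_poly :: "(real ^ 'n \<Rightarrow> complex) \<Rightarrow> bool" where
  chr: "trig_poly (\<lambda>x. c * chr k x)"
| add: "trig_poly f \<Longrightarrow> trig_poly g \<Longrightarrow> trig_poly (\<lambda>x. f x + g x)"

lemma trig_poly_mult:
  assumes "trig_poly f" "trig_poly g"
  shows "trig_poly (\<lambda>x. f x * g x)"
  using assms
proof (induction f arbitrary: g)
  case (chr c k)
  from chr.prems show ?case
  proof (induction g)
    case (chr d l)
    have "(\<lambda>x. c * Submission.chr k x * (d * Submission.chr l x)) = (\<lambda>x. (c * d) * Submission.chr (k + l) x)"
      by (simp add: chr_add mult_ac)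
    then show ?case by (simp add: trig_poly.chr)
  next
    case (add f g)
    then show ?case by (simp add: distrib_left trig_poly.add)
  qed
next
  case (add f h)
  then show ?case by (simp add: distrib_right trig_poly.add)
qed

text \<open>Wraps the cube onto a compact set in complex space, where Stone-Weierstrass for real
  polynomials applies; such polynomials pull back to trigonometric ones.\<close>

definition torus_map :: "real ^ 'n \<Rightarrow> complex ^ 'n" where
  "torus_map x = (\<chi> j. cis (2 * pi * x $ j))"

lemma continuous_on_torus_map: "continuous_on S torus_map"
  unfolding torus_map_def by (intro continuous_intros)

lemma torus_map_chr: "torus_map x $ j = chr (axis j 1) x"
proof -
  have "(\<Sum>i\<in>UNIV. of_int (axis j 1 $ i) * x $ i) = (\<Sum>i\<in>UNIV. if i = j then x $ j else 0)"
    by (intro sum.cong) (auto simp: axis_def)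
  then show ?thesis by (simp add: chr_def torus_map_def)
qed

lemma cis_2pi_eq_unit:
  assumes "cis (2 * pi * s) = cis (2 * pi * t)" "0 < s" "s < 1" "0 \<le> t" "t \<le> 1"
  shows "s = t"
proof -
  obtain n :: int where n: "2 * pi * s = 2 * pi * t + 2 * pi * of_int n"
    using assms(1) sin_cos_eq_iff[of "2 * pi * s" "2 * pi * t"] by (auto simp: complex_eq_iff)
  then have "2 * pi * s = 2 * pi * (t + of_int n)" by (simp add: distrib_left)
  then have "s = t + of_int n" by simp
  moreover from this have "-1 < real_of_int n" "real_of_int n < 1" using assms by linarith+
  then have "n = 0" by linarith
  ultimately show ?thesis by simp
qed

text \<open>\<open>torus_map\<close> glues opposite faces of the cube together, so one of the two
  points has to be interior.\<close>

lemma torus_map_inj: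
  assumes "torus_map x = torus_map y" "x \<in> box 0 1" "y \<in> cbox 0 1"
  shows "x = y"
  unfolding vec_eq_iff
proof
  fix i
  have "cis (2 * pi * x $ i) = cis (2 * pi * y $ i)"
    using assms(1) by (simp add: torus_map_def vec_eq_iff)
  then show "x $ i = y $ i"
    using assms(2,3) by (intro cis_2pi_eq_unit) (auto simp: mem_box_cart)
qed

lemma real_polynomial_torus_map:
  fixes p :: "complex ^ 'n \<Rightarrow> real"
  assumes "real_polynomial_function p"
  shows "trig_poly (\<lambda>x. complex_of_real (p (torus_map x)))"
  using assms
proof induction
  case (linear f)
  interpret bounded_linear f by fact
  have z: "trig_poly (\<lambda>x. 0)" using trig_poly.chr[of 0 0] by simp
  have comp: "trig_poly (\<lambda>x. of_real (Re (torus_map x $ j)) * c)" "trig_poly (\<lambda>x. of_real (Im (torus_map x $ j)) * c)"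
    for j c
  proof -
    have "of_real (Re w) * c = (c/2) * w + (c/2) * cnj w" for w
      by (simp add: complex_eq_iff field_simps)
    moreover have "of_real (Im w) * c = (- \<i> * c / 2) * w + (\<i> * c / 2) * cnj w" for w
      by (simp add: complex_eq_iff field_simps)
    ultimately show "trig_poly (\<lambda>x. of_real (Re (torus_map x $ j)) * c)"
      "trig_poly (\<lambda>x. of_real (Im (torus_map x $ j)) * c)"
      unfolding torus_map_chr by (simp_all only: chr_minus[symmetric] trig_poly.intros)
  qed
  have sums: "trig_poly (\<lambda>x. \<Sum>j\<in>J. h j x)" if "finite J" "\<And>j. trig_poly (h j)" for h and J :: "'n set"
    using that by (induction J rule: finite_induct) (auto simp: z intro!: trig_poly.add)
  \<comment> \<open>A real-linear functional sees the real and imaginary part of each coordinate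
    separately, and either part of a coordinate of \<open>torus_map\<close> is a combination of a
    character and its conjugate.\<close>
  have "f z = (\<Sum>j\<in>UNIV. Re (z $ j) * f (axis j 1) + Im (z $ j) * f (axis j \<i>))" for z
  proof -
    have "z = (\<Sum>j\<in>UNIV. Re (z $ j) *\<^sub>R axis j 1 + Im (z $ j) *\<^sub>R axis j \<i>)"
    proof (subst vec_eq_iff, intro allI)
      fix i
      have "(\<Sum>j\<in>UNIV. Re (z $ j) *\<^sub>R axis j 1 + Im (z $ j) *\<^sub>R axis j \<i>) $ i
          = (\<Sum>j\<in>UNIV. if j = i then Re (z $ i) *\<^sub>R 1 + Im (z $ i) *\<^sub>R \<i> else 0)"
        unfolding sum_component by (intro sum.cong) (auto simp: axis_def)
      then show "z $ i = (\<Sum>j\<in>UNIV. Re (z $ j) *\<^sub>R axis j 1 + Im (z $ j) *\<^sub>R axis j \<i>) $ i"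
        by (simp add: complex_eq_iff)
    qed
    then have "f z = f (\<Sum>j\<in>UNIV. Re (z $ j) *\<^sub>R axis j 1 + Im (z $ j) *\<^sub>R axis j \<i>)" by simp
    then show ?thesis by (simp add: sum add scaleR)
  qed
  from this[of "torus_map _"] have eq: "(\<lambda>x. complex_of_real (f (torus_map x))) = (\<lambda>x. \<Sum>j\<in>UNIV.
      of_real (Re (torus_map x $ j)) * of_real (f (axis j 1)) + of_real (Im (torus_map x $ j)) * of_real (f (axis j \<i>)))"
    by (simp only: of_real_sum of_real_add of_real_mult)
  show ?case unfolding eq by (rule sums[OF finite trig_poly.add[OF comp]])
next
  case (const c)
  then show ?case using trig_poly.chr[of "of_real c" 0] by simp
next
  case (add f g)
  then show ?case by (simp add: trig_poly.add)
next
  case (mult f g)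
  then show ?case by (simp add: trig_poly_mult)
qed

lemma fourier_coeff_zero_trig_poly:
  assumes f: "integrable torus f" and z: "\<And>k. fourier_coeff f k = 0" and g: "trig_poly g"
  shows "integrable torus (\<lambda>x. g x * complex_of_real (f x)) \<and> (LINT x|torus. g x * complex_of_real (f x)) = 0"
  using g
proof induction
  case (chr c k)
  then show ?case
    using L1_integrable_chr[OF f, of k] z[of "- k"]
    by (simp add: fourier_coeff_chr mult.assoc)
next
  case (add g h)
  then show ?case by (simp add: distrib_right)
qed

lemma integrable_mult_continuous:
  fixes f :: "real ^ 'n \<Rightarrow> real"
  assumes f: "integrable torus f" and g: "continuous_on UNIV g"
  shows "integrable torus (\<lambda>x. g x * f x)"
proof -
  have "compact (g ` cbox 0 1)"
    by (rule compact_continuous_image[OF continuous_on_subset[OF g]]) auto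
  then have "bounded (g ` cbox 0 1)" by (rule compact_imp_bounded)
  then obtain B where B: "\<forall>y\<in>g ` cbox 0 1. norm y \<le> B"
    unfolding bounded_iff by auto
  have [measurable]: "f \<in> borel_measurable torus" "g \<in> borel_measurable torus"
    using f continuous_measurable_torus[OF g] by auto
  show ?thesis
  proof (rule Bochner_Integration.integrable_bound)
    show "integrable torus (\<lambda>x. B * f x)" using f by simp
    show "AE x in torus. norm (g x * f x) \<le> norm (B * f x)"
    proof (rule AE_I2)
      fix x :: "real ^ 'n" assume "x \<in> space torus"
      then have "\<bar>g x\<bar> \<le> B" using B by auto
      then show "norm (g x * f x) \<le> norm (B * f x)"
        by (simp add: abs_mult mult_right_mono)
    qed
  qed measurable
qed

text \<open>Replacing \<open>G\<close> by a polynomial that is uniformly \<open>e\<close>-close on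
  the compact image of the cube changes the integral by at most \<open>e\<close> times the L^1 norm
  of \<open>f\<close>.\<close>

lemma fourier_coeff_zero_continuous:
  fixes f :: "real ^ 'n \<Rightarrow> real" and G :: "complex ^ 'n \<Rightarrow> real"
  assumes f: "integrable torus f" and z: "\<And>k. fourier_coeff f k = 0" and G: "continuous_on UNIV G"
  shows "(LINT x|torus. G (torus_map x) * f x) = 0"
proof -
  let ?L = "LINT x|torus. \<bar>f x\<bar>"
  have L: "?L \<ge> 0" by simp
  have le: "\<bar>LINT x|torus. G (torus_map x) * f x\<bar> \<le> e * ?L" if "e > 0" for e
  proof -
    have "compact (torus_map ` cbox 0 1 :: (complex ^ 'n) set)"
      by (rule compact_continuous_image[OF continuous_on_torus_map]) auto
    then obtain p where p: "real_polynomial_function p"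
      "\<And>w. w \<in> torus_map ` cbox 0 1 \<Longrightarrow> \<bar>G w - p w\<bar> < e"
      using Stone_Weierstrass_real_polynomial_function[OF _ continuous_on_subset[OF G] \<open>e > 0\<close>] by (metis subset_UNIV)
    have intG: "integrable torus (\<lambda>x. G (torus_map x) * f x)"
      by (rule integrable_mult_continuous[OF f continuous_on_compose2[OF G continuous_on_torus_map]]) auto
    have tp: "trig_poly (\<lambda>x. complex_of_real (p (torus_map x)))"
      by (rule real_polynomial_torus_map[OF p(1)])
    have intp: "integrable torus (\<lambda>x. p (torus_map x) * f x)"
      using conjunct1[OF fourier_coeff_zero_trig_poly[OF f z tp]]
      by (simp add: complex_of_real_integrable_eq flip: of_real_mult)
    have zero: "(LINT x|torus. p (torus_map x) * f x) = 0"
      using conjunct2[OF fourier_coeff_zero_trig_poly[OF f z tp]]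
      by (simp flip: of_real_mult)
    have "(LINT x|torus. G (torus_map x) * f x) = (LINT x|torus. (G (torus_map x) - p (torus_map x)) * f x)"
      using intG intp zero by (simp add: left_diff_distrib)
    also have "\<bar>\<dots>\<bar> \<le> (LINT x|torus. \<bar>(G (torus_map x) - p (torus_map x)) * f x\<bar>)"
      by (rule integral_abs_bound)
    also have "\<dots> \<le> (LINT x|torus. e * \<bar>f x\<bar>)"
    proof (rule integral_mono)
      show "integrable torus (\<lambda>x. \<bar>(G (torus_map x) - p (torus_map x)) * f x\<bar>)"
        using intG intp by (simp add: left_diff_distrib)
      show "integrable torus (\<lambda>x. e * \<bar>f x\<bar>)" using f by simp
      fix x :: "real ^ 'n" assume "x \<in> space torus"
      then have "\<bar>G (torus_map x) - p (torus_map x)\<bar> < e" by (intro p(2)) auto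
      then show "\<bar>(G (torus_map x) - p (torus_map x)) * f x\<bar> \<le> e * \<bar>f x\<bar>"
        by (simp add: abs_mult mult_right_mono)
    qed
    finally show ?thesis by simp
  qed
  show ?thesis
  proof (rule ccontr)
    assume nz: "(LINT x|torus. G (torus_map x) * f x) \<noteq> 0"
    let ?a = "\<bar>LINT x|torus. G (torus_map x) * f x\<bar>"
    have pos: "0 < 2 * (?L + 1)" by (intro mult_pos_pos add_nonneg_pos L) auto
    \<comment> \<open>This \<open>e\<close> keeps \<open>e * ?L\<close> below \<open>?a / 2\<close>;
      the added 1 covers \<open>?L = 0\<close>.\<close>
    have "?a \<le> (?a / (2 * (?L + 1))) * ?L"
      using nz by (intro le divide_pos_pos pos) simp
    also have "\<dots> = ?a * (?L / (2 * (?L + 1)))" by simp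
    also have "\<dots> \<le> ?a * (1 / 2)"
    proof (rule mult_left_mono)
      show "?L / (2 * (?L + 1)) \<le> 1 / 2"
        unfolding pos_divide_le_eq[OF pos] by simp
    qed simp
    finally show False using nz by simp
  qed
qed

text \<open>The indicator of a closed set is the pointwise limit of the continuous functions
  \<open>g n\<close>, all bounded by 1.\<close>

lemma fourier_coeff_zero_closed:
  fixes f :: "real ^ 'n \<Rightarrow> real" and C :: "(complex ^ 'n) set"
  assumes f: "integrable torus f" and z: "\<And>k. fourier_coeff f k = 0" and C: "closed C" "C \<noteq> {}"
  shows "(LINT x|torus. indicator C (torus_map x) * f x) = 0"
proof -
  define g where "g n w = max 0 (1 - real n * infdist w C)" for n w
  have g: "continuous_on UNIV (g n)" for n
    unfolding g_def by (intro continuous_intros)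
  have [measurable]: "f \<in> borel_measurable torus" using f by simp
  have tm [measurable]: "torus_map \<in> borel_measurable torus"
    by (intro continuous_measurable_torus continuous_on_torus_map)
  have [measurable]: "C \<in> sets borel" using C by auto
  have lim: "(\<lambda>n. g n w) \<longlonglongrightarrow> indicator C w" for w
  proof (cases "w \<in> C")
    case True
    then show ?thesis by (simp add: g_def)
  next
    case False
    then have pos: "infdist w C > 0"
      using C infdist_pos_not_in_closed by blast
    obtain N where N: "1 < real N * infdist w C" using reals_Archimedean3[OF pos] by blast
    have "g n w = 0" if "n \<ge> N" for n
    proof -
      have "real N * infdist w C \<le> real n * infdist w C"
        using that pos by (intro mult_right_mono) auto
      with N show ?thesis by (simp add: g_def)
    qed
    then have "\<forall>\<^sub>F n in sequentially. g n w = indicator C w"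
      using False by (auto simp: eventually_sequentially)
    then show ?thesis by (rule tendsto_eventually)
  qed
  have "(\<lambda>n. LINT x|torus. g n (torus_map x) * f x) \<longlonglongrightarrow> (LINT x|torus. indicator C (torus_map x) * f x)"
  proof (rule integral_dominated_convergence[where w = "\<lambda>x. \<bar>f x\<bar>"])
    show "integrable torus (\<lambda>x. \<bar>f x\<bar>)" using f by simp
    show "AE x in torus. (\<lambda>n. g n (torus_map x) * f x) \<longlonglongrightarrow> indicator C (torus_map x) * f x"
      by (intro AE_I2 tendsto_mult lim tendsto_const)
    show "AE x in torus. norm (g n (torus_map x) * f x) \<le> \<bar>f x\<bar>" for n
    proof (intro AE_I2)
      fix x :: "real ^ 'n"
      have "\<bar>g n (torus_map x)\<bar> \<le> 1" by (simp add: g_def infdist_nonneg)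
      then show "norm (g n (torus_map x) * f x) \<le> \<bar>f x\<bar>"
        by (simp add: abs_mult mult_left_le_one_le)
    qed
    have [measurable]: "g n \<in> borel_measurable borel" for n
      by (rule borel_measurable_continuous_onI[OF g])
    show "(\<lambda>x. g n (torus_map x) * f x) \<in> borel_measurable torus" for n by measurable
  qed measurable
  moreover have "(LINT x|torus. g n (torus_map x) * f x) = 0" for n
    by (rule fourier_coeff_zero_continuous[OF f z g])
  ultimately show ?thesis by (simp add: LIMSEQ_const_iff)
qed

lemma AE_torus_box: "AE x in torus. x \<in> box 0 (1 :: real ^ 'n)"
proof -
  have "cbox 0 1 - box 0 (1 :: real ^ 'n) \<in> null_sets lborel"
    using negligible_frontier_interval[of 0 "1 :: real ^ 'n"]
    by (simp add: negligible_iff_null_sets null_sets_completion_iff)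
  then have "AE x in lborel. x \<notin> cbox 0 1 - box 0 (1 :: real ^ 'n)" by (rule AE_not_in)
  then have "AE x in lebesgue. x \<notin> cbox 0 1 - box 0 (1 :: real ^ 'n)" by (rule AE_completion)
  then show ?thesis unfolding torus_def
    by (subst AE_restrict_space_iff) auto
qed

text \<open>Up to a null set \<open>S\<close> may be intersected with the open cube. What remains of
  the closed cube is compact and has a closed image under \<open>torus_map\<close>; by injectivity
  at interior points, the indicator of that image pulls back to the indicator of the
  complement.\<close>

lemma fourier_coeff_zero_open:
  fixes f :: "real ^ 'n \<Rightarrow> real"
  assumes f: "integrable torus f" and z: "\<And>k. fourier_coeff f k = 0" and S: "open S"
  shows "(LINT x|torus. indicator S x * f x) = 0"
proof -
  let ?U = "S \<inter> box 0 (1 :: real ^ 'n)"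
  let ?C = "torus_map ` (cbox 0 1 - ?U)"
  have U: "open ?U" using S by auto
  have [measurable]: "f \<in> borel_measurable torus" using f by simp
  have SU: "S \<in> sets borel" "?U \<in> sets borel" using S by auto
  have meas: "indicator A \<in> borel_measurable torus" if "A \<in> sets borel" for A :: "(real ^ 'n) set"
    using that by (intro borel_measurable_torusI) simp
  note [measurable] = meas[OF SU(1)] meas[OF SU(2)]
  have "compact (cbox 0 1 - ?U)" by (intro compact_diff U) auto
  then have "compact ?C" by (intro compact_continuous_image continuous_on_torus_map)
  then have "closed ?C" by (rule compact_imp_closed)
  \<comment> \<open>Distances to an empty set would be a default value; the corner 0 always survives
    because \<open>?U\<close> lies in the open cube.\<close>
  moreover have "?C \<noteq> {}"
  proof -
    have "0 \<in> cbox 0 (1 :: real ^ 'n) - ?U" by (auto simp: mem_box_cart)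
    then show ?thesis by blast
  qed
  ultimately have zC: "(LINT x|torus. indicator ?C (torus_map x) * f x) = 0"
    by (rule fourier_coeff_zero_closed[OF f z])
  have ind: "indicator ?C (torus_map x) = (1 - indicator ?U x :: real)" if "x \<in> cbox 0 1" for x
  proof (cases "x \<in> ?U")
    case True
    have "torus_map x \<notin> ?C"
    proof
      assume "torus_map x \<in> ?C"
      then obtain y where y: "y \<in> cbox 0 1 - ?U" "torus_map x = torus_map y" by blast
      have "x = y" using True y by (intro torus_map_inj) auto
      then show False using True y(1) by blast
    qed
    with True show ?thesis by simp
  next
    case False
    then show ?thesis using that by (auto simp: indicator_def)
  qed
  have intU: "integrable torus (\<lambda>x. indicator ?U x * f x)"
  proof (rule Bochner_Integration.integrable_bound[OF f])
    show "(\<lambda>x. indicat_real ?U x * f x) \<in> borel_measurable torus"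
      by (intro borel_measurable_times meas SU) measurable
  qed (auto simp: indicator_def)
  have zf: "(LINT x|torus. f x) = 0"
    using z[of 0] by (simp add: fourier_coeff_chr)
  have "(LINT x|torus. indicator S x * f x) = (LINT x|torus. indicator ?U x * f x)"
  proof (rule integral_cong_AE)
    show "AE x in torus. indicator S x * f x = indicator ?U x * f x"
      using AE_torus_box by eventually_elim (auto simp: indicator_def)
    show "(\<lambda>x. indicat_real ?U x * f x) \<in> borel_measurable torus"
      by (intro borel_measurable_times meas SU) measurable
  qed measurable
  also have "\<dots> = (LINT x|torus. f x) - (LINT x|torus. indicator ?C (torus_map x) * f x)"
  proof -
    have "(LINT x|torus. indicator ?C (torus_map x) * f x) = (LINT x|torus. f x - indicator ?U x * f x)"
      by (rule Bochner_Integration.integral_cong) (simp_all add: ind left_diff_distrib)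
    then show ?thesis using f intU by simp
  qed
  finally show ?thesis by (simp add: zf zC)
qed

text \<open>Open sets are closed under intersection and generate the Borel sets, and the sets over
  which \<open>f\<close> integrates to 0 form a Dynkin system.\<close>

lemma fourier_coeff_zero_borel:
  fixes f :: "real ^ 'n \<Rightarrow> real"
  assumes f: "integrable torus f" and z: "\<And>k. fourier_coeff f k = 0" and S: "S \<in> sets borel"
  shows "(LINT x|torus. indicator S x * f x) = 0"
proof -
  have [measurable]: "f \<in> borel_measurable torus" using f by simp
  have meas: "indicator A \<in> borel_measurable torus" if "A \<in> sets borel" for A :: "(real ^ 'n) set"
    using that by (intro borel_measurable_torusI) simp
  have int: "integrable torus (\<lambda>x. indicator A x * f x)" if "A \<in> sets borel" for A
  proof (rule Bochner_Integration.integrable_bound[OF f])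
    note [measurable] = meas[OF that]
    show "(\<lambda>x. indicat_real A x * f x) \<in> borel_measurable torus" by measurable
  qed (auto simp: indicator_def)
  have zf: "(LINT x|torus. f x) = 0"
    using z[of 0] by (simp add: fourier_coeff_chr)
  have Int: "Int_stable {S :: (real ^ 'n) set. open S}"
    by (auto intro!: Int_stableI)
  have mem: "S \<in> sigma_sets UNIV {S. open S}"
    using S by (simp add: borel_def)
  have borel: "A \<in> sets borel" if "A \<in> sigma_sets UNIV {S :: (real ^ 'n) set. open S}" for A
    using that by (simp add: borel_def)
  have Pow: "{S :: (real ^ 'n) set. open S} \<subseteq> Pow UNIV" by simp
  from Int Pow mem show ?thesis
  proof (induct rule: sigma_sets_induct_disjoint)
    case (basic A)
    then show ?case using fourier_coeff_zero_open[OF f z] by simp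
  next
    case empty
    show ?case by simp
  next
    case (compl A)
    have "(LINT x|torus. indicator (UNIV - A) x * f x) = (LINT x|torus. f x - indicator A x * f x)"
      by (rule Bochner_Integration.integral_cong) (auto simp: indicator_def)
    also have "\<dots> = 0" using compl f zf int[OF borel[OF compl(1)]] by simp
    finally show ?case .
  next
    case (union A)
    have A: "A i \<in> sets borel" for i using union(2) borel by auto
    have UN: "(\<Union>i. A i) \<in> sets borel" using A by auto
    have "(\<lambda>n. LINT x|torus. indicator (\<Union>i<n. A i) x * f x) \<longlonglongrightarrow> (LINT x|torus. indicator (\<Union>i. A i) x * f x)"
    proof (rule integral_dominated_convergence[where w = "\<lambda>x. \<bar>f x\<bar>"])
      show "integrable torus (\<lambda>x. \<bar>f x\<bar>)" using f by simp
      show "AE x in torus. (\<lambda>n. indicator (\<Union>i<n. A i) x * f x) \<longlonglongrightarrow> indicator (\<Union>i. A i) x * f x"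
        by (intro AE_I2 tendsto_mult tendsto_const LIMSEQ_indicator_UN)
      show "AE x in torus. norm (indicator (\<Union>i<n. A i) x * f x) \<le> \<bar>f x\<bar>" for n
        by (intro AE_I2) (auto simp: indicator_def)
      show "(\<lambda>x. indicat_real (\<Union>i. A i) x * f x) \<in> borel_measurable torus"
        using int[OF UN] by simp
      show "(\<lambda>x. indicat_real (\<Union>i<n. A i) x * f x) \<in> borel_measurable torus" for n
        using int[of "\<Union>i<n. A i"] A by auto
    qed
    moreover have "(LINT x|torus. indicator (\<Union>i<n. A i) x * f x) = 0" for n
    proof -
      have "(LINT x|torus. indicator (\<Union>i<n. A i) x * f x) = (LINT x|torus. (\<Sum>i<n. indicator (A i) x * f x))"
        using disjoint_family_on_mono[OF _ union(1), of "{..<n}"]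
        by (intro Bochner_Integration.integral_cong) (auto simp: indicator_UN_disjoint sum_distrib_right)
      also have "\<dots> = (\<Sum>i<n. LINT x|torus. indicator (A i) x * f x)"
        by (rule Bochner_Integration.integral_sum) (rule int[OF A])
      also have "\<dots> = 0" using union(3) by simp
      finally show ?thesis .
    qed
    ultimately show ?case by (simp add: LIMSEQ_const_iff)
  qed
qed

text \<open>Every Lebesgue set is a Borel set up to a null set, so \<open>f\<close> integrates to 0
  over all measurable sets.\<close>

lemma fourier_coeff_zero_AE:
  fixes f :: "real ^ 'n \<Rightarrow> real"
  assumes f: "integrable torus f" and z: "\<And>k. fourier_coeff f k = 0"
  shows "AE x in torus. f x = 0"
proof (rule torus.density_zero[OF f])
  fix A :: "(real ^ 'n) set" assume "A \<in> sets torus"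
  then have "A \<in> sets lebesgue" unfolding torus_def by (auto simp: sets_restrict_space)
  then obtain S N N' where A: "A = S \<union> N" "N \<subseteq> N'" "N' \<in> null_sets lborel" "S \<in> sets lborel"
    by (rule sets_completionE)
  have AS: "AE x in torus. x \<in> A \<longleftrightarrow> x \<in> S"
  proof -
    have "AE x in lborel. x \<notin> N'" by (rule AE_not_in[OF A(3)])
    then have "AE x in lebesgue. x \<notin> N'" by (rule AE_completion)
    then have "AE x in torus. x \<notin> N'" unfolding torus_def
      by (subst AE_restrict_space_iff) (auto elim: eventually_mono)
    then show ?thesis by eventually_elim (use A in auto)
  qed
  have [measurable]: "f \<in> borel_measurable torus" using f by simp
  have [measurable]: "indicat_real A \<in> borel_measurable torus"
    using \<open>A \<in> sets torus\<close> by simp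
  have [measurable]: "indicat_real S \<in> borel_measurable torus"
    using A(4) by (intro borel_measurable_torusI) simp
  have "set_lebesgue_integral torus A f = (LINT x|torus. indicator S x * f x)"
    unfolding set_lebesgue_integral_def real_scaleR_def
  proof (rule integral_cong_AE)
    show "AE x in torus. indicat_real A x * f x = indicat_real S x * f x"
      using AS by eventually_elim (auto simp: indicator_def)
  qed measurable
  also have "\<dots> = 0" using A(4) by (intro fourier_coeff_zero_borel[OF f z]) simp
  finally show "set_lebesgue_integral torus A f = 0" .
qed

section \<open>Square integrable functions\<close>

definition sq_int :: "(real ^ 'n \<Rightarrow> real) \<Rightarrow> real" where
  "sq_int f = (LINT x|torus. (f x)\<^sup>2)"

lemma sq_int_nonneg: "0 \<le> sq_int f"
  by (simp add: sq_int_def)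

lemma torus_fun_measurable: "f \<in> torus_fun \<Longrightarrow> f \<in> borel_measurable torus"
  by (auto simp: torus_fun_def intro: measurable_torusI)

lemma torus_fun_add: "f \<in> torus_fun \<Longrightarrow> g \<in> torus_fun \<Longrightarrow> (\<lambda>x. f x + g x) \<in> torus_fun"
  by (auto simp: torus_fun_def periodic_def)

lemma torus_fun_scale: "f \<in> torus_fun \<Longrightarrow> (\<lambda>x. c * f x) \<in> torus_fun"
  by (auto simp: torus_fun_def periodic_def)

lemma torus_fun_zero: "(\<lambda>x. 0) \<in> torus_fun"
  by (auto simp: torus_fun_def periodic_def)

lemma torus_fun_diff: "f \<in> torus_fun \<Longrightarrow> g \<in> torus_fun \<Longrightarrow> (\<lambda>x. f x - g x) \<in> torus_fun"
  using torus_fun_add[of f "\<lambda>x. -1 * g x"] torus_fun_scale[of g "-1"] by simp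

lemma L2_measurable: "f \<in> L2 \<Longrightarrow> f \<in> borel_measurable torus"
  by (auto simp: L2_def intro: torus_fun_measurable)

lemma L2_integrable_sq: "f \<in> L2 \<Longrightarrow> integrable torus (\<lambda>x. (f x)\<^sup>2)"
  by (simp add: L2_def)

lemma L2_integrable_mult:
  assumes "f \<in> L2" "g \<in> L2"
  shows "integrable torus (\<lambda>x. f x * g x)"
proof (rule Bochner_Integration.integrable_bound)
  show "integrable torus (\<lambda>x. (f x)\<^sup>2 + (g x)\<^sup>2)"
    using assms by (intro Bochner_Integration.integrable_add L2_integrable_sq)
  note [measurable] = L2_measurable[OF assms(1)] L2_measurable[OF assms(2)]
  show "(\<lambda>x. f x * g x) \<in> borel_measurable torus" by measurable
  have "\<bar>a * b\<bar> \<le> a\<^sup>2 + b\<^sup>2" for a b :: real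
  proof -
    have "2 * (\<bar>a\<bar> * \<bar>b\<bar>) \<le> a\<^sup>2 + b\<^sup>2"
      using sum_squares_bound[of "\<bar>a\<bar>" "\<bar>b\<bar>"] by (simp add: mult.assoc)
    moreover have "0 \<le> \<bar>a\<bar> * \<bar>b\<bar>" by simp
    ultimately show ?thesis unfolding abs_mult by linarith
  qed
  then show "AE x in torus. norm (f x * g x) \<le> norm ((f x)\<^sup>2 + (g x)\<^sup>2)"
    by (intro AE_I2) auto
qed

lemma L2_add: 
  assumes "f \<in> L2" "g \<in> L2"
  shows "(\<lambda>x. f x + g x) \<in> L2"
proof -
  have "integrable torus (\<lambda>x. (f x)\<^sup>2 + (g x)\<^sup>2 + 2 * (f x * g x))"
    using assms by (intro Bochner_Integration.integrable_add L2_integrable_sq integrable_mult_right L2_integrable_mult)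
  then show ?thesis
    using assms by (auto simp: L2_def torus_fun_add power2_sum algebra_simps)
qed

lemma L2_scale: "f \<in> L2 \<Longrightarrow> (\<lambda>x. c * f x) \<in> L2"
  by (auto simp: L2_def torus_fun_scale power_mult_distrib)

lemma L2_diff: "f \<in> L2 \<Longrightarrow> g \<in> L2 \<Longrightarrow> (\<lambda>x. f x - g x) \<in> L2"
  using L2_add[of f "\<lambda>x. -1 * g x"] L2_scale[of g "-1"] by simp

lemma L2_zero: "(\<lambda>x. 0) \<in> L2"
  by (simp add: L2_def torus_fun_zero)

lemma L2_integrable: "f \<in> L2 \<Longrightarrow> integrable torus f"
  by (rule torus.square_integrable_imp_integrable[OF L2_measurable L2_integrable_sq])

text \<open>Nonnegativity of the variance of |f| under the probability measure
  \<open>torus\<close>.\<close>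

lemma LINT_abs_le_sq_int:
  assumes "f \<in> L2"
  shows "(LINT x|torus. \<bar>f x\<bar>) \<le> sqrt (sq_int f)"
proof -
  have "0 \<le> torus.variance (\<lambda>x. \<bar>f x\<bar>)" by simp
  also have "\<dots> = sq_int f - (LINT x|torus. \<bar>f x\<bar>)\<^sup>2"
    using L2_integrable[OF assms] L2_integrable_sq[OF assms]
    by (subst torus.variance_eq) (auto simp: sq_int_def)
  finally show ?thesis by (intro real_le_rsqrt) simp
qed

lemma sq_int_diff_commute: "sq_int (\<lambda>x. f x - g x) = sq_int (\<lambda>x. g x - f x)"
  by (simp add: sq_int_def power2_commute)

lemma continuous_periodic_L2:
  assumes "continuous_on UNIV f" "periodic f"
  shows "f \<in> L2"
  using assms unfolding L2_def torus_fun_def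
  by (auto intro!: continuous_integrable_torus continuous_measurable_lebesgue continuous_intros)

lemma sq_int_tendsto_fourier_coeff:
  assumes F: "\<And>n. F n \<in> L2" and f: "f \<in> L2" and lim: "(\<lambda>n. sq_int (\<lambda>x. F n x - f x)) \<longlonglongrightarrow> 0"
  shows "(\<lambda>n. fourier_coeff (F n) k) \<longlonglongrightarrow> fourier_coeff f k"
proof -
  have "norm (fourier_coeff (F n) k - fourier_coeff f k) \<le> sqrt (sq_int (\<lambda>x. F n x - f x))" for n
  proof -
    have "fourier_coeff (F n) k - fourier_coeff f k = fourier_coeff (\<lambda>x. F n x - f x) k"
      by (rule fourier_coeff_diff[symmetric]) (intro L2_integrable F f)+
    also have "norm \<dots> \<le> (LINT x|torus. \<bar>F n x - f x\<bar>)"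
      by (intro norm_fourier_coeff_le L2_integrable L2_diff F f)
    also have "\<dots> \<le> sqrt (sq_int (\<lambda>x. F n x - f x))"
      by (intro LINT_abs_le_sq_int L2_diff F f)
    finally show ?thesis .
  qed
  moreover have "(\<lambda>n. sqrt (sq_int (\<lambda>x. F n x - f x))) \<longlonglongrightarrow> 0"
    using tendsto_real_sqrt[OF lim] by simp
  ultimately have "(\<lambda>n. fourier_coeff (F n) k - fourier_coeff f k) \<longlonglongrightarrow> 0"
    by (rule Lim_null_comparison[OF always_eventually, OF allI])
  then show ?thesis by (simp add: LIM_zero_iff)
qed

text \<open>The increments have summable L^1 norms, so the series of their absolute values has
  finite integral and is finite almost everywhere; the sequence telescopes.\<close>

lemma AE_convergent_of_summable_L1:
  fixes F :: "nat \<Rightarrow> real ^ 'n \<Rightarrow> real"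
  assumes F: "\<And>i. integrable torus (F i)"
    and le: "\<And>i. (LINT x|torus. \<bar>F (Suc i) x - F i x\<bar>) \<le> (1/2)^i"
  shows "AE x in torus. convergent (\<lambda>i. F i x)"
proof -
  have [measurable]: "F i \<in> borel_measurable torus" for i using F by simp
  have "(\<integral>\<^sup>+x. (\<Sum>i. ennreal \<bar>F (Suc i) x - F i x\<bar>) \<partial>torus) = (\<Sum>i. \<integral>\<^sup>+x. ennreal \<bar>F (Suc i) x - F i x\<bar> \<partial>torus)"
    by (rule nn_integral_suminf) measurable
  also have "\<dots> \<le> (\<Sum>i. ennreal ((1/2)^i))"
  proof (intro suminf_le)
    fix i
    have "(\<integral>\<^sup>+x. ennreal \<bar>F (Suc i) x - F i x\<bar> \<partial>torus) = ennreal (LINT x|torus. \<bar>F (Suc i) x - F i x\<bar>)"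
      by (rule nn_integral_eq_integral) (auto intro!: F Bochner_Integration.integrable_diff)
    also have "\<dots> \<le> ennreal ((1/2)^i)" by (rule ennreal_leI[OF le])
    finally show "(\<integral>\<^sup>+x. ennreal \<bar>F (Suc i) x - F i x\<bar> \<partial>torus) \<le> ennreal ((1/2)^i)" .
  qed auto
  also have "\<dots> = ennreal (\<Sum>i. (1/2)^i)"
    by (rule suminf_ennreal2) (auto intro: summable_geometric)
  finally have "(\<integral>\<^sup>+x. (\<Sum>i. ennreal \<bar>F (Suc i) x - F i x\<bar>) \<partial>torus) \<noteq> \<infinity>"
    by (auto simp: top_unique)
  then have "AE x in torus. (\<Sum>i. ennreal \<bar>F (Suc i) x - F i x\<bar>) \<noteq> \<infinity>"
    by (intro nn_integral_PInf_AE) auto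
  then show ?thesis
  proof eventually_elim
    case (elim x)
    then have "summable (\<lambda>i. \<bar>F (Suc i) x - F i x\<bar>)"
      by (intro summable_suminf_not_top) auto
    then have "summable (\<lambda>i. F (Suc i) x - F i x)" by (rule summable_rabs_cancel)
    then have "convergent (\<lambda>n. \<Sum>i<n. F (Suc i) x - F i x)" by (simp add: summable_iff_convergent)
    then have "convergent (\<lambda>n. F n x - F 0 x)" by (simp add: sum_lessThan_telescope[of "\<lambda>i. F i x"])
    from convergent_add[OF this convergent_const[of "F 0 x"]] show ?case by simp
  qed
qed

text \<open>The Riesz-Fischer theorem. The almost everywhere convergent subsequence is exported
  because the pointwise bound on the final solution is read off from it.\<close>

lemma L2_complete:
  fixes F :: "nat \<Rightarrow> real ^ 'n \<Rightarrow> real"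
  assumes F: "\<And>n. F n \<in> L2"
    and cauchy: "\<And>e. e > 0 \<Longrightarrow> \<exists>M. \<forall>m\<ge>M. \<forall>n\<ge>M. sq_int (\<lambda>x. F m x - F n x) < e"
  obtains f r where "f \<in> L2" "(\<lambda>n. sq_int (\<lambda>x. F n x - f x)) \<longlonglongrightarrow> 0"
    "strict_mono r" "AE x in torus. (\<lambda>i. F (r i) x) \<longlonglongrightarrow> f x"
proof -
  have "\<exists>M. \<forall>m\<ge>M. \<forall>n\<ge>M. sqrt (sq_int (\<lambda>x. F m x - F n x)) < e" if "e > 0" for e
  proof -
    obtain M where M: "\<forall>m\<ge>M. \<forall>n\<ge>M. sq_int (\<lambda>x. F m x - F n x) < e\<^sup>2"
      using cauchy[of "e\<^sup>2"] \<open>e > 0\<close> by auto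
    have "sqrt (sq_int (\<lambda>x. F m x - F n x)) < e" if "m \<ge> M" "n \<ge> M" for m n
      using M that \<open>e > 0\<close> real_sqrt_less_mono[of "sq_int (\<lambda>x. F m x - F n x)" "e\<^sup>2"] by simp
    then show ?thesis by auto
  qed
  note fs = fast_subseq[of "\<lambda>m n. sqrt (sq_int (\<lambda>x. F m x - F n x))", OF this]
  obtain r where r: "strict_mono r"
    "\<And>i m n. m \<ge> r i \<Longrightarrow> n \<ge> r i \<Longrightarrow> sqrt (sq_int (\<lambda>x. F m x - F n x)) < (1/2)^i"
  proof (rule fs)
    fix r :: "nat \<Rightarrow> nat"
    assume "strict_mono r"
      and "\<And>i m n. m \<ge> r i \<Longrightarrow> n \<ge> r i \<Longrightarrow> sqrt (sq_int (\<lambda>x. F m x - F n x)) < (1/2)^i"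
    then show thesis by (rule that)
  qed
  have conv: "AE x in torus. convergent (\<lambda>i. F (r i) x)"
  proof (rule AE_convergent_of_summable_L1)
    show "integrable torus (F (r i))" for i by (intro L2_integrable F)
    fix i
    have "r i \<le> r (Suc i)" using r(1) by (simp add: strict_mono_less_eq)
    then have "sqrt (sq_int (\<lambda>x. F (r (Suc i)) x - F (r i) x)) < (1/2)^i"
      by (intro r(2)) auto
    with LINT_abs_le_sq_int[OF L2_diff[OF F F], of "r (Suc i)" "r i"]
    show "(LINT x|torus. \<bar>F (r (Suc i)) x - F (r i) x\<bar>) \<le> (1/2)^i" by linarith
  qed
  \<comment> \<open>Periodicity has to hold at every point. \<open>lim\<close> depends only on the
    sequence of values, so even where that sequence diverges, its default value is periodic in
    \<open>x\<close>.\<close>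
  define f where "f x = lim (\<lambda>i. F (r i) x)" for x
  have conv': "AE x in torus. (\<lambda>i. F (r i) x) \<longlonglongrightarrow> f x"
    using conv by eventually_elim (auto simp: f_def convergent_LIMSEQ_iff)
  have f: "f \<in> torus_fun"
    unfolding torus_fun_def
  proof (intro CollectI conjI)
    have "F n (x + axis i 1) = F n x" for n x i
      using F[of n] by (auto simp: L2_def torus_fun_def periodic_def)
    then show "periodic f" by (simp add: periodic_def f_def)
    have "F n \<in> borel_measurable lebesgue" for n
      using F[of n] by (auto simp: L2_def torus_fun_def)
    then show "f \<in> borel_measurable lebesgue"
      unfolding f_def by (intro borel_measurable_lim_metric)
  qed
  note [measurable] = torus_fun_measurable[OF f] L2_measurable[OF F]
  have bound: "(\<integral>\<^sup>+x. ennreal ((F m x - f x)\<^sup>2) \<partial>torus) \<le> ennreal e"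
    if M: "\<And>n. n \<ge> M \<Longrightarrow> sq_int (\<lambda>x. F m x - F n x) < e" for m M e
  proof -
    have "(\<integral>\<^sup>+x. ennreal ((F m x - f x)\<^sup>2) \<partial>torus) = (\<integral>\<^sup>+x. liminf (\<lambda>i. ennreal ((F m x - F (r i) x)\<^sup>2)) \<partial>torus)"
    proof (rule nn_integral_cong_AE)
      show "AE x in torus. ennreal ((F m x - f x)\<^sup>2) = liminf (\<lambda>i. ennreal ((F m x - F (r i) x)\<^sup>2))"
        using conv'
      proof eventually_elim
        case (elim x)
        then have "(\<lambda>i. ennreal ((F m x - F (r i) x)\<^sup>2)) \<longlonglongrightarrow> ennreal ((F m x - f x)\<^sup>2)"
          by (intro tendsto_ennrealI tendsto_power tendsto_diff tendsto_const)
        then show ?case by (intro lim_imp_Liminf[symmetric]) auto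
      qed
    qed
    also have "\<dots> \<le> liminf (\<lambda>i. \<integral>\<^sup>+x. ennreal ((F m x - F (r i) x)\<^sup>2) \<partial>torus)"
      by (rule nn_integral_liminf) measurable
    also have "\<dots> \<le> liminf (\<lambda>i. ennreal e)"
    proof (intro Liminf_mono eventually_sequentiallyI[of M])
      fix i assume "i \<ge> M"
      then have "r i \<ge> M" using seq_suble[OF r(1), of i] by simp
      have "(\<integral>\<^sup>+x. ennreal ((F m x - F (r i) x)\<^sup>2) \<partial>torus) = ennreal (sq_int (\<lambda>x. F m x - F (r i) x))"
        unfolding sq_int_def
        by (rule nn_integral_eq_integral) (auto intro!: L2_integrable_sq L2_diff F)
      also have "\<dots> \<le> ennreal e" using M[OF \<open>r i \<ge> M\<close>] by (intro ennreal_leI) simp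
      finally show "(\<integral>\<^sup>+x. ennreal ((F m x - F (r i) x)\<^sup>2) \<partial>torus) \<le> ennreal e" .
    qed
    also have "\<dots> = ennreal e" by (intro lim_imp_Liminf) auto
    finally show ?thesis .
  qed
  have int: "integrable torus (\<lambda>x. (F m x - f x)\<^sup>2)"
    if M: "\<And>n. n \<ge> M \<Longrightarrow> sq_int (\<lambda>x. F m x - F n x) < e" for m M e
  proof (rule integrableI_bounded)
    have "(\<integral>\<^sup>+x. ennreal ((F m x - f x)\<^sup>2) \<partial>torus) < \<infinity>"
      using bound[of M m e, OF M] by (auto intro: le_less_trans)
    then show "(\<integral>\<^sup>+x. ennreal (norm ((F m x - f x)\<^sup>2)) \<partial>torus) < \<infinity>" by simp
  qed measurable
  obtain M where "\<forall>m\<ge>M. \<forall>n\<ge>M. sq_int (\<lambda>x. F m x - F n x) < 1" using cauchy[of 1] by auto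
  then have "(\<lambda>x. F M x - f x) \<in> L2"
    using int[of M M 1] f F[of M] by (auto simp: L2_def torus_fun_diff)
  from L2_diff[OF F[of M] this] have fL2: "f \<in> L2" by simp
  have "(\<lambda>n. sq_int (\<lambda>x. F n x - f x)) \<longlonglongrightarrow> 0"
  proof (rule LIMSEQ_I)
    fix e :: real assume "e > 0"
    then obtain M where M: "\<forall>m\<ge>M. \<forall>n\<ge>M. sq_int (\<lambda>x. F m x - F n x) < e/2"
      using cauchy[of "e/2"] by auto
    have "norm (sq_int (\<lambda>x. F m x - f x) - 0) < e" if "m \<ge> M" for m
    proof -
      have "ennreal (sq_int (\<lambda>x. F m x - f x)) = (\<integral>\<^sup>+x. ennreal ((F m x - f x)\<^sup>2) \<partial>torus)"
        unfolding sq_int_def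
        by (rule nn_integral_eq_integral[symmetric]) (auto intro!: L2_integrable_sq L2_diff F fL2)
      also have "\<dots> \<le> ennreal (e/2)" using M that by (intro bound[of M]) auto
      finally have "sq_int (\<lambda>x. F m x - f x) \<le> e/2" using \<open>e > 0\<close> by (simp add: ennreal_le_iff)
      then show ?thesis using \<open>e > 0\<close> sq_int_nonneg[of "\<lambda>x. F m x - f x"] by simp
    qed
    then show "\<exists>no. \<forall>n\<ge>no. norm (sq_int (\<lambda>x. F n x - f x) - 0) < e" by auto
  qed
  with fL2 r(1) conv' show thesis by (intro that)
qed

section \<open>Trigonometric polynomials and Parseval's identity\<close>

definition freq_box :: "nat \<Rightarrow> (int ^ 'n) set" where
  "freq_box n = {k. \<forall>i. \<bar>k $ i\<bar> \<le> int n}"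

lemma card_freq_box: "finite (freq_box n :: (int ^ 'n) set) \<and> card (freq_box n :: (int ^ 'n) set) = (2 * n + 1) ^ CARD('n)"
proof -
  let ?P = "PiE (UNIV :: 'n set) (\<lambda>_. {- int n..int n})"
  have eq: "freq_box n = vec_lambda ` ?P"
  proof (intro equalityI subsetI)
    fix k :: "int ^ 'n" assume "k \<in> freq_box n"
    then have "vec_nth k \<in> ?P" by (auto simp: freq_box_def abs_le_iff) (metis minus_le_iff)
    then show "k \<in> vec_lambda ` ?P" by (metis image_eqI vec_nth_inverse)
  next
    fix k :: "int ^ 'n" assume "k \<in> vec_lambda ` ?P"
    then show "k \<in> freq_box n" by (auto simp: freq_box_def abs_le_iff PiE_iff) (metis minus_le_iff)
  qed
  have inj: "inj_on vec_lambda ?P" by (auto intro!: inj_onI simp: vec_lambda_inject)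
  have "finite ?P" by (intro finite_PiE) auto
  moreover have "card ?P = (2 * n + 1) ^ CARD('n)"
  proof -
    have "nat (2 * int n + 1) = 2 * n + 1" by simp
    then show ?thesis by (subst card_PiE) (simp_all del: Suc_eq_plus1 add: prod_constant)
  qed
  ultimately show ?thesis unfolding eq by (simp add: card_image[OF inj])
qed

lemma finite_freq_box [simp]: "finite (freq_box n)"
  using card_freq_box by blast

lemma freq_box_mono: "m \<le> n \<Longrightarrow> freq_box m \<subseteq> freq_box n"
  by (auto simp: freq_box_def intro: order_trans[of _ "int m"])

lemma finite_subset_freq_box:
  assumes "finite S"
  obtains n where "S \<subseteq> freq_box n"
proof -
  have "\<exists>n. S \<subseteq> freq_box n"
    using assms
  proof induction
    case (insert k S)
    then obtain n where n: "S \<subseteq> freq_box n" by auto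
    define m where "m = nat (\<Sum>i\<in>UNIV. \<bar>k $ i\<bar>)"
    have "k \<in> freq_box m"
      unfolding freq_box_def m_def using member_le_sum[of _ UNIV "\<lambda>i. \<bar>k $ i\<bar>"] by (auto simp: sum_nonneg)
    then have "insert k S \<subseteq> freq_box (max m n)"
      using n freq_box_mono[of m "max m n"] freq_box_mono[of n "max m n"] by auto
    then show ?case by auto
  qed simp
  then show thesis using that by auto
qed

lemma uminus_freq_box: "k \<in> freq_box n \<Longrightarrow> - k \<in> freq_box n"
  by (simp add: freq_box_def)

definition trig :: "(int ^ 'n) set \<Rightarrow> (int ^ 'n \<Rightarrow> complex) \<Rightarrow> real ^ 'n \<Rightarrow> real" where
  "trig S c x = Re (\<Sum>k\<in>S. c k * chr k x)"

text \<open>Symmetry of the coefficients makes the complex trigonometric sum real valued.\<close>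
definition sym_coeff :: "(int ^ 'n) set \<Rightarrow> (int ^ 'n \<Rightarrow> complex) \<Rightarrow> bool" where
  "sym_coeff S c \<longleftrightarrow> (\<forall>k\<in>S. - k \<in> S \<and> c (- k) = cnj (c k))"

lemma trig_continuous: "continuous_on UNIV (trig S c)"
  unfolding trig_def by (intro continuous_intros)

lemma trig_periodic: "periodic (trig S c)"
proof -
  have "chr k (x + axis i 1) = chr k x" for k :: "int ^ 'a" and x i
    using periodic_chr by (auto simp: periodic_def)
  then show ?thesis by (simp only: periodic_def trig_def simp_thms)
qed

lemma trig_L2: "trig S c \<in> L2"
  by (intro continuous_periodic_L2 trig_continuous trig_periodic)

lemma trig_add: "trig S c x + trig S d x = trig S (\<lambda>k. c k + d k) x"
  by (simp add: trig_def sum.distrib distrib_right)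

lemma trig_scale: "a * trig S c x = trig S (\<lambda>k. of_real a * c k) x"
  by (simp add: trig_def sum_distrib_left mult.assoc)

lemma trig_complex:
  assumes "sym_coeff S c"
  shows "complex_of_real (trig S c x) = (\<Sum>k\<in>S. c k * chr k x)"
proof -
  have "cnj (\<Sum>k\<in>S. c k * chr k x) = (\<Sum>k\<in>S. c (- k) * chr (- k) x)"
    using assms by (simp add: chr_minus sym_coeff_def)
  also have "\<dots> = (\<Sum>k\<in>S. c k * chr k x)"
    by (rule sum.reindex_bij_witness[of _ uminus uminus]) (use assms in \<open>auto simp: sym_coeff_def\<close>)
  finally have "cnj (\<Sum>k\<in>S. c k * chr k x) = (\<Sum>k\<in>S. c k * chr k x)" .
  moreover have "complex_of_real (Re w) = w" if "cnj w = w" for w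
    using that by (simp add: complex_eq_iff)
  ultimately show ?thesis unfolding trig_def by blast
qed

lemma fourier_coeff_trig:
  assumes "sym_coeff S c" "finite S"
  shows "fourier_coeff (trig S c) k = (if k \<in> S then c k else 0)"
proof -
  have "fourier_coeff (trig S c) k = (LINT x|torus. (\<Sum>l\<in>S. c l * chr (l - k) x))"
    unfolding fourier_coeff_chr trig_complex[OF assms(1)]
    by (simp add: sum_distrib_left chr_add[symmetric] mult.left_commute diff_conv_add_uminus add.commute
        del: add_uminus_conv_diff)
  also have "\<dots> = (\<Sum>l\<in>S. LINT x|torus. c l * chr (l - k) x)"
    by (rule Bochner_Integration.integral_sum) (intro continuous_integrable_torus continuous_intros)
  also have "\<dots> = (\<Sum>l\<in>S. if l = k then c k else 0)"
    by (intro sum.cong) (auto simp: LINT_chr)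
  finally show ?thesis using assms(2) by simp
qed

lemma LINT_mult_trig:
  assumes f: "integrable torus f"
  shows "integrable torus (\<lambda>x. f x * trig S c x)"
    and "(LINT x|torus. f x * trig S c x) = (\<Sum>k\<in>S. Re (c k * cnj (fourier_coeff f k)))"
proof -
  have eq: "f x * trig S c x = (\<Sum>k\<in>S. Re (c k * (chr k x * complex_of_real (f x))))" for x
    by (simp add: trig_def sum_distrib_left algebra_simps)
  have int: "integrable torus (\<lambda>x. c k * (chr k x * complex_of_real (f x)))" for k
    by (intro integrable_mult_right L1_integrable_chr f)
  show "integrable torus (\<lambda>x. f x * trig S c x)"
    unfolding eq by (intro Bochner_Integration.integrable_sum integrable_Re int)
  have "(LINT x|torus. f x * trig S c x) = (\<Sum>k\<in>S. LINT x|torus. Re (c k * (chr k x * complex_of_real (f x))))"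
    unfolding eq by (intro Bochner_Integration.integral_sum integrable_Re int)
  also have "\<dots> = (\<Sum>k\<in>S. Re (c k * (LINT x|torus. chr k x * complex_of_real (f x))))"
    by (intro sum.cong) (simp_all only: integral_Re[OF int] integral_mult_right_zero)
  also have "\<dots> = (\<Sum>k\<in>S. Re (c k * cnj (fourier_coeff f k)))"
  proof -
    have "(LINT x|torus. chr k x * complex_of_real (f x)) = cnj (fourier_coeff f k)" for k
      using fourier_coeff_minus[of f k] by (simp add: fourier_coeff_chr[of f "- k"])
    then show ?thesis by (simp only:)
  qed
  finally show "(LINT x|torus. f x * trig S c x) = \<dots>" .
qed

lemma sq_int_trig:
  assumes "sym_coeff S c" "finite S"
  shows "sq_int (trig S c) = (\<Sum>k\<in>S. (cmod (c k))\<^sup>2)"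
  using LINT_mult_trig(2)[OF L2_integrable[OF trig_L2], of S c S c] assms
  by (simp add: sq_int_def power2_eq_square[of "trig S c _"] fourier_coeff_trig
      cmod_power2 power2_eq_square[of "Re _"] power2_eq_square[of "Im _"] cong: sum.cong)

lemma sym_coeff_fourier: "(\<And>k. k \<in> S \<Longrightarrow> - k \<in> S) \<Longrightarrow> sym_coeff S (fourier_coeff f)"
  by (simp add: sym_coeff_def fourier_coeff_minus)

lemma bessel:
  assumes f: "f \<in> L2" and S: "finite S" "\<And>k. k \<in> S \<Longrightarrow> - k \<in> S"
  shows "sq_int (\<lambda>x. trig S (fourier_coeff f) x - f x) = sq_int f - (\<Sum>k\<in>S. (cmod (fourier_coeff f k))\<^sup>2)"
proof -
  let ?t = "trig S (fourier_coeff f)"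
  have eq: "(?t x - f x)\<^sup>2 = ((?t x)\<^sup>2 + (f x)\<^sup>2) - 2 * (f x * ?t x)" for x
    by (simp add: power2_diff algebra_simps)
  have "sq_int (\<lambda>x. ?t x - f x) = sq_int ?t + sq_int f - 2 * (LINT x|torus. f x * ?t x)"
    unfolding sq_int_def eq
    using L2_integrable_sq[OF f] L2_integrable_sq[OF trig_L2[of S "fourier_coeff f"]]
      LINT_mult_trig(1)[OF L2_integrable[OF f], of S "fourier_coeff f"] by simp
  also have "(LINT x|torus. f x * ?t x) = (\<Sum>k\<in>S. (cmod (fourier_coeff f k))\<^sup>2)"
    by (simp add: LINT_mult_trig(2)[OF L2_integrable[OF f]] cmod_power2
        power2_eq_square[of "Re _"] power2_eq_square[of "Im _"])
  also have "sq_int ?t = (\<Sum>k\<in>S. (cmod (fourier_coeff f k))\<^sup>2)"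
    by (intro sq_int_trig sym_coeff_fourier S)
  finally show ?thesis by simp
qed

text \<open>The Fourier partial sums are Cauchy in L^2. Their limit has the coefficients of
  \<open>f\<close>, hence equals \<open>f\<close> almost everywhere, and then the defect in
  \<open>bessel\<close> tends to 0.\<close>

lemma parseval:
  fixes f :: "real ^ 'n \<Rightarrow> real"
  assumes f: "f \<in> L2"
  shows "((\<lambda>k. (cmod (fourier_coeff f k))\<^sup>2) has_sum sq_int f) UNIV"
proof -
  let ?a = "\<lambda>k. (cmod (fourier_coeff f k))\<^sup>2"
  let ?s = "\<lambda>n. sum ?a (freq_box n)"
  let ?t = "\<lambda>n. trig (freq_box n) (fourier_coeff f)"
  have le: "?s n \<le> sq_int f" for n
    using bessel[OF f finite_freq_box uminus_freq_box, of n] sq_int_nonneg[of "\<lambda>x. ?t n x - f x"] by simp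
  have mono: "?s m \<le> ?s n" if "m \<le> n" for m n
    using that by (intro sum_mono2 freq_box_mono) auto
  have "convergent ?s"
  proof (rule Bseq_mono_convergent)
    have "norm (?s n) \<le> sq_int f" for n using le[of n] by (simp add: sum_nonneg abs_of_nonneg)
    then show "Bseq ?s" by (rule BseqI')
  qed (use mono in auto)
  then have sC: "Cauchy ?s" by (simp add: Cauchy_convergent_iff)
  have diff: "sq_int (\<lambda>x. ?t m x - ?t n x) = \<bar>?s m - ?s n\<bar>" for m n
  proof -
    have gen: "sq_int (\<lambda>x. ?t m x - ?t n x) = ?s m - ?s n" if "n \<le> m" for m n
    proof -
      have sub: "freq_box n \<subseteq> freq_box m" using that by (rule freq_box_mono)
      have "(\<lambda>x. ?t m x - ?t n x) = trig (freq_box m - freq_box n) (fourier_coeff f)"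
        using sum_diff[OF finite_freq_box sub, of "\<lambda>k. fourier_coeff f k * chr k x" for x]
        by (simp add: trig_def fun_eq_iff del: Re_sum)
      moreover have "sq_int (trig (freq_box m - freq_box n) (fourier_coeff f)) = sum ?a (freq_box m - freq_box n)"
      proof (intro sq_int_trig sym_coeff_fourier)
        fix k :: "int ^ 'n" assume "k \<in> freq_box m - freq_box n"
        then show "- k \<in> freq_box m - freq_box n"
          using uminus_freq_box[of k m] uminus_freq_box[of "- k" n] by auto
      qed auto
      ultimately show ?thesis by (simp add: sum_diff[OF finite_freq_box sub])
    qed
    show ?thesis
    proof (cases "n \<le> m")
      case True
      then show ?thesis using gen[OF True] mono[OF True] by simp
    next
      case False
      then show ?thesis using gen[of m n] mono[of m n] sq_int_diff_commute[of "?t m" "?t n"] by simp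
    qed
  qed
  have cau: "\<exists>M. \<forall>m\<ge>M. \<forall>n\<ge>M. sq_int (\<lambda>x. ?t m x - ?t n x) < e" if "e > 0" for e
    using sC that unfolding diff Cauchy_def dist_real_def by simp
  obtain g r where g: "g \<in> L2" "(\<lambda>n. sq_int (\<lambda>x. ?t n x - g x)) \<longlonglongrightarrow> 0"
    by (rule L2_complete[of ?t, OF trig_L2 cau])
  have coeff: "fourier_coeff g k = fourier_coeff f k" for k
  proof (rule LIMSEQ_unique[OF sq_int_tendsto_fourier_coeff[OF trig_L2 g]])
    obtain N where N: "{k} \<subseteq> freq_box N" using finite_subset_freq_box[of "{k}"] by auto
    have "fourier_coeff (?t n) k = fourier_coeff f k" if "n \<ge> N" for n
    proof -
      have "k \<in> freq_box n" using N freq_box_mono[OF that] by auto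
      then show ?thesis
        by (subst fourier_coeff_trig) (auto intro: sym_coeff_fourier uminus_freq_box)
    qed
    then show "(\<lambda>n. fourier_coeff (?t n) k) \<longlonglongrightarrow> fourier_coeff f k"
      by (intro tendsto_eventually) (auto simp: eventually_sequentially)
  qed
  have "AE x in torus. g x - f x = 0"
    using fourier_coeff_diff[OF L2_integrable[OF g(1)] L2_integrable[OF f]] coeff
    by (intro fourier_coeff_zero_AE L2_integrable L2_diff g f) auto
  then have eqAE: "sq_int (\<lambda>x. ?t n x - g x) = sq_int (\<lambda>x. ?t n x - f x)" for n
    unfolding sq_int_def
    using L2_measurable[OF L2_diff[OF trig_L2 g(1)]] L2_measurable[OF L2_diff[OF trig_L2 f]]
    by (intro integral_cong_AE) (auto elim: eventually_mono)
  have "(\<lambda>n. sq_int f - ?s n) \<longlonglongrightarrow> 0"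
    using g(2) bessel[OF f finite_freq_box uminus_freq_box] by (simp add: eqAE)
  then have slim: "?s \<longlonglongrightarrow> sq_int f"
    using tendsto_diff[OF tendsto_const, of "\<lambda>n. sq_int f - ?s n" 0 sequentially "sq_int f"] by simp
  have fin_le: "sum ?a S \<le> sq_int f" if fin: "finite S" for S
  proof -
    obtain n where "S \<subseteq> freq_box n" using fin by (rule finite_subset_freq_box)
    then have "sum ?a S \<le> ?s n" by (intro sum_mono2) auto
    with le[of n] show ?thesis by linarith
  qed
  have summ: "?a summable_on UNIV"
    using fin_le by (intro nonneg_bdd_above_summable_on bdd_aboveI[of _ "sq_int f"]) auto
  have "infsum ?a UNIV \<le> sq_int f"
    using fin_le by (intro infsum_le_finite_sums summ) auto
  moreover have "sq_int f \<le> infsum ?a UNIV"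
    using slim by (rule LIMSEQ_le_const2) (use finite_sum_le_infsum[OF summ finite_freq_box] in auto)
  ultimately have "infsum ?a UNIV = sq_int f" by simp
  with summ show ?thesis by (metis has_sum_infsum)
qed

text \<open>Polarisation of \<open>parseval\<close>.\<close>

lemma parseval_inner:
  assumes f: "f \<in> L2" and g: "g \<in> L2"
  shows "((\<lambda>k. Re (fourier_coeff f k * cnj (fourier_coeff g k))) has_sum (LINT x|torus. f x * g x)) UNIV"
proof -
  have "((\<lambda>k. 1/4 * ((cmod (fourier_coeff (\<lambda>x. f x + g x) k))\<^sup>2 + - (cmod (fourier_coeff (\<lambda>x. f x - g x) k))\<^sup>2))
      has_sum 1/4 * (sq_int (\<lambda>x. f x + g x) + - sq_int (\<lambda>x. f x - g x))) UNIV"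
    by (intro has_sum_cmult_right has_sum_add has_sum_uminusI parseval L2_add L2_diff f g)
  moreover have "1/4 * ((cmod (fourier_coeff (\<lambda>x. f x + g x) k))\<^sup>2 + - (cmod (fourier_coeff (\<lambda>x. f x - g x) k))\<^sup>2)
      = Re (fourier_coeff f k * cnj (fourier_coeff g k))" for k
    unfolding fourier_coeff_add[OF L2_integrable[OF f] L2_integrable[OF g]]
      fourier_coeff_diff[OF L2_integrable[OF f] L2_integrable[OF g]] cmod_power2
    by (simp add: power2_eq_square algebra_simps)
  moreover have "1/4 * (sq_int (\<lambda>x. f x + g x) + - sq_int (\<lambda>x. f x - g x)) = (LINT x|torus. f x * g x)"
  proof -
    have "f x * g x = 1/4 * ((f x + g x)\<^sup>2 - (f x - g x)\<^sup>2)" for x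
      by (simp add: power2_eq_square algebra_simps)
    then have "(LINT x|torus. f x * g x) = (LINT x|torus. 1/4 * ((f x + g x)\<^sup>2 - (f x - g x)\<^sup>2))"
      by presburger
    also have "\<dots> = 1/4 * (sq_int (\<lambda>x. f x + g x) - sq_int (\<lambda>x. f x - g x))"
      using L2_integrable_sq[OF L2_add[OF f g]] L2_integrable_sq[OF L2_diff[OF f g]]
      by (simp add: sq_int_def)
    finally show ?thesis by simp
  qed
  ultimately show ?thesis by (simp only:)
qed

section \<open>A bounded kernel\<close>

text \<open>Moves frequencies into a normed space, since \<open>int ^ 'n\<close> carries no
  norm.\<close>

definition freq_vec :: "int ^ 'n \<Rightarrow> real ^ 'n" where
  "freq_vec k = (\<chi> i. of_int (k $ i))"

abbreviation fnorm :: "int ^ 'n \<Rightarrow> real" where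
  "fnorm k \<equiv> norm (freq_vec k)"

lemma freq_vec_nth [simp]: "freq_vec k $ i = of_int (k $ i)"
  by (simp add: freq_vec_def)

lemma freq_vec_diff: "freq_vec (k - l) = freq_vec k - freq_vec l"
  by (simp add: vec_eq_iff)

lemma freq_vec_uminus: "freq_vec (- k) = - freq_vec k"
  by (simp add: vec_eq_iff)

lemma freq_vec_0 [simp]: "freq_vec 0 = 0"
  by (simp add: vec_eq_iff)

lemma freq_vec_eq_0_iff [simp]: "freq_vec k = 0 \<longleftrightarrow> k = 0"
  by (simp add: vec_eq_iff)

lemma freq_vec_axis: "freq_vec (axis r 1) = axis r 1"
  by (simp add: vec_eq_iff axis_def)

lemma fnorm_sq: "(fnorm k)\<^sup>2 = (\<Sum>i\<in>UNIV. (of_int (k $ i))\<^sup>2)"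
  unfolding norm_vec_def L2_set_def by (simp add: sum_nonneg)

lemma fnorm_ge_1:
  assumes "k \<noteq> 0"
  shows "1 \<le> fnorm k"
proof -
  obtain i where "k $ i \<noteq> 0" using assms by (auto simp: vec_eq_iff)
  then have "1 \<le> \<bar>real_of_int (k $ i)\<bar>" by linarith
  also have "\<dots> \<le> fnorm k" using component_le_norm_cart[of "freq_vec k" i] by simp
  finally show ?thesis .
qed

lemma freq_box_fnorm_le:
  fixes k :: "int ^ 'n"
  assumes "k \<in> freq_box N"
  shows "fnorm k \<le> real CARD('n) * real N"
proof -
  have "fnorm k \<le> (\<Sum>i\<in>UNIV. \<bar>freq_vec k $ i\<bar>)" by (rule norm_le_l1_cart)
  also have "\<dots> \<le> (\<Sum>i\<in>(UNIV :: 'n set). real N)"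
  proof (rule sum_mono)
    fix i
    have "\<bar>k $ i\<bar> \<le> int N" using assms by (simp add: freq_box_def)
    then have "real_of_int \<bar>k $ i\<bar> \<le> real_of_int (int N)" by (simp only: of_int_le_iff)
    then show "\<bar>freq_vec k $ i\<bar> \<le> real N" by simp
  qed
  finally show ?thesis by simp
qed

lemma fnorm_le_freq_box: "fnorm k \<le> real N \<Longrightarrow> k \<in> freq_box N"
  unfolding freq_box_def
proof (intro CollectI allI)
  fix i assume "fnorm k \<le> real N"
  then have "\<bar>real_of_int (k $ i)\<bar> \<le> real N"
    using component_le_norm_cart[of "freq_vec k" i] by simp
  then show "\<bar>k $ i\<bar> \<le> int N" by linarith
qed

text \<open>The traceless part of the matrix \<open>k k\<^sup>T\<close>; its sum over symmetric frequency sets vanishes, which makes the kernel bounded.\<close>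
definition symb :: "'n \<Rightarrow> 'n \<Rightarrow> int ^ 'n \<Rightarrow> real" where
  "symb j l k = of_int (k $ j) * of_int (k $ l) - (if j = l then (fnorm k)\<^sup>2 / real CARD('n) else 0)"

text \<open>A tent instead of a sharp truncation: its Lipschitz constant \<open>1 / N\<close> is
  what summation by parts turns into a gained power of \<open>N\<close>.\<close>

definition cutoff :: "nat \<Rightarrow> int ^ 'n \<Rightarrow> real" where
  "cutoff N k = max 0 (1 - fnorm k / real N)"

lemma cutoff_bounds: "0 \<le> cutoff N k" "cutoff N k \<le> 1"
  by (auto simp: cutoff_def)

lemma cutoff_eq_0: "N > 0 \<Longrightarrow> fnorm k \<ge> real N \<Longrightarrow> cutoff N k = 0"
  by (simp add: cutoff_def)

lemma cutoff_uminus: "cutoff N (- k) = cutoff N k"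
  by (simp add: cutoff_def freq_vec_uminus)

lemma cutoff_diff_le:
  assumes "N > 0"
  shows "\<bar>cutoff N k - cutoff N l\<bar> \<le> norm (freq_vec k - freq_vec l) / real N"
proof -
  have "\<bar>cutoff N k - cutoff N l\<bar> \<le> \<bar>fnorm k / real N - fnorm l / real N\<bar>"
    unfolding cutoff_def by linarith
  also have "\<dots> = \<bar>fnorm k - fnorm l\<bar> / real N"
    using assms by (simp add: diff_divide_distrib[symmetric])
  also have "\<dots> \<le> norm (freq_vec k - freq_vec l) / real N"
    by (intro divide_right_mono norm_triangle_ineq3) simp
  finally show ?thesis .
qed

lemma symb_le: "\<bar>symb j l (k :: int ^ 'n)\<bar> \<le> 2 * (fnorm k)\<^sup>2"
proof -
  have "\<bar>real_of_int (k $ j) * of_int (k $ l)\<bar> \<le> fnorm k * fnorm k"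
    unfolding abs_mult
    using component_le_norm_cart[of "freq_vec k" j] component_le_norm_cart[of "freq_vec k" l]
    by (intro mult_mono) auto
  moreover have "(fnorm k)\<^sup>2 / real CARD('n) \<le> (fnorm k)\<^sup>2 / 1"
    by (intro divide_left_mono) (auto simp: Suc_le_eq)
  moreover have "0 \<le> (fnorm k)\<^sup>2 / real CARD('n)" by simp
  moreover have aux: "\<bar>p - a\<bar> \<le> 2 * X" if "\<bar>p\<bar> \<le> X" "0 \<le> a" "a \<le> X" for p a X :: real
    using that by linarith
  ultimately show ?thesis
    unfolding symb_def by (intro aux) (auto simp: power2_eq_square)
qed

lemma symb_diff_le:
  fixes k l :: "int ^ 'n"
  shows "\<bar>symb i j k - symb i j l\<bar> \<le> 2 * (fnorm k + fnorm l) * norm (freq_vec k - freq_vec l)"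
proof -
  let ?D = "norm (freq_vec k - freq_vec l)"
  have c: "\<bar>of_int (k $ i) - of_int (l $ i)\<bar> \<le> ?D" for i
    using component_le_norm_cart[of "freq_vec k - freq_vec l" i] by simp
  have m: "\<bar>of_int (k $ i)\<bar> \<le> fnorm k" for i and k :: "int ^ 'n"
    using component_le_norm_cart[of "freq_vec k" i] by simp
  have "real_of_int (k $ i) * of_int (k $ j) - of_int (l $ i) * of_int (l $ j)
      = of_int (k $ i) * (of_int (k $ j) - of_int (l $ j)) + (of_int (k $ i) - of_int (l $ i)) * of_int (l $ j)"
    by (simp add: algebra_simps)
  also have "\<bar>\<dots>\<bar> \<le> \<bar>real_of_int (k $ i)\<bar> * \<bar>of_int (k $ j) - of_int (l $ j)\<bar> + \<bar>of_int (k $ i) - of_int (l $ i)\<bar> * \<bar>of_int (l $ j)\<bar>"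
    by (metis abs_mult abs_triangle_ineq)
  also have "\<dots> \<le> fnorm k * ?D + ?D * fnorm l"
    by (intro add_mono mult_mono c m) auto
  finally have 1: "\<bar>real_of_int (k $ i) * of_int (k $ j) - of_int (l $ i) * of_int (l $ j)\<bar> \<le> (fnorm k + fnorm l) * ?D"
    by (simp add: algebra_simps)
  have "\<bar>(fnorm k)\<^sup>2 - (fnorm l)\<^sup>2\<bar> = (fnorm k + fnorm l) * \<bar>fnorm k - fnorm l\<bar>"
    by (simp add: abs_mult square_diff_square_factored power2_eq_square)
  also have "\<dots> \<le> (fnorm k + fnorm l) * ?D"
    by (intro mult_left_mono norm_triangle_ineq3) simp
  finally have 2: "\<bar>(fnorm k)\<^sup>2 - (fnorm l)\<^sup>2\<bar> \<le> (fnorm k + fnorm l) * ?D" .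
  have "\<bar>(fnorm k)\<^sup>2 / real CARD('n) - (fnorm l)\<^sup>2 / real CARD('n)\<bar> = \<bar>(fnorm k)\<^sup>2 - (fnorm l)\<^sup>2\<bar> / real CARD('n)"
    by (simp add: diff_divide_distrib[symmetric])
  also have "\<dots> \<le> \<bar>(fnorm k)\<^sup>2 - (fnorm l)\<^sup>2\<bar> / 1"
    by (intro divide_left_mono) (auto simp: Suc_le_eq)
  finally have 3: "\<bar>(fnorm k)\<^sup>2 / real CARD('n) - (fnorm l)\<^sup>2 / real CARD('n)\<bar> \<le> (fnorm k + fnorm l) * ?D"
    using 2 by simp
  have aux: "\<bar>p - a - (q - b)\<bar> \<le> 2 * X" if "\<bar>p - q\<bar> \<le> X" "\<bar>a - b\<bar> \<le> X" for p q a b X :: real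
    using that by linarith
  have "\<bar>symb i j k - symb i j l\<bar> \<le> 2 * ((fnorm k + fnorm l) * ?D)"
    unfolding symb_def by (rule aux[OF 1]) (use 3 in auto)
  then show ?thesis by (simp only: mult.assoc)
qed

text \<open>Off the diagonal the terms cancel under reflection of coordinate \<open>j\<close>. On
  the diagonal, exchanging two coordinates shows that all second moments agree, so the subtracted
  trace is exactly their mean. Boxes and \<open>cutoff\<close> are invariant under both
  symmetries.\<close>

lemma sum_symb_cutoff:
  "(\<Sum>k\<in>freq_box N. symb j l k * cutoff N k) = 0" for j l :: "'n::finite"
proof (cases "j = l")
  case False
  define R where "R k = (\<chi> i. if i = j then - (k $ i) else k $ i)" for k :: "int ^ 'n"
  have RR: "R (R k) = k" for k by (simp add: R_def vec_eq_iff)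
  have Rbox: "R k \<in> freq_box N" if "k \<in> freq_box N" for k
    using that by (auto simp: R_def freq_box_def)
  have Rn: "fnorm (R k) = fnorm k" for k
  proof (rule power2_eq_imp_eq)
    show "(fnorm (R k))\<^sup>2 = (fnorm k)\<^sup>2"
      unfolding fnorm_sq by (rule sum.cong) (simp_all add: R_def)
  qed auto
  have "(\<Sum>k\<in>freq_box N. symb j l k * cutoff N k) = (\<Sum>k\<in>freq_box N. - (symb j l k * cutoff N k))"
  proof (rule sum.reindex_bij_witness[of _ R R])
    fix k :: "int ^ 'n" assume "k \<in> freq_box N"
    show "- (symb j l (R k) * cutoff N (R k)) = symb j l k * cutoff N k"
      using False by (simp add: symb_def cutoff_def Rn) (simp add: R_def)
  qed (auto simp: RR Rbox)
  then show ?thesis by (simp add: sum_negf)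
next
  case True
  define m where "m i = (\<Sum>k\<in>freq_box N. (of_int (k $ i))\<^sup>2 * cutoff N k)" for i :: 'n
  have m: "m i = m j" for i
  proof -
    define R where "R k = (\<chi> a. k $ (Transposition.transpose i j a))" for k :: "int ^ 'n"
    have RR: "R (R k) = k" for k by (simp add: R_def vec_eq_iff)
    have Rbox: "R k \<in> freq_box N" if "k \<in> freq_box N" for k
      using that by (auto simp: R_def freq_box_def)
    have Rn: "fnorm (R k) = fnorm k" for k
    proof (rule power2_eq_imp_eq)
      show "(fnorm (R k))\<^sup>2 = (fnorm k)\<^sup>2"
        unfolding fnorm_sq R_def
        by (rule sum.reindex_bij_witness[of _ "Transposition.transpose i j" "Transposition.transpose i j"]) auto
    qed auto
    show ?thesis unfolding m_def
    proof (rule sum.reindex_bij_witness[of _ R R])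
      fix k :: "int ^ 'n" assume "k \<in> freq_box N"
      show "(of_int (R k $ j))\<^sup>2 * cutoff N (R k) = (of_int (k $ i))\<^sup>2 * cutoff N k"
        unfolding cutoff_def Rn by (simp add: R_def)
    qed (auto simp: RR Rbox)
  qed
  have "(\<Sum>k\<in>(freq_box N :: (int ^ 'n) set). (fnorm k)\<^sup>2 * cutoff N k) = (\<Sum>i\<in>UNIV. m i)"
    unfolding fnorm_sq m_def sum_distrib_right by (rule sum.swap)
  also have "\<dots> = (\<Sum>i\<in>(UNIV :: 'n set). m j)"
    by (rule sum.cong[OF refl m])
  also have "\<dots> = real CARD('n) * m j" by simp
  finally have "(\<Sum>k\<in>(freq_box N :: (int ^ 'n) set). (fnorm k)\<^sup>2 * cutoff N k) = real CARD('n) * m j" .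
  moreover have "(\<Sum>k\<in>(freq_box N :: (int ^ 'n) set). symb j l k * cutoff N k) = m j - (\<Sum>k\<in>(freq_box N :: (int ^ 'n) set). (fnorm k)\<^sup>2 * cutoff N k) / real CARD('n)"
    using True by (simp add: symb_def m_def sum_subtractf left_diff_distrib sum_divide_distrib power2_eq_square)
  ultimately show ?thesis by simp
qed

text \<open>Comparable to the distance from \<open>x\<close> to the integer lattice, but written
  with the factors \<open>chr (axis r 1) x - 1\<close> that appear when a trigonometric sum is
  shifted by one frequency.\<close>

definition phase_dist :: "real ^ 'n \<Rightarrow> real" where
  "phase_dist x = (MAX r. norm (chr (axis r 1) x - 1))"

lemma phase_dist_ge: "norm (chr (axis r 1) x - 1) \<le> phase_dist x"
  unfolding phase_dist_def by (intro Max_ge) auto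

lemma phase_dist_attained: "\<exists>r. phase_dist x = norm (chr (axis r 1) x - 1)"
proof -
  have "phase_dist x \<in> range (\<lambda>r. norm (chr (axis r 1) x - 1))"
    unfolding phase_dist_def by (intro Max_in) auto
  then show ?thesis by auto
qed

lemma phase_dist_nonneg: "0 \<le> phase_dist x"
  using phase_dist_attained[of x] by auto

text \<open>De Moivre reduces this to |z^m - 1| \<le> m |z - 1| on the unit circle; conjugation
  handles negative \<open>n\<close>.\<close>

lemma norm_cis_int_diff:
  "norm (cis (of_int n * t) - 1) \<le> \<bar>of_int n\<bar> * norm (cis t - 1)"
proof -
  have nat: "norm (cis (real m * t) - 1) \<le> real m * norm (cis t - 1)" for m
    using norm_power_diff[of "cis t" 1 m] Complex.DeMoivre[of t m] by simp
  show ?thesis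
  proof (cases "n \<ge> 0")
    case True
    then show ?thesis using nat[of "nat n"] by simp
  next
    case False
    have "norm (cis (of_int n * t) - 1) = norm (cnj (cis (of_int n * t) - 1))"
      by (rule complex_mod_cnj[symmetric])
    also have "\<dots> = norm (cis (real (nat (- n)) * t) - 1)"
      using False by (simp add: cis_cnj)
    also have "\<dots> \<le> real (nat (- n)) * norm (cis t - 1)" by (rule nat)
    finally show ?thesis using False by simp
  qed
qed

lemma cis_sum: "cis (\<Sum>i\<in>A. f i) = (\<Prod>i\<in>A. cis (f i))"
  by (induction A rule: infinite_finite_induct) (auto simp: cis_mult[symmetric])

lemma chr_axis_eq: "chr (axis r 1) x = cis (2 * pi * x $ r)"
  using torus_map_chr[of x r] by (simp add: torus_map_def)

lemma norm_chr_diff_le: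
  fixes k :: "int ^ 'n"
  assumes "k \<in> freq_box N"
  shows "norm (chr k x - 1) \<le> real CARD('n) * real N * phase_dist x"
proof -
  have "chr k x = (\<Prod>r\<in>UNIV. cis (of_int (k $ r) * (2 * pi * x $ r)))"
    unfolding chr_def cis_sum[symmetric] by (simp add: sum_distrib_left mult_ac)
  then have "norm (chr k x - 1) = norm ((\<Prod>r\<in>UNIV. cis (of_int (k $ r) * (2 * pi * x $ r))) - (\<Prod>r\<in>(UNIV :: 'n set). 1))"
    by simp
  also have "\<dots> \<le> (\<Sum>r\<in>UNIV. norm (cis (of_int (k $ r) * (2 * pi * x $ r)) - 1))"
    by (rule norm_prod_diff) auto
  also have "\<dots> \<le> (\<Sum>r\<in>(UNIV :: 'n set). real N * phase_dist x)"
  proof (rule sum_mono)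
    fix r
    have "\<bar>k $ r\<bar> \<le> int N" using assms by (simp add: freq_box_def)
    then have "\<bar>real_of_int (k $ r)\<bar> \<le> real N" by linarith
    moreover have "norm (cis (2 * pi * x $ r) - 1) \<le> phase_dist x"
      using phase_dist_ge[of r x] by (simp add: chr_axis_eq)
    ultimately have "\<bar>of_int (k $ r)\<bar> * norm (cis (2 * pi * x $ r) - 1) \<le> real N * phase_dist x"
      by (intro mult_mono) auto
    with norm_cis_int_diff[of "k $ r" "2 * pi * x $ r"]
    show "norm (cis (of_int (k $ r) * (2 * pi * x $ r)) - 1) \<le> real N * phase_dist x" by linarith
  qed
  finally show ?thesis by (simp add: mult_ac)
qed

section \<open>The kernel at a single scale\<close>

definition scale_kernel :: "nat \<Rightarrow> 'n \<Rightarrow> 'n \<Rightarrow> real ^ 'n \<Rightarrow> complex" where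
  "scale_kernel N j l x = (\<Sum>k\<in>freq_box N. of_real (symb j l k * cutoff N k) * chr k x)"

text \<open>The coefficients sum to zero, so \<open>chr k x\<close> may be replaced by
  \<open>chr k x - 1\<close>. This gains the factor \<open>N * phase_dist x\<close> over the trivial
  bound of order \<open>N ^ (CARD('n) + 2)\<close>.\<close>

lemma scale_kernel_small:
  fixes x :: "real ^ 'n"
  assumes "N > 0"
  shows "norm (scale_kernel N j l x) \<le> 2 * real CARD('n) ^ 3 * 3 ^ CARD('n) * real N ^ (CARD('n) + 3) * phase_dist x"
proof -
  let ?d = "real CARD('n)"
  have "scale_kernel N j l x = (\<Sum>k\<in>freq_box N. of_real (symb j l k * cutoff N k) * (chr k x - 1))"
    using sum_symb_cutoff[where 'n='n, of j l N]
    by (simp add: scale_kernel_def right_diff_distrib sum_subtractf flip: of_real_mult of_real_sum)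
  also have "norm \<dots> \<le> (\<Sum>k\<in>(freq_box N :: (int ^ 'n) set). 2 * (?d * real N)\<^sup>2 * (?d * real N * phase_dist x))"
  proof (rule order_trans[OF norm_sum sum_mono])
    fix k :: "int ^ 'n" assume k: "k \<in> freq_box N"
    have "\<bar>symb j l k\<bar> * \<bar>cutoff N k\<bar> \<le> (2 * (?d * real N)\<^sup>2) * 1"
    proof (intro mult_mono)
      have "2 * (fnorm k)\<^sup>2 \<le> 2 * (?d * real N)\<^sup>2"
        using freq_box_fnorm_le[OF k] by (intro mult_left_mono power_mono) auto
      with symb_le[of j l k] show "\<bar>symb j l k\<bar> \<le> 2 * (?d * real N)\<^sup>2" by linarith
    qed (use cutoff_bounds[of N k] in auto)
    then have "\<bar>symb j l k\<bar> * \<bar>cutoff N k\<bar> \<le> 2 * (?d * real N)\<^sup>2" by simp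
    then show "norm (of_real (symb j l k * cutoff N k) * (chr k x - 1)) \<le> 2 * (?d * real N)\<^sup>2 * (?d * real N * phase_dist x)"
      unfolding norm_mult norm_of_real abs_mult
      by (rule mult_mono[OF _ norm_chr_diff_le[OF k]]) auto
  qed
  also have "\<dots> = real ((2 * N + 1) ^ CARD('n)) * (2 * (?d * real N)\<^sup>2 * (?d * real N * phase_dist x))"
    using card_freq_box[where 'n='n, of N] by simp
  also have "\<dots> \<le> real ((3 * N) ^ CARD('n)) * (2 * (?d * real N)\<^sup>2 * (?d * real N * phase_dist x))"
    using assms phase_dist_nonneg[of x]
    by (intro mult_right_mono of_nat_mono power_mono mult_nonneg_nonneg) auto
  also have "\<dots> = 2 * ?d ^ 3 * 3 ^ CARD('n) * real N ^ (CARD('n) + 3) * phase_dist x"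
    by (simp add: power_mult_distrib power_add power2_eq_square power3_eq_cube)
  finally show ?thesis .
qed

text \<open>Summation by parts in the direction in which \<open>x\<close> is furthest from the lattice.\<close>
lemma scale_kernel_large:
  fixes x :: "real ^ 'n"
  assumes "N > 0"
  shows "phase_dist x * norm (scale_kernel N j l x) \<le> 30 * real CARD('n) ^ 2 * 5 ^ CARD('n) * real N ^ (CARD('n) + 1)"
proof -
  let ?d = "real CARD('n)"
  have d1: "?d \<ge> 1" by (simp add: Suc_le_eq)
  obtain r where r: "phase_dist x = norm (chr (axis r 1) x - 1)" using phase_dist_attained by blast
  define e :: "int ^ 'n" where "e = axis r 1"
  define a where "a k = symb j l k * cutoff N k" for k :: "int ^ 'n"
  \<comment> \<open>One layer beyond \<open>freq_box N\<close>, so that it also contains the support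
    of the coefficients shifted by \<open>e\<close>.\<close>
  define B where "B = (freq_box (Suc N) :: (int ^ 'n) set)"
  have a0: "a k = 0" if "k \<notin> freq_box N" for k
  proof -
    have "real N \<le> fnorm k" using fnorm_le_freq_box[of k N] that by (metis linear)
    then show ?thesis using assms by (simp add: a_def cutoff_eq_0)
  qed
  have shift: "k + e \<in> B" if "k \<in> freq_box N" for k
    using that by (auto simp: B_def freq_box_def e_def axis_def abs_le_iff dest: spec)
      (smt (verit, best))+
  have ker: "scale_kernel N j l x = (\<Sum>k\<in>B. of_real (a k) * chr k x)"
    unfolding scale_kernel_def a_def[symmetric] B_def
    by (rule sum.mono_neutral_left) (use freq_box_mono[of N "Suc N"] a0 in auto)
  have "chr e x * scale_kernel N j l x = (\<Sum>k\<in>freq_box N. of_real (a k) * chr (k + e) x)"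
    unfolding scale_kernel_def a_def[symmetric] by (simp add: sum_distrib_left chr_add mult_ac)
  also have "\<dots> = (\<Sum>k\<in>(\<lambda>k. k + e) ` freq_box N. of_real (a (k - e)) * chr k x)"
    by (subst sum.reindex) (auto simp: inj_on_def)
  also have "\<dots> = (\<Sum>k\<in>B. of_real (a (k - e)) * chr k x)"
  proof (rule sum.mono_neutral_left)
    show "\<forall>k\<in>B - (\<lambda>k. k + e) ` freq_box N. of_real (a (k - e)) * chr k x = 0"
    proof
      fix k assume k: "k \<in> B - (\<lambda>k. k + e) ` freq_box N"
      have "k - e \<notin> freq_box N"
      proof
        assume "k - e \<in> freq_box N"
        then have "(k - e) + e \<in> (\<lambda>k. k + e) ` freq_box N" by (rule imageI)
        with k show False by simp
      qed
      then show "of_real (a (k - e)) * chr k x = 0" by (simp add: a0)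
    qed
  qed (use shift in \<open>auto simp: B_def\<close>)
  finally have "(chr e x - 1) * scale_kernel N j l x = (\<Sum>k\<in>B. of_real (a (k - e) - a k) * chr k x)"
    by (simp add: left_diff_distrib sum_subtractf ker)
  also have "norm \<dots> \<le> (\<Sum>k\<in>B. 30 * ?d\<^sup>2 * real N)"
  proof (rule order_trans[OF norm_sum sum_mono])
    fix k assume k: "k \<in> B"
    have N: "real N \<ge> 1" using assms by simp
    have ek: "norm (freq_vec (k - e) - freq_vec k) = 1"
      by (simp add: freq_vec_diff e_def freq_vec_axis norm_axis_1)
    have "fnorm k \<le> ?d * real (Suc N)" using k unfolding B_def by (rule freq_box_fnorm_le)
    also have "\<dots> \<le> ?d * (2 * real N)" using N by (intro mult_left_mono) auto
    finally have k2: "fnorm k \<le> 2 * ?d * real N" by simp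
    have "fnorm (k - e) \<le> fnorm k + 1"
      using norm_triangle_ineq4[of "freq_vec k" "freq_vec e"] by (simp add: freq_vec_diff e_def freq_vec_axis norm_axis_1)
    also have "1 \<le> ?d * real N" using d1 N by (metis mult_mono' mult_1 zero_le_one)
    finally have ke3: "fnorm (k - e) \<le> 3 * ?d * real N" using k2 by simp
    have "a (k - e) - a k = symb j l (k - e) * (cutoff N (k - e) - cutoff N k) + (symb j l (k - e) - symb j l k) * cutoff N k"
      by (simp add: a_def algebra_simps)
    also have "\<bar>\<dots>\<bar> \<le> \<bar>symb j l (k - e)\<bar> * \<bar>cutoff N (k - e) - cutoff N k\<bar> + \<bar>symb j l (k - e) - symb j l k\<bar> * \<bar>cutoff N k\<bar>"
      by (metis abs_mult abs_triangle_ineq)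
    \<comment> \<open>The size of \<open>symb\<close>, of order \<open>N\<close> squared, meets the
      Lipschitz constant \<open>1 / N\<close> of the cutoff, and the increment of
      \<open>symb\<close> is itself of order \<open>N\<close>. Either term is one power of
      \<open>N\<close> better than \<open>symb\<close>.\<close>
    also have "\<dots> \<le> (2 * (3 * ?d * real N)\<^sup>2) * (1 / real N) + (2 * (3 * ?d * real N + 2 * ?d * real N) * 1) * 1"
    proof (intro add_mono mult_mono)
      have "2 * (fnorm (k - e))\<^sup>2 \<le> 2 * (3 * ?d * real N)\<^sup>2"
        using ke3 by (intro mult_left_mono power_mono) auto
      with symb_le[of j l "k - e"] show "\<bar>symb j l (k - e)\<bar> \<le> 2 * (3 * ?d * real N)\<^sup>2" by linarith
      show "\<bar>cutoff N (k - e) - cutoff N k\<bar> \<le> 1 / real N"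
        using cutoff_diff_le[OF assms, of "k - e" k] ek by simp
      have "2 * (fnorm (k - e) + fnorm k) * norm (freq_vec (k - e) - freq_vec k) \<le> 2 * (3 * ?d * real N + 2 * ?d * real N) * 1"
        unfolding ek by (intro mult_right_mono mult_left_mono add_mono ke3 k2) simp_all
      with symb_diff_le[of j l "k - e" k]
      show "\<bar>symb j l (k - e) - symb j l k\<bar> \<le> 2 * (3 * ?d * real N + 2 * ?d * real N) * 1" by linarith
    qed (use cutoff_bounds[of N k] in auto)
    also have "\<dots> = 18 * ?d\<^sup>2 * real N + 10 * (?d * real N)"
      using N by (simp add: power2_eq_square)
    also have "\<dots> \<le> 18 * ?d\<^sup>2 * real N + 12 * (?d\<^sup>2 * real N)"
      using d1 N by (intro add_left_mono mult_mono) (auto simp: power2_eq_square)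
    finally show "norm (of_real (a (k - e) - a k) * chr k x) \<le> 30 * ?d\<^sup>2 * real N"
      by (simp add: norm_mult mult_ac flip: of_real_diff)
  qed
  also have "\<dots> = real ((2 * Suc N + 1) ^ CARD('n)) * (30 * ?d\<^sup>2 * real N)"
    using card_freq_box[where 'n='n, of "Suc N"] by (simp add: B_def)
  also have "\<dots> \<le> real ((5 * N) ^ CARD('n)) * (30 * ?d\<^sup>2 * real N)"
    using assms by (intro mult_right_mono of_nat_mono power_mono mult_nonneg_nonneg) auto
  also have "\<dots> = 30 * ?d\<^sup>2 * 5 ^ CARD('n) * real N ^ (CARD('n) + 1)"
    by (simp add: power_mult_distrib)
  finally show ?thesis by (simp add: r e_def norm_mult)
qed

section \<open>Summation over dyadic scales\<close>

lemma sum_dyadic_le: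
  fixes R :: real
  assumes "R \<ge> 0"
  shows "(\<Sum>i\<le>I. if 2 ^ i \<le> R then 2 ^ i else 0) \<le> 2 * R"
proof (induction I)
  case 0
  then show ?case using assms by (cases "1 \<le> R") simp_all
next
  case (Suc I)
  show ?case
  proof (cases "2 ^ Suc I \<le> R")
    case True
    have "(\<Sum>i\<le>Suc I. if 2 ^ i \<le> R then 2 ^ i else 0) \<le> (\<Sum>i\<le>Suc I. 2 ^ i :: real)"
      by (intro sum_mono) auto
    also have "\<dots> \<le> 2 * 2 ^ Suc I"
      using sum_power2[of "Suc (Suc I)"] by (simp add: lessThan_Suc_atMost sum_gp0)
    finally show ?thesis using True by linarith
  next
    case False
    then show ?thesis using Suc by simp
  qed
qed

lemma sum_dyadic_inverse_le:
  fixes R :: real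
  assumes "R > 0"
  shows "(\<Sum>i\<le>I. if 2 ^ i > R then 1 / 2 ^ i else 0) \<le> 2 / R"
proof -
  \<comment> \<open>The subtracted \<open>1 / 2 ^ I\<close> is the tail of the geometric series
    still to come; this stronger bound is what the induction can carry.\<close>
  have "(\<Sum>i\<le>I. if 2 ^ i > R then 1 / 2 ^ i else 0) \<le> (if 2 ^ I > R then 2 / R - 1 / 2 ^ I else 0)"
  proof (induction I)
    case 0
    then show ?case using assms by (auto simp: field_simps)
  next
    case (Suc I)
    consider "2 ^ I > R" | "2 ^ I \<le> R" "2 ^ Suc I > R" | "2 ^ Suc I \<le> R" by linarith
    then show ?case
    proof cases
      case 1
      moreover have "(2::real) ^ I \<le> 2 ^ Suc I" by simp
      ultimately have "2 ^ Suc I > R" by linarith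
      moreover have "1 / 2 ^ Suc I = (1 / 2 ^ I) / (2 :: real)" by simp
      moreover have aux: "s + c \<le> a - c" if "s \<le> a - b" "c = b / 2" for s a b c :: real
        using that by linarith
      ultimately show ?thesis using 1 Suc by (simp only: sum.atMost_Suc if_True aux)
    next
      case 2
      then have "(\<Sum>i\<le>Suc I. if 2 ^ i > R then 1 / 2 ^ i else 0) \<le> (1 / 2 ^ Suc I :: real)"
        using Suc by simp
      also have "\<dots> \<le> 2 / R - 1 / 2 ^ Suc I"
        using 2 assms by (simp add: field_simps)
      finally show ?thesis using 2 by simp
    next
      case 3
      then have "2 ^ I \<le> R" using power_increasing[of I "Suc I" "2::real"] by linarith
      with 3 Suc show ?thesis by simp
    qed
  qed
  also have "\<dots> \<le> 2 / R" using assms by auto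
  finally show ?thesis .
qed

text \<open>A stand-in for the power \<open>-(d + 2)\<close> of \<open>fnorm k\<close>. Only scales
  with \<open>2 ^ i > fnorm k\<close> contribute, with geometrically decreasing bounds, so the sum
  is governed by the first few of them. The comparison is made precise in \<open>rho_upper\<close>
  and \<open>rho_lower\<close>.\<close>

definition dyadic_weight :: "nat \<Rightarrow> int ^ 'n \<Rightarrow> real" where
  "dyadic_weight I k = (\<Sum>i\<le>I. cutoff (2 ^ i) k / (2 ^ i) ^ (CARD('n) + 2))"

definition kernel :: "nat \<Rightarrow> 'n \<Rightarrow> 'n \<Rightarrow> real ^ 'n \<Rightarrow> complex" where
  "kernel I j l x = (\<Sum>k\<in>freq_box (2 ^ I). of_real (symb j l k * dyadic_weight I k) * chr k x)"

lemma kernel_eq: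
  "kernel I j l (x :: real ^ 'n) = (\<Sum>i\<le>I. scale_kernel (2 ^ i) j l x / (2 ^ i) ^ (CARD('n) + 2))"
proof -
  have "kernel I j l x = (\<Sum>k\<in>freq_box (2 ^ I). \<Sum>i\<le>I. of_real (symb j l k * cutoff (2 ^ i) k) * chr k x / (2 ^ i) ^ (CARD('n) + 2))"
    unfolding kernel_def dyadic_weight_def by (simp add: sum_distrib_left sum_distrib_right mult.assoc)
  also have "\<dots> = (\<Sum>i\<le>I. (\<Sum>k\<in>freq_box (2 ^ I). of_real (symb j l k * cutoff (2 ^ i) k) * chr k x) / (2 ^ i) ^ (CARD('n) + 2))"
    by (subst sum.swap) (simp add: sum_divide_distrib)
  also have "\<dots> = (\<Sum>i\<le>I. scale_kernel (2 ^ i) j l x / (2 ^ i) ^ (CARD('n) + 2))"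
  proof (rule sum.cong)
    fix i assume "i \<in> {..I}"
    then have "(2::nat) ^ i \<le> 2 ^ I" by (intro power_increasing) auto
    then have sub: "freq_box (2 ^ i) \<subseteq> (freq_box (2 ^ I) :: (int ^ 'n) set)" by (rule freq_box_mono)
    have z: "cutoff (2 ^ i) k = 0" if "k \<notin> freq_box (2 ^ i)" for k :: "int ^ 'n"
    proof (rule cutoff_eq_0)
      show "real (2 ^ i) \<le> fnorm k"
        using fnorm_le_freq_box[of k "2 ^ i"] that by (metis linear)
    qed simp
    have "(\<Sum>k\<in>freq_box (2 ^ I). of_real (symb j l k * cutoff (2 ^ i) k) * chr k x) = scale_kernel (2 ^ i) j l x"
      unfolding scale_kernel_def by (rule sum.mono_neutral_right) (use sub z in auto)
    then show "(\<Sum>k\<in>freq_box (2 ^ I). of_real (symb j l k * cutoff (2 ^ i) k) * chr k x) / (2 ^ i) ^ (CARD('n) + 2)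
        = scale_kernel (2 ^ i) j l x / (2 ^ i) ^ (CARD('n) + 2)" by simp
  qed simp
  finally show ?thesis .
qed

text \<open>The constants of \<open>scale_kernel_small\<close> and
  \<open>scale_kernel_large\<close>, each doubled by a geometric series.\<close>

definition kernel_const :: "'n::finite itself \<Rightarrow> real" where
  "kernel_const _ = 2 * (2 * real CARD('n) ^ 3 * 3 ^ CARD('n)) + 2 * (30 * real CARD('n) ^ 2 * 5 ^ CARD('n))"

text \<open>With s = \<open>phase_dist x\<close>, scale \<open>2 ^ i\<close> contributes at most a
  constant times \<open>2 ^ i * s\<close> by cancellation and at most a constant times
  \<open>1 / (2 ^ i * s)\<close> by oscillation. Using the first up to \<open>2 ^ i = 1 / s\<close>
  and the second beyond gives two geometric series with sums independent of \<open>x\<close> and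
  \<open>I\<close>. If s = 0, the first bound alone gives 0.\<close>

lemma kernel_bounded: "norm (kernel I j l (x :: real ^ 'n)) \<le> kernel_const TYPE('n)"
proof -
  let ?s = "phase_dist x"
  define A B where "A = 2 * real CARD('n) ^ 3 * 3 ^ CARD('n)" and "B = 30 * real CARD('n) ^ 2 * 5 ^ CARD('n)"
  have AB: "A \<ge> 0" "B \<ge> 0" by (auto simp: A_def B_def)
  have small: "norm (scale_kernel (2 ^ i) j l x / (2 ^ i) ^ (CARD('n) + 2)) \<le> A * (2 ^ i * ?s)" for i
  proof -
    have "norm (scale_kernel (2 ^ i) j l x) \<le> A * (2 ^ i) ^ (CARD('n) + 3) * ?s"
      using scale_kernel_small[of "2 ^ i" j l x] by (simp add: A_def)
    also have "\<dots> = A * (2 ^ i * ?s) * (2 ^ i) ^ (CARD('n) + 2)"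
      by (simp add: power_add eval_nat_numeral)
    finally show ?thesis by (simp add: norm_divide norm_mult norm_power divide_le_eq)
  qed
  show ?thesis
  proof (cases "?s = 0")
    case True
    have "scale_kernel (2 ^ i) j l x / (2 ^ i) ^ (CARD('n) + 2) = 0" for i
      using small[of i] True by simp
    then have "kernel I j l x = 0" unfolding kernel_eq by (intro sum.neutral) blast
    then show ?thesis using AB by (simp add: kernel_const_def A_def B_def)
  next
    case False
    then have s: "?s > 0" using phase_dist_nonneg[of x] by simp
    have large: "norm (scale_kernel (2 ^ i) j l x / (2 ^ i) ^ (CARD('n) + 2)) \<le> B * (1 / 2 ^ i) / ?s" for i
    proof -
      have "?s * norm (scale_kernel (2 ^ i) j l x) \<le> B * (2 ^ i) ^ (CARD('n) + 1)"
        using scale_kernel_large[of "2 ^ i" x j l] by (simp add: B_def)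
      also have "\<dots> = B * (1 / 2 ^ i) * (2 ^ i) ^ (CARD('n) + 2)"
        by (simp add: power_add eval_nat_numeral)
      finally have "norm (scale_kernel (2 ^ i) j l x) \<le> B * (1 / 2 ^ i) * (2 ^ i) ^ (CARD('n) + 2) / ?s"
        using s by (simp add: le_divide_eq mult.commute)
      then have "norm (scale_kernel (2 ^ i) j l x) / (2 ^ i) ^ (CARD('n) + 2) \<le> (B * (1 / 2 ^ i) / ?s * (2 ^ i) ^ (CARD('n) + 2)) / (2 ^ i) ^ (CARD('n) + 2)"
        by (intro divide_right_mono) auto
      then show ?thesis by (simp add: norm_divide norm_mult norm_power mult.commute)
    qed
    have "norm (kernel I j l x) \<le> (\<Sum>i\<le>I. norm (scale_kernel (2 ^ i) j l x / (2 ^ i) ^ (CARD('n) + 2)))"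
      unfolding kernel_eq by (rule norm_sum)
    also have "\<dots> \<le> (\<Sum>i\<le>I. A * ?s * (if 2 ^ i \<le> 1 / ?s then 2 ^ i else 0) + B / ?s * (if 2 ^ i > 1 / ?s then 1 / 2 ^ i else 0))"
    proof (rule sum_mono)
      fix i
      show "norm (scale_kernel (2 ^ i) j l x / (2 ^ i) ^ (CARD('n) + 2))
          \<le> A * ?s * (if 2 ^ i \<le> 1 / ?s then 2 ^ i else 0) + B / ?s * (if 2 ^ i > 1 / ?s then 1 / 2 ^ i else 0)"
        using small[of i] large[of i] by (cases "2 ^ i \<le> 1 / ?s") (simp_all add: mult_ac)
    qed
    also have "\<dots> = A * ?s * (\<Sum>i\<le>I. if 2 ^ i \<le> 1 / ?s then 2 ^ i else 0) + B / ?s * (\<Sum>i\<le>I. if 2 ^ i > 1 / ?s then 1 / 2 ^ i else 0)"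
      by (simp only: sum.distrib sum_distrib_left)
    also have "\<dots> \<le> A * ?s * (2 * (1 / ?s)) + B / ?s * (2 / (1 / ?s))"
      using s AB by (intro add_mono mult_left_mono sum_dyadic_le sum_dyadic_inverse_le) auto
    also have "\<dots> = 2 * A + 2 * B" using s by simp
    finally show ?thesis by (simp add: kernel_const_def A_def B_def)
  qed
qed

section \<open>The quadratic form of the kernel\<close>

text \<open>Up to a factor 2 pi i, the divergence on the Fourier side; \<open>kdir\<close> is
  likewise the gradient. The two are adjoint for the real inner product on complex vectors
  (\<open>kdir_inner\<close>).\<close>

definition kdot :: "int ^ 'n \<Rightarrow> complex ^ 'n \<Rightarrow> complex" where
  "kdot k z = (\<Sum>j\<in>UNIV. of_int (k $ j) * z $ j)"

definition kdir :: "int ^ 'n \<Rightarrow> complex \<Rightarrow> complex ^ 'n" where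
  "kdir k a = (\<chi> j. of_int (k $ j) * a)"

lemma kdir_inner: "kdir k a \<bullet> z = a \<bullet> kdot k z"
  by (simp add: inner_vec_def kdir_def kdot_def inner_complex_def sum_distrib_left
      sum.distrib[symmetric] algebra_simps)

lemma kdir_scaleR: "kdir k (r *\<^sub>R a) = r *\<^sub>R kdir k a"
  by (simp add: kdir_def vec_eq_iff)

lemma norm_kdir: "norm (kdir k a) = fnorm k * norm a"
  by (simp add: norm_vec_def kdir_def norm_mult L2_set_right_distrib[symmetric] mult.commute[of _ "norm a"] L2_set_left_distrib
      del: L2_set_right_distrib)

lemma kdot_kdir: "kdot k (kdir k a) = of_real ((fnorm k)\<^sup>2) * a"
  unfolding kdot_def kdir_def fnorm_sq
  by (simp add: sum_distrib_right power2_eq_square mult.assoc)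

lemma norm_kdot_le: "norm (kdot k z) \<le> fnorm k * norm z"
proof (cases "kdot k z = 0")
  case False
  have "norm (kdot k z) * norm (kdot k z) = kdir k (kdot k z) \<bullet> z"
    by (simp add: kdir_inner power2_norm_eq_inner[symmetric] power2_eq_square[symmetric])
  also have "\<dots> \<le> norm (kdir k (kdot k z)) * norm z" by (rule norm_cauchy_schwarz)
  also have "\<dots> = norm (kdot k z) * (fnorm k * norm z)" by (simp add: norm_kdir)
  finally show ?thesis using False by simp
qed simp

lemma kdot_add: "kdot k (y + z) = kdot k y + kdot k z"
  by (simp add: kdot_def distrib_left sum.distrib)

lemma kdot_diff: "kdot k (y - z) = kdot k y - kdot k z"
  by (simp add: kdot_def right_diff_distrib sum_subtractf)

lemma kdot_scaleR: "kdot k (r *\<^sub>R z) = r *\<^sub>R kdot k z"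
  by (simp add: kdot_def scaleR_sum_right)

text \<open>The matrix with entries \<open>symb j l k\<close> applied to \<open>z\<close>, as
  \<open>kform_symb\<close> confirms.\<close>

definition kform :: "int ^ 'n \<Rightarrow> complex ^ 'n \<Rightarrow> complex ^ 'n" where
  "kform k z = kdir k (kdot k z) - ((fnorm k)\<^sup>2 / real CARD('n)) *\<^sub>R z"

lemma kform_add: "kform k (y + z) = kform k y + kform k z"
  by (simp add: kform_def kdot_add kdir_def vec_eq_iff algebra_simps)

lemma norm_kform_le: "norm (kform k (z :: complex ^ 'n)) \<le> 2 * (fnorm k)\<^sup>2 * norm z"
proof -
  have "norm (kform k z) \<le> fnorm k * norm (kdot k z) + (fnorm k)\<^sup>2 / real CARD('n) * norm z"
    unfolding kform_def using norm_triangle_ineq4[of "kdir k (kdot k z)" "((fnorm k)\<^sup>2 / real CARD('n)) *\<^sub>R z"]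
    by (simp add: norm_kdir)
  also have "\<dots> \<le> fnorm k * (fnorm k * norm z) + (fnorm k)\<^sup>2 / 1 * norm z"
    by (intro add_mono mult_left_mono mult_right_mono divide_left_mono norm_kdot_le) (auto simp: Suc_le_eq)
  finally show ?thesis by (simp add: power2_eq_square mult_ac)
qed

text \<open>Gradient vectors are eigenvectors of the traceless matrix, with eigenvalue (1 - 1/d)
  |k|^2; this is positive as soon as d \<ge> 2.\<close>

lemma kform_kdir:
  "kform k (kdir k a :: complex ^ 'n) \<bullet> kdir k a = (1 - 1 / real CARD('n)) * (fnorm k)\<^sup>2 * (norm (kdir k a :: complex ^ 'n))\<^sup>2"
proof -
  have "kdir k (of_real ((fnorm k)\<^sup>2) * a) = (fnorm k)\<^sup>2 *\<^sub>R (kdir k a :: complex ^ 'n)"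
    by (simp only: scaleR_conv_of_real[symmetric] kdir_scaleR)
  then have "kform k (kdir k a :: complex ^ 'n) = ((1 - 1 / real CARD('n)) * (fnorm k)\<^sup>2) *\<^sub>R kdir k a"
    by (simp add: kform_def kdot_kdir algebra_simps)
  then show ?thesis by (simp add: power2_norm_eq_inner)
qed

lemma kform_symb: "kform k z \<bullet> w = (\<Sum>j\<in>UNIV. \<Sum>l\<in>UNIV. symb j l k * Re (z $ j * cnj (w $ l)))"
proof -
  have "(\<Sum>j\<in>UNIV. \<Sum>l\<in>UNIV. symb j l k * Re (z $ j * cnj (w $ l)))
      = (\<Sum>j\<in>UNIV. \<Sum>l\<in>UNIV. of_int (k $ j) * of_int (k $ l) * Re (z $ j * cnj (w $ l)))
        - (\<Sum>j\<in>UNIV. \<Sum>l\<in>UNIV. if j = l then (fnorm k)\<^sup>2 / real CARD('a) * Re (z $ j * cnj (w $ j)) else 0)"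
    unfolding sum_subtractf[symmetric]
    by (intro sum.cong refl) (auto simp: symb_def algebra_simps)
  also have "(\<Sum>j\<in>UNIV. \<Sum>l\<in>UNIV. if j = l then (fnorm k)\<^sup>2 / real CARD('a) * Re (z $ j * cnj (w $ j)) else 0)
      = ((fnorm k)\<^sup>2 / real CARD('a)) * (z \<bullet> w)"
    by (simp add: inner_vec_def inner_complex_def sum_distrib_left)
  also have "(\<Sum>j\<in>UNIV. \<Sum>l\<in>UNIV. of_int (k $ j) * of_int (k $ l) * Re (z $ j * cnj (w $ l))) = Re (kdot k z * cnj (kdot k w))"
    unfolding kdot_def cnj_sum sum_product Re_sum
    by (intro sum.cong refl) (simp add: algebra_simps)
  also have "\<dots> = kdir k (kdot k z) \<bullet> w"
    by (simp add: kdir_inner inner_complex_def)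
  finally show ?thesis by (simp add: kform_def inner_diff_left)
qed

definition coeff_vec :: "('n \<Rightarrow> real ^ 'n \<Rightarrow> real) \<Rightarrow> int ^ 'n \<Rightarrow> complex ^ 'n" where
  "coeff_vec F k = (\<chi> j. fourier_coeff (F j) k)"

text \<open>Unfolding the coefficients turns the sum into a double integral of
  \<open>kernel I j l (y - x)\<close> against \<open>f x\<close> and \<open>g y\<close>, and the
  uniform bound on the kernel leaves the product of the L^1 norms. \<open>P\<close> is the inner
  integral.\<close>

lemma kernel_form_le:
  fixes f g :: "real ^ 'n \<Rightarrow> real"
  assumes f: "integrable torus f" and g: "integrable torus g"
  shows "norm (\<Sum>k\<in>freq_box (2 ^ I). of_real (symb j l k * dyadic_weight I k) * (fourier_coeff f k * cnj (fourier_coeff g k)))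
    \<le> kernel_const TYPE('n) * (LINT x|torus. \<bar>f x\<bar>) * (LINT x|torus. \<bar>g x\<bar>)"
proof -
  let ?B = "kernel_const TYPE('n)"
  let ?S = "freq_box (2 ^ I) :: (int ^ 'n) set"
  define m where "m k = complex_of_real (symb j l k * dyadic_weight I k)" for k :: "int ^ 'n"
  define P where "P x = (\<Sum>k\<in>?S. m k * cnj (fourier_coeff g k) * chr (- k) x)" for x
  have cg: "cnj (fourier_coeff g k) = (LINT y|torus. chr k y * complex_of_real (g y))" for k
    using fourier_coeff_minus[of g k] by (simp add: fourier_coeff_chr[of g "- k"])
  have P: "norm (P x) \<le> ?B * (LINT y|torus. \<bar>g y\<bar>)" for x
  proof -
    have int: "integrable torus (\<lambda>y. m k * chr (- k) x * (chr k y * complex_of_real (g y)))" for k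
      by (intro integrable_mult_right L1_integrable_chr g)
    have "P x = (\<Sum>k\<in>?S. LINT y|torus. m k * chr (- k) x * (chr k y * complex_of_real (g y)))"
      unfolding P_def cg integral_mult_right_zero by (intro sum.cong refl) (simp add: mult_ac)
    also have "\<dots> = (LINT y|torus. (\<Sum>k\<in>?S. m k * chr (- k) x * (chr k y * complex_of_real (g y))))"
      by (rule Bochner_Integration.integral_sum[symmetric]) (rule int)
    also have "\<dots> = (LINT y|torus. kernel I j l (y - x) * complex_of_real (g y))"
    proof (rule Bochner_Integration.integral_cong[OF refl])
      fix y :: "real ^ 'n"
      have "chr k (y - x) = chr k y * chr (- k) x" for k
      proof -
        have "chr k y = chr k (y - x) * chr k x" using chr_plus[of k "y - x" x] by simp
        moreover have "chr k x * chr (- k) x = 1" using chr_add[of k "- k" x] by simp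
        ultimately show ?thesis by (metis mult.assoc mult.right_neutral)
      qed
      then show "(\<Sum>k\<in>?S. m k * chr (- k) x * (chr k y * complex_of_real (g y))) = kernel I j l (y - x) * complex_of_real (g y)"
        unfolding kernel_def m_def sum_distrib_right by (intro sum.cong refl) (simp only: mult_ac)
    qed
    finally have "norm (P x) \<le> (LINT y|torus. norm (kernel I j l (y - x) * complex_of_real (g y)))"
      using integral_norm_bound by metis
    also have "\<dots> \<le> (LINT y|torus. ?B * \<bar>g y\<bar>)"
    proof (rule integral_mono_AE')
      show "integrable torus (\<lambda>y. ?B * \<bar>g y\<bar>)" using g by simp
      show "AE y in torus. norm (kernel I j l (y - x) * complex_of_real (g y)) \<le> ?B * \<bar>g y\<bar>"
        unfolding norm_mult norm_of_real by (intro AE_I2 mult_right_mono kernel_bounded) simp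
      show "AE y in torus. 0 \<le> ?B * \<bar>g y\<bar>" by (auto simp: kernel_const_def)
    qed
    finally show ?thesis by simp
  qed
  have int: "integrable torus (\<lambda>x. m k * cnj (fourier_coeff g k) * (chr (- k) x * complex_of_real (f x)))" for k
    by (intro integrable_mult_right L1_integrable_chr f)
  have "(\<Sum>k\<in>?S. m k * (fourier_coeff f k * cnj (fourier_coeff g k)))
      = (\<Sum>k\<in>?S. LINT x|torus. m k * cnj (fourier_coeff g k) * (chr (- k) x * complex_of_real (f x)))"
    unfolding integral_mult_right_zero fourier_coeff_chr[of f] by (intro sum.cong refl) (simp add: mult_ac)
  also have "\<dots> = (LINT x|torus. (\<Sum>k\<in>?S. m k * cnj (fourier_coeff g k) * (chr (- k) x * complex_of_real (f x))))"
    by (rule Bochner_Integration.integral_sum[symmetric]) (rule int)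
  also have "\<dots> = (LINT x|torus. P x * complex_of_real (f x))"
    unfolding P_def by (simp add: sum_distrib_right mult.assoc)
  finally have "norm (\<Sum>k\<in>?S. m k * (fourier_coeff f k * cnj (fourier_coeff g k))) \<le> (LINT x|torus. norm (P x * complex_of_real (f x)))"
    using integral_norm_bound by metis
  also have "\<dots> \<le> (LINT x|torus. ?B * (LINT y|torus. \<bar>g y\<bar>) * \<bar>f x\<bar>)"
  proof (rule integral_mono_AE')
    show "integrable torus (\<lambda>x. ?B * (LINT y|torus. \<bar>g y\<bar>) * \<bar>f x\<bar>)" using f by simp
    show "AE x in torus. norm (P x * complex_of_real (f x)) \<le> ?B * (LINT y|torus. \<bar>g y\<bar>) * \<bar>f x\<bar>"
      unfolding norm_mult norm_of_real by (intro AE_I2 mult_right_mono P) simp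
    show "AE x in torus. 0 \<le> ?B * (LINT y|torus. \<bar>g y\<bar>) * \<bar>f x\<bar>"
      by (intro AE_I2 mult_nonneg_nonneg) (auto simp: kernel_const_def)
  qed
  finally show ?thesis by (simp add: m_def mult_ac)
qed

text \<open>A truncated version of |k|^(-d), the dual of the critical Sobolev weight. The factor
  |k|^2 is that of the eigenvalue in \<open>kform_kdir\<close>, so the weighted form on gradients
  produces exactly \<open>rho\<close>.\<close>

definition rho :: "nat \<Rightarrow> int ^ 'n \<Rightarrow> real" where
  "rho I k = (fnorm k)\<^sup>2 * dyadic_weight I k"

text \<open>The frequencies at which division by \<open>rho\<close> makes sense; frequency 0 is
  thereby excluded.\<close>

definition spectrum :: "nat \<Rightarrow> (int ^ 'n) set" where
  "spectrum I = {k \<in> freq_box (2 ^ I). 0 < rho I k}"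

lemma finite_spectrum [simp]: "finite (spectrum I)"
  by (simp add: spectrum_def)

lemma dyadic_weight_nonneg: "0 \<le> dyadic_weight I k"
  unfolding dyadic_weight_def by (intro sum_nonneg divide_nonneg_nonneg cutoff_bounds) auto

lemma rho_nonneg: "0 \<le> rho I k"
  by (simp add: rho_def dyadic_weight_nonneg)

lemma dyadic_weight_uminus: "dyadic_weight I (- k) = dyadic_weight I k"
  by (simp add: dyadic_weight_def cutoff_uminus)

lemma rho_uminus: "rho I (- k) = rho I k"
  by (simp add: rho_def dyadic_weight_uminus freq_vec_uminus)

lemma spectrum_uminus: "- k \<in> spectrum I \<longleftrightarrow> k \<in> spectrum I"
  using uminus_freq_box[of k] uminus_freq_box[of "- k"] by (auto simp: spectrum_def rho_uminus)

lemma spectrum_nonzero: "k \<in> spectrum I \<Longrightarrow> k \<noteq> 0"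
  by (auto simp: spectrum_def rho_def)

lemma spectrum_form_le:
  fixes F :: "'n \<Rightarrow> real ^ 'n \<Rightarrow> real"
  assumes F: "\<And>j. integrable torus (F j)"
  shows "(\<Sum>k\<in>spectrum I. dyadic_weight I k * (kform k (coeff_vec F k) \<bullet> coeff_vec F k))
    \<le> kernel_const TYPE('n) * (\<Sum>j\<in>UNIV. LINT x|torus. \<bar>F j x\<bar>)\<^sup>2"
proof -
  let ?S = "freq_box (2 ^ I) :: (int ^ 'n) set"
  define q where "q k = dyadic_weight I k * (kform k (coeff_vec F k) \<bullet> coeff_vec F k)" for k
  define T where "T j l = (\<Sum>k\<in>?S. of_real (symb j l k * dyadic_weight I k) * (fourier_coeff (F j) k * cnj (fourier_coeff (F l) k)))" for j l
  \<comment> \<open>A frequency of the box outside the spectrum either is 0, where the form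
    vanishes, or has dyadic weight 0.\<close>
  have "(\<Sum>k\<in>spectrum I. q k) = (\<Sum>k\<in>?S. q k)"
  proof (rule sum.mono_neutral_left)
    show "\<forall>k\<in>?S - spectrum I. q k = 0"
    proof
      fix k assume "k \<in> ?S - spectrum I"
      then have "rho I k = 0" using rho_nonneg[of I k] by (auto simp: spectrum_def)
      then have "k = 0 \<or> dyadic_weight I k = 0" by (simp add: rho_def)
      moreover have "kform 0 z = 0" for z :: "complex ^ 'n"
        by (simp add: kform_def kdir_def vec_eq_iff freq_vec_def norm_vec_def L2_set_def)
      ultimately show "q k = 0" by (auto simp: q_def)
    qed
  qed (auto simp: spectrum_def)
  also have "\<dots> = (\<Sum>k\<in>?S. \<Sum>j\<in>UNIV. \<Sum>l\<in>UNIV. Re (of_real (symb j l k * dyadic_weight I k) * (fourier_coeff (F j) k * cnj (fourier_coeff (F l) k))))"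
  proof -
    have "Re (complex_of_real a * z) = a * Re z" for a z by simp
    then show ?thesis
      unfolding q_def kform_symb coeff_vec_def vec_lambda_beta sum_distrib_left
      by (intro sum.cong refl) (simp only:, simp only: mult_ac)
  qed
  also have "\<dots> = (\<Sum>j\<in>UNIV. \<Sum>l\<in>UNIV. Re (T j l))"
    unfolding T_def Re_sum by (subst sum.swap, intro sum.cong refl, rule sum.swap)
  also have "\<dots> \<le> (\<Sum>j\<in>UNIV. \<Sum>l\<in>UNIV. kernel_const TYPE('n) * (LINT x|torus. \<bar>F j x\<bar>) * (LINT x|torus. \<bar>F l x\<bar>))"
    unfolding T_def by (intro sum_mono order_trans[OF complex_Re_le_cmod] kernel_form_le F)
  also have "\<dots> = kernel_const TYPE('n) * (\<Sum>j\<in>UNIV. LINT x|torus. \<bar>F j x\<bar>)\<^sup>2"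
    unfolding power2_eq_square sum_product by (simp only: sum_distrib_left mult.assoc)
  finally show ?thesis by (simp add: q_def)
qed

text \<open>
  If \<open>w = f + g\<close> is a gradient, the quadratic form at \<open>w\<close> is definite, while at \<open>f\<close> it is controlled
  by the \<open>L\<^sup>1\<close> norm.
\<close>
lemma gradient_estimate:
  fixes F :: "'n \<Rightarrow> real ^ 'n \<Rightarrow> real" and g :: "int ^ 'n \<Rightarrow> complex ^ 'n"
  assumes d: "CARD('n) \<ge> 2" and F: "\<And>j. integrable torus (F j)"
    and w: "\<And>k. k \<in> spectrum I \<Longrightarrow> coeff_vec F k + g k = kdir k (a k)"
  shows "(\<Sum>k\<in>spectrum I. rho I k * (norm (coeff_vec F k + g k))\<^sup>2)
    \<le> 4 * kernel_const TYPE('n) * (\<Sum>j\<in>UNIV. LINT x|torus. \<bar>F j x\<bar>)\<^sup>2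
      + 72 * (\<Sum>k\<in>spectrum I. rho I k * (norm (g k))\<^sup>2)"
proof -
  let ?W = "\<Sum>k\<in>spectrum I. rho I k * (norm (coeff_vec F k + g k))\<^sup>2"
  let ?G = "\<Sum>k\<in>spectrum I. rho I k * (norm (g k))\<^sup>2"
  let ?Q = "\<Sum>k\<in>spectrum I. dyadic_weight I k * (kform k (coeff_vec F k) \<bullet> coeff_vec F k)"
  \<comment> \<open>The 1/2 is a lower bound for \<open>1 - 1 / real CARD('n)\<close>, and the cross
    terms cost a quarter of \<open>?W\<close>. Absorbing that quarter and multiplying by 4 yields
    the constants 4 and 72.\<close>
  have "(1/2) * ?W \<le> ?Q + ((1/4) * ?W + 18 * ?G)"
    unfolding sum_distrib_left sum.distrib[symmetric]
  proof (rule sum_mono)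
    fix k :: "int ^ 'n" assume k: "k \<in> spectrum I"
    define y z where "y = coeff_vec F k" and "z = coeff_vec F k + g k"
    have g: "g k = z - y" by (simp add: y_def z_def)
    have yz: "y = z - g k" by (simp add: y_def z_def)
    have half: "1/2 \<le> 1 - 1 / real CARD('n)" using d by (simp add: field_simps)
    have "(1/2) * ((fnorm k)\<^sup>2 * (norm z)\<^sup>2) \<le> (1 - 1 / real CARD('n)) * ((fnorm k)\<^sup>2 * (norm z)\<^sup>2)"
      using half by (intro mult_right_mono) auto
    also have "\<dots> = kform k z \<bullet> z"
      unfolding z_def w[OF k] kform_kdir by simp
    also have "\<dots> = kform k y \<bullet> y + kform k y \<bullet> g k + kform k (g k) \<bullet> z"
      unfolding z_def y_def by (simp add: kform_add inner_add_left inner_add_right)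
    also have "kform k y \<bullet> g k = kform k z \<bullet> g k - kform k (g k) \<bullet> g k"
      unfolding z_def y_def by (simp add: kform_add inner_add_left)
    also have "kform k y \<bullet> y + (kform k z \<bullet> g k - kform k (g k) \<bullet> g k) + kform k (g k) \<bullet> z
        \<le> kform k y \<bullet> y + (fnorm k)\<^sup>2 * ((1/4) * (norm z)\<^sup>2 + 18 * (norm (g k))\<^sup>2)"
    proof -
      have b: "\<bar>kform k p \<bullet> r\<bar> \<le> (2 * (fnorm k)\<^sup>2 * norm p) * norm r" for p r :: "complex ^ 'n"
        by (rule order_trans[OF Cauchy_Schwarz_ineq2 mult_right_mono[OF norm_kform_le]]) simp
      have "kform k z \<bullet> g k - kform k (g k) \<bullet> g k + kform k (g k) \<bullet> z
          \<le> (2 * (fnorm k)\<^sup>2 * norm z) * norm (g k) + (2 * (fnorm k)\<^sup>2 * norm (g k)) * norm (g k) + (2 * (fnorm k)\<^sup>2 * norm (g k)) * norm z"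
        using b[of z "g k"] b[of "g k" "g k"] b[of "g k" z] by linarith
      also have "\<dots> = (fnorm k)\<^sup>2 * (4 * (norm z * norm (g k)) + 2 * (norm (g k))\<^sup>2)"
        by (simp add: algebra_simps power2_eq_square)
      also have "\<dots> \<le> (fnorm k)\<^sup>2 * ((1/4) * (norm z)\<^sup>2 + 18 * (norm (g k))\<^sup>2)"
      proof (rule mult_left_mono)
        \<comment> \<open>Expanding this square trades the mixed term for 1/4 and 16; with the 2
          already present, 16 becomes 18.\<close>
        have "0 \<le> ((1/2) * norm z - 4 * norm (g k))\<^sup>2" by simp
        then show "4 * (norm z * norm (g k)) + 2 * (norm (g k))\<^sup>2 \<le> (1/4) * (norm z)\<^sup>2 + 18 * (norm (g k))\<^sup>2"
          by (simp add: power2_eq_square algebra_simps)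
      qed simp
      finally show ?thesis by simp
    qed
    finally have "dyadic_weight I k * ((1/2) * ((fnorm k)\<^sup>2 * (norm z)\<^sup>2))
        \<le> dyadic_weight I k * (kform k y \<bullet> y + (fnorm k)\<^sup>2 * ((1/4) * (norm z)\<^sup>2 + 18 * (norm (g k))\<^sup>2))"
      by (intro mult_left_mono dyadic_weight_nonneg)
    then show "1/2 * (rho I k * (norm (coeff_vec F k + g k))\<^sup>2)
        \<le> dyadic_weight I k * (kform k (coeff_vec F k) \<bullet> coeff_vec F k)
          + (1/4 * (rho I k * (norm (coeff_vec F k + g k))\<^sup>2) + 18 * (rho I k * (norm (g k))\<^sup>2))"
      by (simp add: rho_def y_def z_def algebra_simps)
  qed
  with spectrum_form_le[of F I, OF F] show ?thesis by simp
qed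

section \<open>Bounds for the truncated weights\<close>

text \<open>Only scales above \<open>fnorm k\<close> contribute. One factor \<open>1 / 2 ^ i\<close>
  is kept for the geometric series, and the remaining powers of \<open>2 ^ i\<close> are bounded
  below by powers of \<open>fnorm k\<close>.\<close>

lemma rho_upper:
  fixes k :: "int ^ 'n"
  assumes "k \<noteq> 0"
  shows "rho I k * fnorm k ^ CARD('n) \<le> 2"
proof -
  have k1: "fnorm k \<ge> 1" using assms by (rule fnorm_ge_1)
  have "dyadic_weight I k \<le> (\<Sum>i\<le>I. (if 2 ^ i > fnorm k then 1 / 2 ^ i else 0) / fnorm k ^ (CARD('n) + 1))"
    unfolding dyadic_weight_def
  proof (rule sum_mono)
    fix i
    show "cutoff (2 ^ i) k / (2 ^ i) ^ (CARD('n) + 2) \<le> (if 2 ^ i > fnorm k then 1 / 2 ^ i else 0) / fnorm k ^ (CARD('n) + 1)"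
    proof (cases "2 ^ i > fnorm k")
      case True
      have "cutoff (2 ^ i) k / (2 ^ i) ^ (CARD('n) + 2) \<le> 1 / (2 ^ i * fnorm k ^ (CARD('n) + 1))"
      proof (rule frac_le)
        have "fnorm k ^ (CARD('n) + 1) \<le> (2 ^ i) ^ (CARD('n) + 1)"
          using True by (intro power_mono) auto
        then show "2 ^ i * fnorm k ^ (CARD('n) + 1) \<le> (2 ^ i) ^ (CARD('n) + 2)" by simp
      qed (use assms cutoff_bounds[of "2 ^ i" k] in \<open>auto intro!: mult_pos_pos\<close>)
      then show ?thesis using True by simp
    next
      case False
      then show ?thesis by (simp add: cutoff_eq_0)
    qed
  qed
  also have "\<dots> = (\<Sum>i\<le>I. if 2 ^ i > fnorm k then 1 / 2 ^ i else 0) / fnorm k ^ (CARD('n) + 1)"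
    by (rule sum_divide_distrib[symmetric])
  also have "\<dots> \<le> (2 / fnorm k) / fnorm k ^ (CARD('n) + 1)"
    using k1 by (intro divide_right_mono sum_dyadic_inverse_le) auto
  finally have "dyadic_weight I k \<le> 2 / (fnorm k * fnorm k ^ (CARD('n) + 1))" by simp
  then have "rho I k * fnorm k ^ CARD('n) \<le> (fnorm k)\<^sup>2 * (2 / (fnorm k * fnorm k ^ (CARD('n) + 1))) * fnorm k ^ CARD('n)"
    unfolding rho_def by (intro mult_right_mono mult_left_mono) auto
  also have "\<dots> = 2" using assms by (simp add: power2_eq_square)
  finally show ?thesis .
qed

text \<open>A single scale suffices: the first one with \<open>2 ^ i \<ge> 2 * fnorm k\<close> has
  cutoff at least 1/2 and, by minimality, \<open>2 ^ i \<le> 4 * fnorm k\<close>. The condition on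
  \<open>I\<close> ensures that this scale occurs in the sum.\<close>

lemma rho_lower:
  fixes k :: "int ^ 'n"
  assumes "k \<noteq> 0" "2 * fnorm k \<le> 2 ^ I"
  shows "1 \<le> rho I k * (2 * 4 ^ (CARD('n) + 2) * fnorm k ^ CARD('n))"
proof -
  have k1: "fnorm k \<ge> 1" using assms(1) by (rule fnorm_ge_1)
  define i where "i = (LEAST i. 2 * fnorm k \<le> 2 ^ i)"
  have i: "2 * fnorm k \<le> 2 ^ i" unfolding i_def using assms(2) by (rule LeastI)
  have iI: "i \<le> I" unfolding i_def using assms(2) by (rule Least_le)
  \<comment> \<open>Minimality is used through the predecessor of \<open>i\<close>, which exists
    because \<open>fnorm k \<ge> 1\<close>.\<close>
  have "i \<noteq> 0"
  proof
    assume "i = 0"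
    then show False using i k1 by simp
  qed
  then obtain i' where i': "i = Suc i'" using not0_implies_Suc by blast
  have "\<not> 2 * fnorm k \<le> 2 ^ i'"
    using not_less_Least[of i' "\<lambda>i. 2 * fnorm k \<le> 2 ^ i"] by (simp add: i_def[symmetric] i')
  then have up: "2 ^ i \<le> 4 * fnorm k" by (simp add: i')
  have "1 / (2 * (4 * fnorm k) ^ (CARD('n) + 2)) = (1/2) / (4 * fnorm k) ^ (CARD('n) + 2)" by simp
  also have "\<dots> \<le> cutoff (2 ^ i) k / (2 ^ i) ^ (CARD('n) + 2)"
  proof (rule frac_le)
    have "fnorm k / 2 ^ i \<le> 1/2" using i by (simp add: field_simps)
    then have "1/2 \<le> 1 - fnorm k / 2 ^ i" by simp
    then show "1/2 \<le> cutoff (2 ^ i) k" by (simp add: cutoff_def le_max_iff_disj)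
    show "(2 ^ i) ^ (CARD('n) + 2) \<le> (4 * fnorm k) ^ (CARD('n) + 2)"
      using up by (intro power_mono) auto
  qed (auto intro: cutoff_bounds)
  also have "\<dots> \<le> dyadic_weight I k"
    unfolding dyadic_weight_def using iI
    by (intro member_le_sum[of i "{..I}" "\<lambda>i. cutoff (2 ^ i) k / (2 ^ i) ^ (CARD('n) + 2)"]
        divide_nonneg_nonneg cutoff_bounds) auto
  finally have s: "1 / (2 * (4 * fnorm k) ^ (CARD('n) + 2)) \<le> dyadic_weight I k" .
  have "1 = (fnorm k)\<^sup>2 * (1 / (2 * (4 * fnorm k) ^ (CARD('n) + 2))) * (2 * 4 ^ (CARD('n) + 2) * fnorm k ^ CARD('n))"
    using assms(1) by (simp add: power_mult_distrib power_add power2_eq_square)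
  also have "\<dots> \<le> (fnorm k)\<^sup>2 * dyadic_weight I k * (2 * 4 ^ (CARD('n) + 2) * fnorm k ^ CARD('n))"
    using s by (intro mult_right_mono mult_left_mono) auto
  finally show ?thesis by (simp add: rho_def)
qed

lemma low_freq_in_spectrum:
  assumes "k \<noteq> 0" "2 * fnorm k \<le> 2 ^ I"
  shows "k \<in> spectrum I"
proof -
  have "fnorm k \<le> real (2 ^ I)" 
  proof -
    have "fnorm k \<le> 2 * fnorm k" by simp
    also note assms(2)
    finally show ?thesis by simp
  qed
  then have "k \<in> freq_box (2 ^ I)" by (rule fnorm_le_freq_box)
  moreover have "rho I k \<noteq> 0" using rho_lower[OF assms] by auto
  ultimately show ?thesis using rho_nonneg[of I k] by (simp add: spectrum_def)
qed

section \<open>Minimisers\<close>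

text \<open>Diagonal extraction along an enumeration of the index type.\<close>

lemma pointwise_convergent_subseq:
  fixes c :: "nat \<Rightarrow> 'a::countable \<Rightarrow> 'b::{real_normed_vector, heine_borel}"
  assumes "\<And>k. \<exists>B. \<forall>n. norm (c n k) \<le> B"
  obtains r l where "strict_mono r" "\<And>k. (\<lambda>n. c (r n) k) \<longlonglongrightarrow> l k"
proof -
  define P where "P n s \<longleftrightarrow> convergent (\<lambda>i. c (s i) (from_nat n))" for n and s :: "nat \<Rightarrow> nat"
  interpret subseqs P
  proof
    fix n and s :: "nat \<Rightarrow> nat" assume "strict_mono s"
    obtain B where "\<forall>i. norm (c i (from_nat n)) \<le> B" using assms by auto
    then have "bounded (range (\<lambda>i. c (s i) (from_nat n)))"
      unfolding bounded_iff by auto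
    then obtain l r where "strict_mono r" "((\<lambda>i. c (s i) (from_nat n)) \<circ> r) \<longlonglongrightarrow> l"
      using bounded_imp_convergent_subsequence by metis
    then show "\<exists>r'. strict_mono r' \<and> P n (s \<circ> r')"
      unfolding P_def by (auto simp: o_def convergent_def)
  qed
  have "P k (diagseq \<circ> (+) (Suc k))" for k
  proof (rule diagseq_holds)
    fix n and s r :: "nat \<Rightarrow> nat" assume "strict_mono r" "P n s"
    then show "P n (s \<circ> r)"
      unfolding P_def using convergent_subseq_convergent[of "\<lambda>i. c (s i) (from_nat n)" r] by (simp add: o_def)
  qed
  then have "convergent (\<lambda>i. c (diagseq (i + Suc (to_nat k))) k)" for k
    proof -
    have "P (to_nat k) (diagseq \<circ> (+) (Suc (to_nat k)))" by fact
    then show ?thesis unfolding P_def o_def from_nat_to_nat by (simp only: add.commute)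
  qed
  then have "convergent (\<lambda>i. c (diagseq i) k)" for k
    using convergent_ignore_initial_segment[of "\<lambda>i. c (diagseq i) k" "Suc (to_nat k)"] by simp
  then have "(\<lambda>i. c (diagseq i) k) \<longlonglongrightarrow> lim (\<lambda>i. c (diagseq i) k)" for k
    by (simp add: convergent_LIMSEQ_iff)
  with subseq_diagseq show thesis by (intro that)
qed

definition vsym :: "(int ^ 'n \<Rightarrow> complex ^ 'n) \<Rightarrow> bool" where
  "vsym c \<longleftrightarrow> (\<forall>k j. c (- k) $ j = cnj (c k $ j))"

definition vtrig :: "nat \<Rightarrow> (int ^ 'n \<Rightarrow> complex ^ 'n) \<Rightarrow> 'n \<Rightarrow> real ^ 'n \<Rightarrow> real" where
  "vtrig I c j = trig (spectrum I) (\<lambda>k. c k $ j)"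

lemma vsym_sym_coeff: "vsym c \<Longrightarrow> sym_coeff (spectrum I) (\<lambda>k. c k $ j)"
  by (auto simp: vsym_def sym_coeff_def spectrum_uminus)

lemma kdot_vsym: "vsym c \<Longrightarrow> kdot (- k) (c (- k)) = - cnj (kdot k (c k))"
  by (simp add: kdot_def vsym_def sum_negf)

lemma vtrig_continuous [continuous_intros]: "continuous_on UNIV (vtrig I c j)"
  unfolding vtrig_def by (rule trig_continuous)

lemma vtrig_add_scale: "vtrig I (\<lambda>k. c k + t *\<^sub>R h k) j x = vtrig I c j x + t * vtrig I h j x"
  unfolding vtrig_def trig_scale trig_add by (simp, simp add: scaleR_conv_of_real)

lemma LINT_mult_vtrig:
  fixes F :: "'n \<Rightarrow> real ^ 'n \<Rightarrow> real"
  assumes "\<And>j. integrable torus (F j)"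
  shows "(\<Sum>j\<in>UNIV. LINT x|torus. F j x * vtrig I h j x) = (\<Sum>k\<in>spectrum I. coeff_vec F k \<bullet> h k)"
proof -
  have "(\<Sum>j\<in>UNIV. LINT x|torus. F j x * vtrig I h j x) = (\<Sum>j\<in>UNIV. \<Sum>k\<in>spectrum I. Re (h k $ j * cnj (fourier_coeff (F j) k)))"
    unfolding vtrig_def by (intro sum.cong refl LINT_mult_trig assms)
  also have "\<dots> = (\<Sum>k\<in>spectrum I. \<Sum>j\<in>UNIV. Re (h k $ j * cnj (fourier_coeff (F j) k)))"
    by (rule sum.swap)
  also have "\<dots> = (\<Sum>k\<in>spectrum I. coeff_vec F k \<bullet> h k)"
    by (simp add: inner_vec_def coeff_vec_def inner_complex_def mult.commute)
  finally show ?thesis .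
qed

text \<open>The quadratic part is weighted by \<open>1 / rho\<close> instead of a power of
  \<open>fnorm k\<close>: its derivative \<open>c k / rho I k\<close>, measured with weight
  \<open>rho\<close> as in \<open>gradient_estimate\<close>, then reproduces the quadratic part
  without loss.\<close>

definition energy :: "nat \<Rightarrow> nat \<Rightarrow> (int ^ 'n \<Rightarrow> complex ^ 'n) \<Rightarrow> real" where
  "energy I p c = (\<Sum>k\<in>spectrum I. (norm (c k))\<^sup>2 / (2 * rho I k))
     + (\<Sum>j\<in>UNIV. LINT x|torus. (vtrig I c j x) ^ p) / real p"

text \<open>An affine space whose directions are the divergence-free fields; the support condition
  makes it finite-dimensional.\<close>

definition admissible :: "nat \<Rightarrow> (int ^ 'n \<Rightarrow> complex ^ 'n) \<Rightarrow> (int ^ 'n \<Rightarrow> complex ^ 'n) set" where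
  "admissible I v = {c. vsym c \<and> (\<forall>k. k \<notin> spectrum I \<longrightarrow> c k = 0) \<and> (\<forall>k\<in>spectrum I. kdot k (c k) = kdot k (v k))}"

lemma spectrum_rho_pos: "k \<in> spectrum I \<Longrightarrow> 0 < rho I k"
  by (simp add: spectrum_def)

lemma norm_le_energy:
  assumes "even p" "k \<in> spectrum I"
  shows "(norm (c k))\<^sup>2 \<le> 2 * rho I k * energy I p c"
proof -
  have "(norm (c k))\<^sup>2 / (2 * rho I k) \<le> (\<Sum>k\<in>spectrum I. (norm (c k))\<^sup>2 / (2 * rho I k))"
    using assms(2) by (intro member_le_sum[of k _ "\<lambda>k. (norm (c k))\<^sup>2 / (2 * rho I k)"]) (auto simp: rho_nonneg)
  also have "\<dots> \<le> energy I p c"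
    unfolding energy_def using assms(1)
    by (simp add: sum_nonneg Bochner_Integration.integral_nonneg zero_le_even_power)
  finally show ?thesis
    using spectrum_rho_pos[OF assms(2)] by (simp add: divide_le_eq mult_ac)
qed

lemma energy_nonneg:
  assumes "even p"
  shows "0 \<le> energy I p c"
  unfolding energy_def using assms rho_nonneg
  by (intro add_nonneg_nonneg sum_nonneg divide_nonneg_nonneg Bochner_Integration.integral_nonneg)
    (auto simp: zero_le_even_power)

lemma tendsto_energy:
  fixes c :: "nat \<Rightarrow> int ^ 'n \<Rightarrow> complex ^ 'n"
  assumes p: "p > 0" and lim: "\<And>k. (\<lambda>n. c n k) \<longlonglongrightarrow> l k" and B: "\<And>n k. k \<in> spectrum I \<Longrightarrow> norm (c n k) \<le> B"
  shows "(\<lambda>n. energy I p (c n)) \<longlonglongrightarrow> energy I p l"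
proof -
  let ?C = "real (card (spectrum I :: (int ^ 'n) set)) * B"
  have le: "\<bar>vtrig I (c n) j x\<bar> \<le> ?C" for n j x
  proof -
    have "\<bar>vtrig I (c n) j x\<bar> \<le> norm (\<Sum>k\<in>spectrum I. c n k $ j * chr k x)"
      unfolding vtrig_def trig_def by (rule abs_Re_le_cmod)
    also have "\<dots> \<le> (\<Sum>k\<in>(spectrum I :: (int ^ 'n) set). B)"
    proof (rule order_trans[OF norm_sum sum_mono])
      fix k :: "int ^ 'n" assume "k \<in> spectrum I"
      then have "norm (c n k $ j) \<le> B"
        using Finite_Cartesian_Product.norm_nth_le[of "c n k" j] B[of k n] by linarith
      then show "norm (c n k $ j * chr k x) \<le> B" by (simp add: norm_mult)
    qed
    finally show ?thesis by simp
  qed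
  have "(\<lambda>n. LINT x|torus. (vtrig I (c n) j x) ^ p) \<longlonglongrightarrow> (LINT x|torus. (vtrig I l j x) ^ p)" for j
  proof (rule integral_dominated_convergence[where w = "\<lambda>_. ?C ^ p"])
    show "(\<lambda>x. vtrig I c j x ^ p) \<in> borel_measurable torus" for c :: "int ^ 'n \<Rightarrow> complex ^ 'n"
      by (intro continuous_measurable_torus continuous_intros)
    then show "(\<lambda>x. vtrig I (c n) j x ^ p) \<in> borel_measurable torus" for n .
    show "AE x in torus. (\<lambda>n. vtrig I (c n) j x ^ p) \<longlonglongrightarrow> vtrig I l j x ^ p"
      unfolding vtrig_def trig_def
      by (intro AE_I2 tendsto_power tendsto_Re tendsto_sum tendsto_mult tendsto_const tendsto_vec_nth lim)
    show "AE x in torus. norm (vtrig I (c n) j x ^ p) \<le> ?C ^ p" for n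
    proof (rule AE_I2)
      fix x :: "real ^ 'n"
      have "norm (vtrig I (c n) j x ^ p) = \<bar>vtrig I (c n) j x\<bar> ^ p" by (simp add: power_abs)
      also have "\<dots> \<le> ?C ^ p" by (intro power_mono le) simp
      finally show "norm (vtrig I (c n) j x ^ p) \<le> ?C ^ p" .
    qed
  qed simp
  then show ?thesis
    unfolding energy_def
    by (intro tendsto_add tendsto_sum tendsto_divide tendsto_power tendsto_norm lim tendsto_const)
      (use p in \<open>auto dest: spectrum_rho_pos\<close>)
qed

text \<open>The direct method: the quadratic part bounds every coefficient along a minimising
  sequence, a subsequence converges, and constraints and energy pass to the limit.\<close>

lemma minimiser_exists:
  fixes v :: "int ^ 'n \<Rightarrow> complex ^ 'n"
  assumes p: "even p" "p > 0" and v: "vsym v"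
  obtains c where "c \<in> admissible I v" "\<And>c'. c' \<in> admissible I v \<Longrightarrow> energy I p c \<le> energy I p c'"
proof -
  let ?A = "admissible I v" and ?E = "energy I p"
  have "(\<lambda>k. if k \<in> spectrum I then v k else 0) \<in> ?A"
    using v by (auto simp: admissible_def vsym_def spectrum_uminus)
  then have ne: "?A \<noteq> {}" by blast
  define e where "e = (INF c\<in>?A. ?E c)"
  have bdd: "bdd_below (?E ` ?A)"
    by (intro bdd_belowI[of _ 0]) (auto intro: energy_nonneg p(1))
  have "\<exists>c\<in>?A. ?E c < e + 1 / real (Suc n)" for n
    using cINF_less_iff[OF ne bdd, of "e + 1 / real (Suc n)"] by (simp add: e_def)
  then obtain c where c: "\<And>n. c n \<in> ?A" "\<And>n. ?E (c n) < e + 1 / real (Suc n)" by metis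
  have Ele: "?E (c n) \<le> e + 1" for n
  proof -
    have "1 / real (Suc n) \<le> 1" by simp
    with c(2)[of n] show ?thesis by linarith
  qed
  define b where "b k = sqrt (2 * rho I k * (e + 1))" for k :: "int ^ 'n"
  have nb: "norm (c n k) \<le> b k" if "k \<in> spectrum I" for n k
  proof -
    have "(norm (c n k))\<^sup>2 \<le> 2 * rho I k * ?E (c n)" by (rule norm_le_energy[OF p(1) that])
    also have "\<dots> \<le> 2 * rho I k * (e + 1)" using rho_nonneg[of I k] by (intro mult_left_mono Ele) auto
    finally show ?thesis unfolding b_def by (rule real_le_rsqrt)
  qed
  have out: "c n k = 0" if "k \<notin> spectrum I" for n k
    using c(1)[of n] that by (auto simp: admissible_def)
  have "\<exists>B. \<forall>n. norm (c n k) \<le> B" for k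
    using nb[of k] out[of k] by (cases "k \<in> spectrum I") auto
  then obtain r l where r: "strict_mono r" and l: "\<And>k. (\<lambda>n. c (r n) k) \<longlonglongrightarrow> l k"
    by (rule pointwise_convergent_subseq[of c]) blast
  have lA: "l \<in> ?A"
    unfolding admissible_def vsym_def
  proof (intro CollectI conjI allI impI ballI)
    fix k j
    have "c (r n) (- k) $ j = cnj (c (r n) k $ j)" for n
      using c(1)[of "r n"] by (auto simp: admissible_def vsym_def)
    moreover have "(\<lambda>n. c (r n) (- k) $ j) \<longlonglongrightarrow> l (- k) $ j"
      by (intro tendsto_vec_nth l)
    moreover have "(\<lambda>n. cnj (c (r n) k $ j)) \<longlonglongrightarrow> cnj (l k $ j)"
      by (intro tendsto_cnj tendsto_vec_nth l)
    ultimately show "l (- k) $ j = cnj (l k $ j)" using LIMSEQ_unique by simp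
  next
    fix k :: "int ^ 'n" assume "k \<notin> spectrum I"
    then show "l k = 0" using l[of k] out[of k] by (simp add: LIMSEQ_const_iff)
  next
    fix k :: "int ^ 'n" assume k: "k \<in> spectrum I"
    have "(\<lambda>n. kdot k (c (r n) k)) \<longlonglongrightarrow> kdot k (l k)"
      unfolding kdot_def by (intro tendsto_sum tendsto_mult tendsto_const tendsto_vec_nth l)
    moreover have "kdot k (c (r n) k) = kdot k (v k)" for n
      using c(1)[of "r n"] k by (auto simp: admissible_def)
    ultimately show "kdot k (l k) = kdot k (v k)" by (simp add: LIMSEQ_const_iff)
  qed
  define B where "B = (\<Sum>k\<in>spectrum I. b k)"
  have "norm (c (r n) k) \<le> B" if "k \<in> spectrum I" for n k
  proof -
    have "0 \<le> b k" for k using energy_nonneg[OF p(1), of I "c 0"] Ele[of 0] rho_nonneg[of I k] by (simp add: b_def)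
    then have "b k \<le> B" unfolding B_def using that by (intro member_le_sum) auto
    with nb[OF that, of "r n"] show ?thesis by linarith
  qed
  with p(2) l have "(\<lambda>n. ?E (c (r n))) \<longlonglongrightarrow> ?E l" by (rule tendsto_energy)
  moreover have "(\<lambda>n. e + 1 / real (Suc n)) \<longlonglongrightarrow> e + 0"
    by (intro tendsto_add tendsto_const LIMSEQ_Suc[OF lim_1_over_n])
  then have "(\<lambda>n. e + 1 / real (Suc (r n))) \<longlonglongrightarrow> e"
    using LIMSEQ_subseq_LIMSEQ[OF _ r, of "\<lambda>n. e + 1 / real (Suc n)" e] by (simp add: o_def)
  ultimately have "?E l \<le> e"
    by (rule LIMSEQ_le) (use c(2) less_imp_le in blast)
  moreover have "e \<le> ?E c'" if "c' \<in> ?A" for c'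
    unfolding e_def by (rule cINF_lower[OF bdd that])
  ultimately show thesis using that[OF lA] order_trans by blast
qed

text \<open>The binomial expansion makes the integral a polynomial in \<open>t\<close>, so nothing
  has to be differentiated under the integral sign.\<close>

lemma deriv_LINT_power:
  fixes u h :: "real ^ 'n \<Rightarrow> real"
  assumes u: "continuous_on UNIV u" and h: "continuous_on UNIV h"
  shows "((\<lambda>t. LINT x|torus. (u x + t * h x) ^ p) has_real_derivative (real p * (LINT x|torus. u x ^ (p - 1) * h x))) (at 0)"
proof (cases p)
  case 0
  then show ?thesis by simp
next
  case (Suc q)
  define A where "A i = real (p choose i) * (LINT x|torus. h x ^ i * u x ^ (p - i))" for i
  have int: "integrable torus (\<lambda>x. h x ^ i * u x ^ (p - i))" for i
    by (intro continuous_integrable_torus continuous_intros u h)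
  have eq: "(LINT x|torus. (u x + t * h x) ^ p) = (\<Sum>i\<le>p. t ^ i * A i)" for t
  proof -
    have "(u x + t * h x) ^ p = (\<Sum>i\<le>p. real (p choose i) * t ^ i * (h x ^ i * u x ^ (p - i)))" for x
      unfolding add.commute[of "u x"] binomial_ring by (intro sum.cong refl) (simp add: power_mult_distrib mult_ac)
    then have "(LINT x|torus. (u x + t * h x) ^ p) = (LINT x|torus. (\<Sum>i\<le>p. real (p choose i) * t ^ i * (h x ^ i * u x ^ (p - i))))"
      by simp
    also have "\<dots> = (\<Sum>i\<le>p. LINT x|torus. real (p choose i) * t ^ i * (h x ^ i * u x ^ (p - i)))"
      by (rule Bochner_Integration.integral_sum) (intro integrable_mult_right int)
    also have "\<dots> = (\<Sum>i\<le>p. t ^ i * A i)" by (simp add: A_def mult_ac)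
    finally show ?thesis .
  qed
  have "((\<lambda>t. \<Sum>i\<le>p. t ^ i * A i) has_real_derivative (\<Sum>i\<le>p. real i * 0 ^ (i - 1) * A i)) (at 0)"
    by (auto intro!: derivative_eq_intros sum.cong)
  also have "(\<Sum>i\<le>p. real i * 0 ^ (i - 1) * A i) = (\<Sum>i\<le>p. if i = 1 then A 1 else 0)"
    by (intro sum.cong refl) (auto simp: power_0_left)
  also have "\<dots> = A 1" using Suc by simp
  also have "A 1 = real p * (LINT x|torus. u x ^ (p - 1) * h x)"
    by (simp add: A_def mult.commute)
  finally show ?thesis unfolding eq .
qed

lemma energy_derivative:
  assumes p: "p > 0"
  shows "((\<lambda>t. energy I p (\<lambda>k. c k + t *\<^sub>R h k)) has_real_derivative
    ((\<Sum>k\<in>spectrum I. (c k \<bullet> h k) / rho I k) + (\<Sum>j\<in>UNIV. LINT x|torus. vtrig I c j x ^ (p - 1) * vtrig I h j x))) (at 0)"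
proof -
  have sq: "(norm (c k + t *\<^sub>R h k))\<^sup>2 = (norm (c k))\<^sup>2 + t * (2 * (c k \<bullet> h k)) + t\<^sup>2 * (norm (h k))\<^sup>2" for t k
    by (simp add: power2_norm_eq_inner inner_add_left inner_add_right inner_commute algebra_simps power2_eq_square[of t])
  have 1: "((\<lambda>t. (norm (c k + t *\<^sub>R h k))\<^sup>2 / (2 * rho I k)) has_real_derivative (c k \<bullet> h k) / rho I k) (at 0)"
    if "k \<in> spectrum I" for k
    unfolding sq using spectrum_rho_pos[OF that]
    by (auto intro!: derivative_eq_intros simp: field_simps)
  have 2: "((\<lambda>t. LINT x|torus. (vtrig I (\<lambda>k. c k + t *\<^sub>R h k) j x) ^ p) has_real_derivative
      (real p * (LINT x|torus. vtrig I c j x ^ (p - 1) * vtrig I h j x))) (at 0)" for j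
    unfolding vtrig_add_scale by (intro deriv_LINT_power vtrig_continuous)
  have "((\<lambda>t. energy I p (\<lambda>k. c k + t *\<^sub>R h k)) has_real_derivative
    ((\<Sum>k\<in>spectrum I. (c k \<bullet> h k) / rho I k) + (\<Sum>j\<in>UNIV. real p * (LINT x|torus. vtrig I c j x ^ (p - 1) * vtrig I h j x)) / real p)) (at 0)"
    unfolding energy_def by (intro DERIV_add DERIV_sum DERIV_cdivide 1 2)
  then show ?thesis using p by (simp add: sum_distrib_left[symmetric])
qed

text \<open>Euler-Lagrange equation: the variation \<open>w\<close> annihilates divergence-free directions, so it is a gradient.\<close>
lemma minimiser_gradient:
  fixes v :: "int ^ 'n \<Rightarrow> complex ^ 'n"
  assumes p: "p > 0" and c: "c \<in> admissible I v"
    and min: "\<And>c'. c' \<in> admissible I v \<Longrightarrow> energy I p c \<le> energy I p c'"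
    and k: "k \<in> spectrum I"
  shows "\<exists>a. coeff_vec (\<lambda>j x. vtrig I c j x ^ (p - 1)) k + (1 / rho I k) *\<^sub>R c k = kdir k a"
proof -
  define F where "F j x = vtrig I c j x ^ (p - 1)" for j x
  have F: "integrable torus (F j)" for j
    unfolding F_def by (intro continuous_integrable_torus continuous_intros)
  define w where "w k = coeff_vec F k + (1 / rho I k) *\<^sub>R c k" for k
  \<comment> \<open>The divergence-free part of \<open>w\<close>, that is, its projection orthogonal
    to \<open>k\<close>. Stationarity in this very direction gives \<Sum> |h|^2 = 0, because
    \<open>w - h\<close> is a gradient and pairs to 0 with \<open>h\<close>.\<close>
  define h where "h k = (if k \<in> spectrum I then w k - kdir k (kdot k (w k) / of_real ((fnorm k)\<^sup>2)) else 0)" for k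
  have csym: "vsym c" using c by (simp add: admissible_def)
  have wsym: "vsym w"
    using csym by (simp add: vsym_def w_def coeff_vec_def fourier_coeff_minus rho_uminus)
  have hsym: "vsym h"
    unfolding vsym_def
  proof (intro allI)
    fix k :: "int ^ 'n" and j
    have "kdot (- k) (w (- k)) = - cnj (kdot k (w k))" by (rule kdot_vsym[OF wsym])
    then show "h (- k) $ j = cnj (h k $ j)"
      using wsym by (simp add: h_def spectrum_uminus freq_vec_uminus vsym_def kdir_def)
  qed
  have hdot: "kdot k (h k) = 0" if "k \<in> spectrum I" for k
    using that spectrum_nonzero[OF that] by (simp add: h_def kdot_diff kdot_kdir)
  have adm: "(\<lambda>k. c k + t *\<^sub>R h k) \<in> admissible I v" for t
    using c hsym csym hdot by (auto simp: admissible_def vsym_def kdot_add kdot_scaleR h_def)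
  have "(\<Sum>k\<in>spectrum I. (c k \<bullet> h k) / rho I k) + (\<Sum>j\<in>UNIV. LINT x|torus. vtrig I c j x ^ (p - 1) * vtrig I h j x) = 0"
  proof (rule DERIV_local_min[OF energy_derivative[OF p] zero_less_one])
    show "\<forall>t. \<bar>0 - t\<bar> < 1 \<longrightarrow> energy I p (\<lambda>k. c k + 0 *\<^sub>R h k) \<le> energy I p (\<lambda>k. c k + t *\<^sub>R h k)"
      using min[OF adm] by simp
  qed
  then have "(\<Sum>k\<in>spectrum I. (c k \<bullet> h k) / rho I k) + (\<Sum>k\<in>spectrum I. coeff_vec F k \<bullet> h k) = 0"
    using LINT_mult_vtrig[of F I h, OF F] by (simp add: F_def)
  then have "(\<Sum>k\<in>spectrum I. w k \<bullet> h k) = 0"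
    unfolding sum.distrib[symmetric] by (simp add: w_def inner_add_left add.commute)
  moreover have "w k \<bullet> h k = (norm (h k))\<^sup>2" if "k \<in> spectrum I" for k
  proof -
    have "w k = h k + kdir k (kdot k (w k) / of_real ((fnorm k)\<^sup>2))" using that by (simp add: h_def)
    then have "w k \<bullet> h k = (h k + kdir k (kdot k (w k) / of_real ((fnorm k)\<^sup>2))) \<bullet> h k" by simp
    also have "\<dots> = (norm (h k))\<^sup>2"
      by (simp only: inner_add_left kdir_inner hdot[OF that] inner_zero_right power2_norm_eq_inner add_0_right)
    finally show ?thesis .
  qed
  ultimately have "(\<Sum>k\<in>spectrum I. (norm (h k))\<^sup>2) = 0" by simp
  then have "h k = 0" using k by (simp add: sum_nonneg_eq_0_iff)
  then have "w k = kdir k (kdot k (w k) / of_real ((fnorm k)\<^sup>2))" using k by (simp add: h_def)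
  then show ?thesis unfolding w_def F_def by blast
qed

text \<open>The bracket is the factor by which \<open>gradient_estimate\<close> controls the dual
  norm of the first variation: 2 sqrt C in front of the L^1 norm, and 9 because 72 \<le> 81. The
  further 2 leaves half of the left-hand side for absorption.\<close>

definition smallness :: "'n::finite itself \<Rightarrow> real" where
  "smallness T = 1 / (2 * (2 * sqrt (kernel_const T) + 9))"

lemma kernel_const_nonneg: "0 \<le> kernel_const T"
  by (simp add: kernel_const_def)

text \<open>Pairing the first variation \<open>w\<close> with the minimiser gives the whole energy,
  up to constants. As \<open>w\<close> is a gradient, the pairing equals that with the small data
  \<open>v\<close>; Cauchy-Schwarz and \<open>gradient_estimate\<close> bound it by half of the L^1
  norm plus half of the quadratic norm. Both are absorbed, with constants free of \<open>p\<close>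
  and \<open>I\<close>.\<close>

lemma approximate_solution:
  fixes v :: "int ^ 'n \<Rightarrow> complex ^ 'n"
  assumes d: "CARD('n) \<ge> 2" and p: "even p" "p > 0" and v: "vsym v"
    and small: "sqrt (\<Sum>k\<in>spectrum I. (norm (v k))\<^sup>2 / rho I k) \<le> smallness TYPE('n)"
  obtains c where "c \<in> admissible I v"
    "(\<Sum>k\<in>spectrum I. (norm (c k))\<^sup>2 / rho I k) \<le> real CARD('n) + 1"
    "\<And>j. (LINT x|torus. (vtrig I c j x) ^ p) \<le> real CARD('n) + 1"
proof -
  obtain c where c: "c \<in> admissible I v" and min: "\<And>c'. c' \<in> admissible I v \<Longrightarrow> energy I p c \<le> energy I p c'"
    using minimiser_exists[OF p v] by blast
  let ?S = "spectrum I :: (int ^ 'n) set" and ?d = "real CARD('n)"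
  define F where "F j x = vtrig I c j x ^ (p - 1)" for j x
  have F: "integrable torus (F j)" for j
    unfolding F_def by (intro continuous_integrable_torus continuous_intros)
  define w where "w k = coeff_vec F k + (1 / rho I k) *\<^sub>R c k" for k
  have "\<exists>a. w k = kdir k a" if "k \<in> ?S" for k
    using minimiser_gradient[OF p(2) c min that] unfolding w_def F_def .
  then obtain a where a: "\<And>k. k \<in> ?S \<Longrightarrow> w k = kdir k (a k)" by metis
  define A2 where "A2 = (\<Sum>k\<in>?S. (norm (c k))\<^sup>2 / rho I k)"
  define V where "V = sqrt (\<Sum>k\<in>?S. (norm (v k))\<^sup>2 / rho I k)"
  define b where "b j = (LINT x|torus. (vtrig I c j x) ^ p)" for j
  define P where "P = (\<Sum>j\<in>UNIV. LINT x|torus. \<bar>F j x\<bar>)"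
  have A2: "A2 \<ge> 0" unfolding A2_def by (intro sum_nonneg divide_nonneg_nonneg rho_nonneg) auto
  have V0: "V \<ge> 0" unfolding V_def by (intro real_sqrt_ge_zero sum_nonneg divide_nonneg_nonneg rho_nonneg) auto
  have P0: "P \<ge> 0" unfolding P_def by (intro sum_nonneg Bochner_Integration.integral_nonneg) auto
  have b0: "b j \<ge> 0" for j
    unfolding b_def using p by (intro Bochner_Integration.integral_nonneg) (simp add: zero_le_even_power)
  have pint: "integrable torus (\<lambda>x. (vtrig I c j x) ^ p)" for j
    by (intro continuous_integrable_torus continuous_intros)
  have W: "(\<Sum>k\<in>?S. rho I k * (norm (w k))\<^sup>2) \<le> 4 * kernel_const TYPE('n) * P\<^sup>2 + 72 * A2"
  proof -
    have "(\<Sum>k\<in>?S. rho I k * (norm (w k))\<^sup>2) \<le> 4 * kernel_const TYPE('n) * P\<^sup>2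
        + 72 * (\<Sum>k\<in>?S. rho I k * (norm ((1 / rho I k) *\<^sub>R c k))\<^sup>2)"
      unfolding w_def P_def by (rule gradient_estimate[OF d F a[unfolded w_def]])
    also have "(\<Sum>k\<in>?S. rho I k * (norm ((1 / rho I k) *\<^sub>R c k))\<^sup>2) = A2"
      unfolding A2_def
    proof (intro sum.cong refl)
      fix k :: "int ^ 'n" assume "k \<in> ?S"
      then have "0 < rho I k" by (rule spectrum_rho_pos)
      then show "rho I k * (norm ((1 / rho I k) *\<^sub>R c k))\<^sup>2 = (norm (c k))\<^sup>2 / rho I k"
        by (simp add: power_divide power2_eq_square)
    qed
    finally show ?thesis .
  qed
  have Wsqrt: "sqrt (\<Sum>k\<in>?S. rho I k * (norm (w k))\<^sup>2) \<le> 2 * sqrt (kernel_const TYPE('n)) * P + 9 * sqrt A2"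
  proof (rule real_le_lsqrt)
    have "(2 * sqrt (kernel_const TYPE('n)) * P + 9 * sqrt A2)\<^sup>2
        = 4 * kernel_const TYPE('n) * P\<^sup>2 + 81 * A2 + 36 * (sqrt (kernel_const TYPE('n)) * P * sqrt A2)"
      using A2 kernel_const_nonneg[of "TYPE('n)"] by (simp add: power2_sum power_mult_distrib)
    moreover have "0 \<le> sqrt (kernel_const TYPE('n)) * P * sqrt A2"
      using A2 P0 kernel_const_nonneg[of "TYPE('n)"] by simp
    ultimately show "(\<Sum>k\<in>?S. rho I k * (norm (w k))\<^sup>2) \<le> (2 * sqrt (kernel_const TYPE('n)) * P + 9 * sqrt A2)\<^sup>2"
      using W A2 by linarith
  qed (use A2 P0 kernel_const_nonneg[of "TYPE('n)"] in auto)
  have "(\<Sum>k\<in>?S. w k \<bullet> c k) = (\<Sum>k\<in>?S. coeff_vec F k \<bullet> c k) + A2"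
    unfolding w_def A2_def by (simp add: inner_add_left sum.distrib power2_norm_eq_inner)
  also have "(\<Sum>k\<in>?S. coeff_vec F k \<bullet> c k) = (\<Sum>j\<in>UNIV. b j)"
    unfolding LINT_mult_vtrig[of F I c, OF F, symmetric] b_def F_def using p(2)
    by (intro sum.cong refl Bochner_Integration.integral_cong) (simp_all flip: power_Suc2)
  finally have e1: "(\<Sum>k\<in>?S. w k \<bullet> c k) = (\<Sum>j\<in>UNIV. b j) + A2" .
  \<comment> \<open>A gradient sees only the divergence, which \<open>c\<close> and \<open>v\<close>
    share.\<close>
  have "(\<Sum>k\<in>?S. w k \<bullet> c k) = (\<Sum>k\<in>?S. w k \<bullet> v k)"
  proof (intro sum.cong refl)
    fix k assume k: "k \<in> ?S"
    then have "kdot k (c k) = kdot k (v k)" using c by (auto simp: admissible_def)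
    then show "w k \<bullet> c k = w k \<bullet> v k" unfolding a[OF k] kdir_inner by simp
  qed
  also have "\<dots> \<le> (\<Sum>k\<in>?S. \<bar>sqrt (rho I k) * norm (w k)\<bar> * \<bar>norm (v k) / sqrt (rho I k)\<bar>)"
  proof (intro sum_mono)
    fix k assume "k \<in> ?S"
    then have "0 < rho I k" by (rule spectrum_rho_pos)
    then show "w k \<bullet> v k \<le> \<bar>sqrt (rho I k) * norm (w k)\<bar> * \<bar>norm (v k) / sqrt (rho I k)\<bar>"
      using norm_cauchy_schwarz[of "w k" "v k"] by simp
  qed
  also have "\<dots> \<le> L2_set (\<lambda>k. sqrt (rho I k) * norm (w k)) ?S * L2_set (\<lambda>k. norm (v k) / sqrt (rho I k)) ?S"
    by (rule L2_set_mult_ineq)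
  also have "L2_set (\<lambda>k. sqrt (rho I k) * norm (w k)) ?S = sqrt (\<Sum>k\<in>?S. rho I k * (norm (w k))\<^sup>2)"
    by (simp add: L2_set_def power_mult_distrib rho_nonneg)
  also have "L2_set (\<lambda>k. norm (v k) / sqrt (rho I k)) ?S = V"
    by (simp add: L2_set_def V_def power_divide rho_nonneg)
  also have "sqrt (\<Sum>k\<in>?S. rho I k * (norm (w k))\<^sup>2) * V \<le> (2 * sqrt (kernel_const TYPE('n)) * P + 9 * sqrt A2) * smallness TYPE('n)"
    using small V0 A2 P0 kernel_const_nonneg[of "TYPE('n)"] unfolding V_def[symmetric]
    by (intro mult_mono Wsqrt) auto
  also have "\<dots> \<le> ((2 * sqrt (kernel_const TYPE('n)) + 9) * (P + sqrt A2)) * smallness TYPE('n)"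
  proof (rule mult_right_mono)
    have "0 \<le> 9 * P" "0 \<le> 2 * sqrt (kernel_const TYPE('n)) * sqrt A2"
      using A2 P0 kernel_const_nonneg[of "TYPE('n)"] by auto
    then show "2 * sqrt (kernel_const TYPE('n)) * P + 9 * sqrt A2 \<le> (2 * sqrt (kernel_const TYPE('n)) + 9) * (P + sqrt A2)"
      by (simp add: algebra_simps)
  qed (simp add: smallness_def kernel_const_nonneg)
  also have "\<dots> = (P + sqrt A2) / 2"
  proof -
    have "2 * sqrt (kernel_const TYPE('n)) + 9 \<noteq> 0"
      using real_sqrt_ge_zero[OF kernel_const_nonneg[of "TYPE('n)"]] by linarith
    then have "(2 * sqrt (kernel_const TYPE('n)) + 9) * smallness TYPE('n) = 1 / 2"
      by (simp add: smallness_def field_simps)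
    then show ?thesis by (metis (no_types, opaque_lifting) mult.assoc mult.commute times_divide_eq_left mult_1)
  qed
  finally have main: "(\<Sum>j\<in>UNIV. b j) + A2 \<le> (P + sqrt A2) / 2" unfolding e1 .
  \<comment> \<open>|y|^(p-1) is at most 1 for |y| \<le> 1 and at most |y|^p otherwise, so the bound
    does not depend on \<open>p\<close>.\<close>
  have "P \<le> (\<Sum>j\<in>UNIV. 1 + b j)"
    unfolding P_def
  proof (rule sum_mono)
    fix j
    have "(LINT x|torus. \<bar>F j x\<bar>) \<le> (LINT x|torus. 1 + (vtrig I c j x) ^ p)"
    proof (rule integral_mono)
      show "integrable torus (\<lambda>x. \<bar>F j x\<bar>)" using F by simp
      show "integrable torus (\<lambda>x. 1 + (vtrig I c j x) ^ p)" using pint by simp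
      fix x :: "real ^ 'n"
      let ?y = "vtrig I c j x"
      have "\<bar>?y\<bar> ^ (p - 1) \<le> 1 + \<bar>?y\<bar> ^ p"
      proof (cases "\<bar>?y\<bar> \<le> 1")
        case True
        then have "\<bar>?y\<bar> ^ (p - 1) \<le> 1" by (intro power_le_one) auto
        then show ?thesis by (simp add: add_increasing2)
      next
        case False
        then have "\<bar>?y\<bar> ^ (p - 1) \<le> \<bar>?y\<bar> ^ p" by (intro power_increasing) auto
        then show ?thesis by simp
      qed
      then show "\<bar>F j x\<bar> \<le> 1 + ?y ^ p" using p(1) by (simp add: F_def power_abs power_even_abs)
    qed
    also have "\<dots> = 1 + b j" using pint torus.prob_space by (simp add: b_def)
    finally show "(LINT x|torus. \<bar>F j x\<bar>) \<le> 1 + b j" .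
  qed
  also have "\<dots> = ?d + (\<Sum>j\<in>UNIV. b j)" by (simp add: sum.distrib)
  finally have Pb: "P \<le> ?d + (\<Sum>j\<in>UNIV. b j)" .
  have sA: "sqrt A2 \<le> A2 + 1/4"
  proof -
    have "0 \<le> (sqrt A2 - 1/2)\<^sup>2" by simp
    then show ?thesis using A2 by (simp add: power2_eq_square algebra_simps)
  qed
  have bs: "0 \<le> (\<Sum>j\<in>UNIV. b j)" using b0 by (intro sum_nonneg) auto
  \<comment> \<open>Substitution gives 2 (x + y) \<le> r + x + y + 1/4, hence x + y \<le> r +
    1/4.\<close>
  have aux: "x \<le> r + 1 \<and> y \<le> r + 1" if "y + x \<le> (q + s) / 2" "q \<le> r + y" "s \<le> x + 1/4" "0 \<le> x" "0 \<le> y"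
    for x y q r s :: real
    using that by simp
  have "A2 \<le> ?d + 1" using aux[OF main Pb sA A2 bs] by simp
  moreover have "b j \<le> ?d + 1" for j
  proof -
    have "b j \<le> (\<Sum>j\<in>UNIV. b j)" using b0 by (intro member_le_sum) auto
    then show ?thesis using aux[OF main Pb sA A2 bs] by simp
  qed
  ultimately show thesis using c by (intro that) (auto simp: A2_def b_def)
qed

section \<open>The spaces \<open>L\<^sup>\<infinity>\<close> and \<open>H\<^sup>s\<close>\<close>

lemma Linf_iff: "f \<in> Linf \<longleftrightarrow> f \<in> torus_fun \<and> (\<exists>C. AE x in torus. \<bar>f x\<bar> \<le> C)"
proof
  assume f: "f \<in> Linf"
  then have fin: "esssup torus (\<lambda>x. ereal \<bar>f x\<bar>) < \<infinity>" by (simp add: Linf_def)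
  then obtain C where "esssup torus (\<lambda>x. ereal \<bar>f x\<bar>) \<le> ereal C"
    by (cases "esssup torus (\<lambda>x. ereal \<bar>f x\<bar>)") (auto intro: exI[of _ 0])
  then have "AE x in torus. \<bar>f x\<bar> \<le> C"
    using esssup_AE[of "\<lambda>x. ereal \<bar>f x\<bar>" torus] by (auto elim!: eventually_mono dest: order_trans)
  with f show "f \<in> torus_fun \<and> (\<exists>C. AE x in torus. \<bar>f x\<bar> \<le> C)" by (auto simp: Linf_def)
next
  assume f: "f \<in> torus_fun \<and> (\<exists>C. AE x in torus. \<bar>f x\<bar> \<le> C)"
  then obtain C where C: "AE x in torus. \<bar>f x\<bar> \<le> C" by auto
  note [measurable] = torus_fun_measurable[OF conjunct1[OF f]]
  have "esssup torus (\<lambda>x. ereal \<bar>f x\<bar>) \<le> ereal C"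
    using C by (intro esssup_I) (auto elim: eventually_mono)
  then show "f \<in> Linf" using f by (auto simp: Linf_def)
qed

lemma Linf_torus_fun: "f \<in> Linf \<Longrightarrow> f \<in> torus_fun"
  by (simp add: Linf_def)

text \<open>The measure is not zero, so the essential supremum of the constant 0 is 0 and not minus
  infinity.\<close>

lemma esssup_abs_nonneg:
  fixes f :: "real ^ 'n \<Rightarrow> real"
  assumes "f \<in> torus_fun"
  shows "0 \<le> esssup torus (\<lambda>x. ereal \<bar>f x\<bar>)"
proof -
  have "esssup torus (\<lambda>x :: real ^ 'n. 0 :: ereal) \<le> esssup torus (\<lambda>x. ereal \<bar>f x\<bar>)"
    by (rule esssup_mono) auto
  moreover have "esssup torus (\<lambda>x :: real ^ 'n. 0 :: ereal) = 0"
    by (rule esssup_const) (simp add: emeasure_torus)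
  ultimately show ?thesis by simp
qed

lemma Linf_esssup:
  assumes "f \<in> Linf"
  shows "esssup torus (\<lambda>x. ereal \<bar>f x\<bar>) = ereal (Linf_norm f)"
  using assms esssup_abs_nonneg[OF Linf_torus_fun[OF assms]] unfolding Linf_norm_def Linf_def
  by (cases "esssup torus (\<lambda>x. ereal \<bar>f x\<bar>)") auto

lemma Linf_norm_AE:
  assumes "f \<in> Linf"
  shows "AE x in torus. \<bar>f x\<bar> \<le> Linf_norm f"
  using esssup_AE[of "\<lambda>x. ereal \<bar>f x\<bar>" torus] unfolding Linf_esssup[OF assms] by simp

lemma Linf_norm_le:
  assumes "f \<in> torus_fun" "AE x in torus. \<bar>f x\<bar> \<le> C"
  shows "Linf_norm f \<le> C"
proof -
  have f: "f \<in> Linf" using assms by (auto simp: Linf_iff)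
  note [measurable] = torus_fun_measurable[OF assms(1)]
  have "esssup torus (\<lambda>x. ereal \<bar>f x\<bar>) \<le> ereal C"
    using assms(2) by (intro esssup_I) (auto elim: eventually_mono)
  then show ?thesis by (simp add: Linf_esssup[OF f])
qed

lemma Linf_norm_nonneg: "f \<in> Linf \<Longrightarrow> 0 \<le> Linf_norm f"
  using esssup_abs_nonneg[OF Linf_torus_fun] Linf_esssup by fastforce

lemma fun_seminorm_Linf: "fun_seminorm (Linf :: (real ^ 'n \<Rightarrow> real) set) Linf_norm"
proof
  show "(\<lambda>x. 0) \<in> (Linf :: (real ^ 'n \<Rightarrow> real) set)"
    by (auto simp: Linf_iff torus_fun_zero)
next
  fix f g :: "real ^ 'n \<Rightarrow> real" assume fg: "f \<in> Linf" "g \<in> Linf"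
  have ae: "AE x in torus. \<bar>f x + g x\<bar> \<le> Linf_norm f + Linf_norm g"
    using Linf_norm_AE[OF fg(1)] Linf_norm_AE[OF fg(2)] by eventually_elim simp
  have tf: "(\<lambda>x. f x + g x) \<in> torus_fun" using fg by (intro torus_fun_add Linf_torus_fun)
  show "(\<lambda>x. f x + g x) \<in> Linf" using ae tf by (auto simp: Linf_iff)
  show "Linf_norm (\<lambda>x. f x + g x) \<le> Linf_norm f + Linf_norm g" by (rule Linf_norm_le[OF tf ae])
next
  fix f :: "real ^ 'n \<Rightarrow> real" assume f: "f \<in> Linf"
  show "0 \<le> Linf_norm f" by (rule Linf_norm_nonneg[OF f])
  have le: "(\<lambda>x. c * h x) \<in> Linf \<and> Linf_norm (\<lambda>x. c * h x) \<le> \<bar>c\<bar> * Linf_norm h"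
    if h: "h \<in> Linf" for c and h :: "real ^ 'n \<Rightarrow> real"
  proof -
    have ae: "AE x in torus. \<bar>c * h x\<bar> \<le> \<bar>c\<bar> * Linf_norm h"
      using Linf_norm_AE[OF h] by eventually_elim (simp add: abs_mult mult_left_mono)
    have tf: "(\<lambda>x. c * h x) \<in> torus_fun" using h by (intro torus_fun_scale Linf_torus_fun)
    show ?thesis using ae tf Linf_norm_le[OF tf ae] by (auto simp: Linf_iff)
  qed
  fix c :: real
  show mem: "(\<lambda>x. c * f x) \<in> Linf" using le[OF f] by blast
  show "Linf_norm (\<lambda>x. c * f x) = \<bar>c\<bar> * Linf_norm f"
  proof (cases "c = 0")
    case True
    then show ?thesis using le[OF f, of c] Linf_norm_nonneg[OF mem] by simp
  next
    case False
    have "Linf_norm f \<le> \<bar>1/c\<bar> * Linf_norm (\<lambda>x. c * f x)"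
      using le[OF mem, of "1/c"] False by simp
    then have "\<bar>c\<bar> * Linf_norm f \<le> Linf_norm (\<lambda>x. c * f x)"
      using False by (simp add: field_simps)
    with le[OF f, of c] show ?thesis by simp
  qed
qed

interpretation Linf: fun_seminorm "Linf :: (real ^ 'n \<Rightarrow> real) set" Linf_norm
  by (rule fun_seminorm_Linf)

lemma Linf_complete: "seminorm_complete (Linf :: (real ^ 'n \<Rightarrow> real) set) Linf_norm"
  unfolding seminorm_complete_def
proof (intro allI impI, elim conjE)
  fix F :: "nat \<Rightarrow> real ^ 'n \<Rightarrow> real"
  assume F: "\<forall>n. F n \<in> Linf"
    and cauchy: "\<forall>e>0. \<exists>M. \<forall>m\<ge>M. \<forall>n\<ge>M. Linf_norm (\<lambda>x. F m x - F n x) < e"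
  have Fn: "F n \<in> Linf" for n using F by simp
  define f where "f x = lim (\<lambda>n. F n x)" for x
  \<comment> \<open>A single null set serves all pairs of indices; outside it the sequence is
    uniformly Cauchy.\<close>
  have "AE x in torus. \<forall>m n. \<bar>F m x - F n x\<bar> \<le> Linf_norm (\<lambda>x. F m x - F n x)"
    using Linf_norm_AE[OF Linf.diff_mem[OF Fn Fn]] by (simp add: AE_all_countable)
  then have ae: "AE x in torus. (\<lambda>n. F n x) \<longlonglongrightarrow> f x \<and> (\<forall>m n. \<bar>F m x - F n x\<bar> \<le> Linf_norm (\<lambda>x. F m x - F n x))"
  proof eventually_elim
    case (elim x)
    have "Cauchy (\<lambda>n. F n x)"
    proof (rule metric_CauchyI)
      fix e :: real assume "e > 0"
      then obtain M where M: "\<forall>m\<ge>M. \<forall>n\<ge>M. Linf_norm (\<lambda>x. F m x - F n x) < e" using cauchy by blast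
      have "dist (F m x) (F n x) < e" if "m \<ge> M" "n \<ge> M" for m n
        using M that elim unfolding dist_real_def by (meson le_less_trans)
      then show "\<exists>M. \<forall>m\<ge>M. \<forall>n\<ge>M. dist (F m x) (F n x) < e" by auto
    qed
    then show ?case using elim by (simp add: f_def Cauchy_convergent_iff convergent_LIMSEQ_iff)
  qed
  have f: "f \<in> torus_fun"
    unfolding torus_fun_def
  proof (intro CollectI conjI)
    have "F n (x + axis i 1) = F n x" for n x i
      using Fn[of n] by (auto simp: Linf_def torus_fun_def periodic_def)
    then show "periodic f" by (simp add: periodic_def f_def)
    have "F n \<in> borel_measurable lebesgue" for n
      using Fn[of n] by (auto simp: Linf_def torus_fun_def)
    then show "f \<in> borel_measurable lebesgue"
      unfolding f_def by (intro borel_measurable_lim_metric)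
  qed
  have bound: "AE x in torus. \<bar>F m x - f x\<bar> \<le> e"
    if M: "\<And>n. n \<ge> M \<Longrightarrow> Linf_norm (\<lambda>x. F m x - F n x) < e" for m M e
    using ae
  proof eventually_elim
    case (elim x)
    have lim: "(\<lambda>n. \<bar>F m x - F n x\<bar>) \<longlonglongrightarrow> \<bar>F m x - f x\<bar>"
      using elim by (intro tendsto_rabs tendsto_diff tendsto_const) auto
    have "\<bar>F m x - F n x\<bar> \<le> e" if "n \<ge> M" for n
      using elim M[OF that] by (meson le_less_trans less_imp_le)
    then show ?case by (intro LIMSEQ_le_const2[OF lim]) auto
  qed
  obtain M where M: "\<forall>m\<ge>M. \<forall>n\<ge>M. Linf_norm (\<lambda>x. F m x - F n x) < 1" using cauchy by (meson zero_less_one)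
  have "AE x in torus. \<bar>F M x - f x\<bar> \<le> 1" using M by (intro bound[of M]) auto
  then have "(\<lambda>x. F M x - f x) \<in> Linf"
    using torus_fun_diff[OF Linf_torus_fun[OF Fn] f] by (auto simp: Linf_iff)
  from Linf.diff_mem[OF Fn[of M] this] have "f \<in> Linf" by simp
  moreover have "(\<lambda>n. Linf_norm (\<lambda>x. F n x - f x)) \<longlonglongrightarrow> 0"
  proof (rule LIMSEQ_I)
    fix e :: real assume "e > 0"
    then obtain M where M: "\<forall>m\<ge>M. \<forall>n\<ge>M. Linf_norm (\<lambda>x. F m x - F n x) < e/2"
      using cauchy by (meson half_gt_zero)
    have "norm (Linf_norm (\<lambda>x. F m x - f x) - 0) < e" if "m \<ge> M" for m
    proof -
      have "AE x in torus. \<bar>F m x - f x\<bar> \<le> e/2" using M that by (intro bound[of M]) auto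
      then have "Linf_norm (\<lambda>x. F m x - f x) \<le> e/2"
        by (intro Linf_norm_le torus_fun_diff Linf_torus_fun Fn f)
      then show ?thesis
        using \<open>e > 0\<close> Linf_norm_nonneg[OF Linf.diff_mem[OF Fn[of m] \<open>f \<in> Linf\<close>]] by simp
    qed
    then show "\<exists>no. \<forall>n\<ge>no. norm (Linf_norm (\<lambda>x. F n x - f x) - 0) < e" by auto
  qed
  ultimately show "\<exists>f\<in>Linf. (\<lambda>n. Linf_norm (\<lambda>x. F n x - f x)) \<longlonglongrightarrow> 0" by blast
qed

lemma Linf_L2: "f \<in> Linf \<Longrightarrow> f \<in> L2"
proof -
  assume f: "f \<in> Linf"
  note [measurable] = torus_fun_measurable[OF Linf_torus_fun[OF f]]
  have "AE x in torus. norm ((f x)\<^sup>2) \<le> (Linf_norm f)\<^sup>2"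
    using Linf_norm_AE[OF f]
  proof eventually_elim
    case (elim x)
    then show ?case using power_mono[OF elim, of 2] by simp
  qed
  then have "integrable torus (\<lambda>x. (f x)\<^sup>2)"
    by (rule torus.integrable_const_bound) measurable
  then show "f \<in> L2" using f by (simp add: L2_def Linf_torus_fun)
qed

lemma LINT_abs_le_Linf:
  assumes "f \<in> Linf"
  shows "(LINT x|torus. \<bar>f x\<bar>) \<le> Linf_norm f"
proof -
  have "(LINT x|torus. \<bar>f x\<bar>) \<le> (LINT x|(torus :: (real ^ 'a) measure). Linf_norm f)"
    using L2_integrable[OF Linf_L2[OF assms]] Linf_norm_AE[OF assms]
    by (intro integral_mono_AE) auto
  then show ?thesis by (simp add: torus.prob_space[simplified])
qed

section \<open>The Sobolev spaces\<close>

abbreviation weight :: "real \<Rightarrow> int ^ 'n \<Rightarrow> real" where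
  "weight s k \<equiv> (1 + (fnorm k)\<^sup>2) powr s"

lemma weight_ge_1: "0 \<le> s \<Longrightarrow> 1 \<le> weight s k"
  by (intro ge_one_powr_ge_zero) auto

lemma sobolev_term_eq: "sobolev_term s f k = weight s k * (cmod (fourier_coeff f k))\<^sup>2"
  by (simp add: sobolev_term_def fnorm_sq)

lemma sobolev_term_nonneg: "0 \<le> sobolev_term s f k"
  by (simp add: sobolev_term_def)

lemma HsI:
  assumes "f \<in> L2" "\<And>F. finite F \<Longrightarrow> (\<Sum>k\<in>F. sobolev_term s f k) \<le> C\<^sup>2" "C \<ge> 0"
  shows "f \<in> Hs s" "Hs_norm s f \<le> C"
proof -
  have summ: "sobolev_term s f summable_on UNIV"
    using assms(2) by (intro nonneg_bdd_above_summable_on bdd_aboveI[of _ "C\<^sup>2"]) (auto simp: sobolev_term_nonneg)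
  then show "f \<in> Hs s" using assms(1) by (simp add: Hs_def)
  have "(\<Sum>\<^sub>\<infinity>k. sobolev_term s f k) \<le> C\<^sup>2"
    using assms(2) by (intro infsum_le_finite_sums summ) auto
  then show "Hs_norm s f \<le> C" unfolding Hs_norm_def using assms(3) by (intro real_le_lsqrt) auto
qed

lemma Hs_norm_nonneg: "0 \<le> Hs_norm s f"
  unfolding Hs_norm_def by (intro real_sqrt_ge_zero infsum_nonneg sobolev_term_nonneg)

lemma Hs_L2: "f \<in> Hs s \<Longrightarrow> f \<in> L2"
  by (simp add: Hs_def)

lemma Hs_finite_sum:
  assumes "f \<in> Hs s" "finite F"
  shows "(\<Sum>k\<in>F. sobolev_term s f k) \<le> (Hs_norm s f)\<^sup>2"
proof -
  have "(\<Sum>k\<in>F. sobolev_term s f k) \<le> (\<Sum>\<^sub>\<infinity>k. sobolev_term s f k)"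
    using assms by (intro finite_sum_le_infsum) (auto simp: Hs_def sobolev_term_nonneg)
  also have "\<dots> = (Hs_norm s f)\<^sup>2"
    unfolding Hs_norm_def by (simp add: infsum_nonneg sobolev_term_nonneg)
  finally show ?thesis .
qed

lemma sq_int_le_Hs:
  assumes s: "0 \<le> s" and f: "f \<in> Hs s"
  shows "sq_int f \<le> (Hs_norm s f)\<^sup>2"
proof -
  note p = parseval[OF Hs_L2[OF f]]
  have "infsum (\<lambda>k. (cmod (fourier_coeff f k))\<^sup>2) UNIV \<le> (Hs_norm s f)\<^sup>2"
  proof (rule infsum_le_finite_sums)
    show "(\<lambda>k. (cmod (fourier_coeff f k))\<^sup>2) summable_on UNIV" using p by (rule has_sum_imp_summable)
    fix F :: "(int ^ 'a) set" assume F: "finite F"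
    have "(\<Sum>k\<in>F. (cmod (fourier_coeff f k))\<^sup>2) \<le> (\<Sum>k\<in>F. sobolev_term s f k)"
    proof (rule sum_mono)
      fix k
      have "1 * (cmod (fourier_coeff f k))\<^sup>2 \<le> weight s k * (cmod (fourier_coeff f k))\<^sup>2"
        by (intro mult_right_mono weight_ge_1 s) auto
      then show "(cmod (fourier_coeff f k))\<^sup>2 \<le> sobolev_term s f k" by (simp add: sobolev_term_eq)
    qed
    also have "\<dots> \<le> (Hs_norm s f)\<^sup>2" by (rule Hs_finite_sum[OF f F])
    finally show "(\<Sum>k\<in>F. (cmod (fourier_coeff f k))\<^sup>2) \<le> (Hs_norm s f)\<^sup>2" .
  qed
  then show ?thesis using infsumI[OF p] by simp
qed

lemma fun_seminorm_Hs:
  shows "fun_seminorm (Hs s :: (real ^ 'n \<Rightarrow> real) set) (Hs_norm s)"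
proof
  show "(\<lambda>x. 0) \<in> (Hs s :: (real ^ 'n \<Rightarrow> real) set)"
    by (rule HsI(1)[of _ _ 0]) (auto simp: L2_zero sobolev_term_eq fourier_coeff_def)
next
  fix f g :: "real ^ 'n \<Rightarrow> real" assume fg: "f \<in> Hs s" "g \<in> Hs s"
  have L2: "(\<lambda>x. f x + g x) \<in> L2" using fg by (intro L2_add Hs_L2)
  let ?r = "\<lambda>h k. sqrt (weight s k) * cmod (fourier_coeff h k)"
  have r: "L2_set (?r h) F = sqrt (\<Sum>k\<in>F. sobolev_term s h k)" for h :: "real ^ 'n \<Rightarrow> real" and F
    by (simp add: L2_set_def sobolev_term_eq power_mult_distrib)
  have rle: "L2_set (?r h) F \<le> Hs_norm s h" if "h \<in> Hs s" "finite F" for h :: "real ^ 'n \<Rightarrow> real" and F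
    unfolding r using Hs_finite_sum[OF that] Hs_norm_nonneg by (intro real_le_lsqrt) auto
  have "(\<Sum>k\<in>F. sobolev_term s (\<lambda>x. f x + g x) k) \<le> (Hs_norm s f + Hs_norm s g)\<^sup>2" if F: "finite F" for F
  proof -
    have "sqrt (\<Sum>k\<in>F. sobolev_term s (\<lambda>x. f x + g x) k) = L2_set (?r (\<lambda>x. f x + g x)) F" by (rule r[symmetric])
    also have "\<dots> \<le> L2_set (\<lambda>k. ?r f k + ?r g k) F"
    proof (rule L2_set_mono)
      fix k
      have "cmod (fourier_coeff (\<lambda>x. f x + g x) k) \<le> cmod (fourier_coeff f k) + cmod (fourier_coeff g k)"
        unfolding fourier_coeff_add[OF L2_integrable[OF Hs_L2[OF fg(1)]] L2_integrable[OF Hs_L2[OF fg(2)]]]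
        by (rule norm_triangle_ineq)
      then have "sqrt (weight s k) * cmod (fourier_coeff (\<lambda>x. f x + g x) k)
          \<le> sqrt (weight s k) * (cmod (fourier_coeff f k) + cmod (fourier_coeff g k))"
        by (intro mult_left_mono) auto
      then show "?r (\<lambda>x. f x + g x) k \<le> ?r f k + ?r g k" by (simp add: distrib_left)
    qed auto
    also have "\<dots> \<le> L2_set (?r f) F + L2_set (?r g) F" by (rule L2_set_triangle_ineq)
    also have "\<dots> \<le> Hs_norm s f + Hs_norm s g" by (intro add_mono rle fg F)
    finally have "sqrt (\<Sum>k\<in>F. sobolev_term s (\<lambda>x. f x + g x) k) \<le> Hs_norm s f + Hs_norm s g" .
    then show ?thesis by (rule sqrt_le_D)
  qed
  note H = HsI[OF L2 this add_nonneg_nonneg[OF Hs_norm_nonneg Hs_norm_nonneg]]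
  show "(\<lambda>x. f x + g x) \<in> Hs s" by (rule H(1))
  show "Hs_norm s (\<lambda>x. f x + g x) \<le> Hs_norm s f + Hs_norm s g" by (rule H(2))
next
  fix f :: "real ^ 'n \<Rightarrow> real" assume f: "f \<in> Hs s"
  show "0 \<le> Hs_norm s f" by (rule Hs_norm_nonneg)
  fix c :: real
  have eq: "sobolev_term s (\<lambda>x. c * f x) k = c\<^sup>2 * sobolev_term s f k" for k
    by (simp add: sobolev_term_eq fourier_coeff_scale norm_mult power_mult_distrib)
  have L2: "(\<lambda>x. c * f x) \<in> L2" by (rule L2_scale[OF Hs_L2[OF f]])
  have summ: "sobolev_term s f summable_on UNIV" using f by (simp add: Hs_def)
  show "(\<lambda>x. c * f x) \<in> Hs s"
    using L2 summable_on_cmult_right[OF summ, of "c\<^sup>2"] by (simp add: Hs_def eq[abs_def])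
  show "Hs_norm s (\<lambda>x. c * f x) = \<bar>c\<bar> * Hs_norm s f"
    by (simp add: Hs_norm_def eq infsum_cmult_right' real_sqrt_mult)
qed

interpretation Hs: fun_seminorm "Hs s :: (real ^ 'n \<Rightarrow> real) set" "Hs_norm s" for s
  by (rule fun_seminorm_Hs)

text \<open>Lower semicontinuity of the Sobolev norm under L^2 convergence: it is enough to pass to
  the limit in finite sums of coefficients. It serves both completeness and the limit of the
  approximate solutions.\<close>

lemma Hs_limit_bound:
  fixes F :: "nat \<Rightarrow> real ^ 'n \<Rightarrow> real"
  assumes F: "\<And>n. F n \<in> L2" and f: "f \<in> L2" and lim: "(\<lambda>n. sq_int (\<lambda>x. F n x - f x)) \<longlonglongrightarrow> 0"
    and C: "\<forall>\<^sub>F n in sequentially. F n \<in> Hs s \<and> Hs_norm s (F n) \<le> C" "C \<ge> 0"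
  shows "f \<in> Hs s" "Hs_norm s f \<le> C"
proof -
  have "(\<Sum>k\<in>S. sobolev_term s f k) \<le> C\<^sup>2" if S: "finite S" for S
  proof (rule tendsto_upperbound)
    show "(\<lambda>n. \<Sum>k\<in>S. sobolev_term s (F n) k) \<longlonglongrightarrow> (\<Sum>k\<in>S. sobolev_term s f k)"
      unfolding sobolev_term_eq
      by (intro tendsto_sum tendsto_mult tendsto_const tendsto_power tendsto_norm
          sq_int_tendsto_fourier_coeff F f lim)
    show "\<forall>\<^sub>F n in sequentially. (\<Sum>k\<in>S. sobolev_term s (F n) k) \<le> C\<^sup>2"
      using C(1)
    proof eventually_elim
      case (elim n)
      then have "(\<Sum>k\<in>S. sobolev_term s (F n) k) \<le> (Hs_norm s (F n))\<^sup>2" by (intro Hs_finite_sum S) auto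
      also have "\<dots> \<le> C\<^sup>2" using elim Hs_norm_nonneg by (intro power_mono) auto
      finally show ?case .
    qed
  qed simp
  note H = HsI[OF f this C(2)]
  show "f \<in> Hs s" by (rule H(1))
  show "Hs_norm s f \<le> C" by (rule H(2))
qed

text \<open>The limit comes from L^2; lower semicontinuity applied to \<open>F m - F n\<close> as
  \<open>n\<close> grows upgrades the convergence to the Sobolev norm.\<close>

lemma Hs_complete:
  assumes s: "0 \<le> s"
  shows "seminorm_complete (Hs s :: (real ^ 'n \<Rightarrow> real) set) (Hs_norm s)"
  unfolding seminorm_complete_def
proof (intro allI impI, elim conjE)
  fix F :: "nat \<Rightarrow> real ^ 'n \<Rightarrow> real"
  assume "\<forall>n. F n \<in> Hs s"
    and cauchy: "\<forall>e>0. \<exists>M. \<forall>m\<ge>M. \<forall>n\<ge>M. Hs_norm s (\<lambda>x. F m x - F n x) < e"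
  then have F: "F n \<in> Hs s" for n by simp
  note FL2 = Hs_L2[OF F]
  have "\<exists>M. \<forall>m\<ge>M. \<forall>n\<ge>M. sq_int (\<lambda>x. F m x - F n x) < e" if e: "e > 0" for e
  proof -
    obtain M where M: "\<forall>m\<ge>M. \<forall>n\<ge>M. Hs_norm s (\<lambda>x. F m x - F n x) < sqrt e"
      using cauchy e by (meson real_sqrt_gt_zero)
    have "sq_int (\<lambda>x. F m x - F n x) < e" if "m \<ge> M" "n \<ge> M" for m n
    proof -
      have "sq_int (\<lambda>x. F m x - F n x) \<le> (Hs_norm s (\<lambda>x. F m x - F n x))\<^sup>2"
        by (intro sq_int_le_Hs s Hs.diff_mem F)
      also have "\<dots> < (sqrt e)\<^sup>2" using M that Hs_norm_nonneg by (intro power_strict_mono) auto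
      finally show ?thesis using e by simp
    qed
    then show ?thesis by auto
  qed
  note cauchy2 = this
  obtain f r where f: "f \<in> L2" and lim: "(\<lambda>n. sq_int (\<lambda>x. F n x - f x)) \<longlonglongrightarrow> 0"
    by (rule L2_complete[of F, OF FL2 cauchy2])
  have bound: "(\<lambda>x. F m x - f x) \<in> Hs s \<and> Hs_norm s (\<lambda>x. F m x - f x) \<le> e"
    if M: "\<And>n. n \<ge> M \<Longrightarrow> Hs_norm s (\<lambda>x. F m x - F n x) < e" and e: "e > 0" for m M e
  proof -
    have lim': "(\<lambda>n. sq_int (\<lambda>x. (F m x - F n x) - (F m x - f x))) \<longlonglongrightarrow> 0"
      using lim by (subst sq_int_diff_commute) simp
    have ev: "\<forall>\<^sub>F n in sequentially. (\<lambda>x. F m x - F n x) \<in> Hs s \<and> Hs_norm s (\<lambda>x. F m x - F n x) \<le> e"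
      using M by (intro eventually_sequentiallyI[of M]) (auto intro!: Hs.diff_mem F less_imp_le)
    show ?thesis
      using Hs_limit_bound[OF L2_diff[OF FL2 FL2] L2_diff[OF FL2 f] lim' ev less_imp_le[OF e]] by blast
  qed
  obtain M where M: "\<forall>m\<ge>M. \<forall>n\<ge>M. Hs_norm s (\<lambda>x. F m x - F n x) < 1" using cauchy by (meson zero_less_one)
  have "(\<lambda>x. F M x - f x) \<in> Hs s" using bound[of M M 1] M by auto
  from Hs.diff_mem[OF F[of M] this] have "f \<in> Hs s" by simp
  moreover have "(\<lambda>n. Hs_norm s (\<lambda>x. F n x - f x)) \<longlonglongrightarrow> 0"
  proof (rule LIMSEQ_I)
    fix e :: real assume e: "e > 0"
    then obtain M where M: "\<forall>m\<ge>M. \<forall>n\<ge>M. Hs_norm s (\<lambda>x. F m x - F n x) < e/2"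
      using cauchy by (meson half_gt_zero)
    have "norm (Hs_norm s (\<lambda>x. F m x - f x) - 0) < e" if "m \<ge> M" for m
      using bound[of M m "e/2"] M that e Hs_norm_nonneg[of s "\<lambda>x. F m x - f x"] by simp
    then show "\<exists>no. \<forall>n\<ge>no. norm (Hs_norm s (\<lambda>x. F n x - f x) - 0) < e" by auto
  qed
  ultimately show "\<exists>f\<in>Hs s. (\<lambda>n. Hs_norm s (\<lambda>x. F n x - f x)) \<longlonglongrightarrow> 0" by blast
qed

section \<open>Divergence in terms of Fourier coefficients\<close>

lemma test_function_differentiable:
  assumes "\<phi> \<in> test_functions"
  shows "\<phi> differentiable (at x)"
proof -
  have "C_k (Suc 0) \<phi>" using assms by (auto simp: test_functions_def)
  then show ?thesis by simp
qed

lemma test_function_continuous: "\<phi> \<in> test_functions \<Longrightarrow> continuous_on UNIV \<phi>"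
  by (intro differentiable_imp_continuous_on differentiable_at_imp_differentiable_on
      test_function_differentiable)

lemma test_function_partial_continuous:
  assumes "\<phi> \<in> test_functions"
  shows "continuous_on UNIV (partial j \<phi>)"
proof -
  have "C_k (Suc 0) \<phi>" using assms by (auto simp: test_functions_def)
  then show ?thesis by simp
qed

lemma test_function_partial_periodic:
  assumes "\<phi> \<in> test_functions"
  shows "periodic (partial j \<phi>)"
  unfolding periodic_def
proof (intro allI)
  fix x :: "real ^ 'a" and i
  let ?D = "frechet_derivative \<phi> (at (x + axis i 1))"
  have per: "\<phi> (y + axis i 1) = \<phi> y" for y using assms by (auto simp: test_functions_def periodic_def)
  have "(\<phi> has_derivative ?D) (at (x + axis i 1))"
    using test_function_differentiable[OF assms] by (simp add: frechet_derivative_works)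
  moreover have "((\<lambda>y. y + axis i 1) has_derivative (\<lambda>y. y)) (at x)"
    by (auto intro!: derivative_eq_intros)
  ultimately have "((\<lambda>y. \<phi> (y + axis i 1)) has_derivative (\<lambda>y. ?D y)) (at x)"
    using has_derivative_compose[of "\<lambda>y. y + axis i 1" "\<lambda>y. y" x UNIV \<phi> ?D] by simp
  then have "(\<phi> has_derivative ?D) (at x)" by (simp add: per)
  then have "?D = frechet_derivative \<phi> (at x)" by (rule frechet_derivative_at)
  then show "partial j \<phi> (x + axis i 1) = partial j \<phi> x" by (simp add: partial_def)
qed

lemma test_function_partial_L2: "\<phi> \<in> test_functions \<Longrightarrow> partial j \<phi> \<in> L2"
  by (intro continuous_periodic_L2 test_function_partial_continuous test_function_partial_periodic)

lemma test_function_line_derivative: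
  assumes "\<phi> \<in> test_functions"
  shows "((\<lambda>t. \<phi> (x + axis j t)) has_real_derivative partial j \<phi> (x + axis j t)) (at t)"
proof -
  let ?D = "frechet_derivative \<phi> (at (x + axis j t))"
  have D: "(\<phi> has_derivative ?D) (at (x + axis j t))"
    using test_function_differentiable[OF assms] by (simp add: frechet_derivative_works)
  have ax: "axis j s = s *\<^sub>R (axis j 1 :: real ^ 'a)" for s
    by (simp add: vec_eq_iff axis_def)
  have "((\<lambda>t. x + t *\<^sub>R axis j 1) has_derivative (\<lambda>s. s *\<^sub>R axis j 1)) (at t)"
    by (auto intro!: derivative_eq_intros)
  then have "((\<lambda>t. x + axis j t) has_derivative (\<lambda>s. axis j s)) (at t)"
    by (simp only: ax[symmetric])
  from has_derivative_compose[OF this, of \<phi> ?D] D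
  have "((\<lambda>t. \<phi> (x + axis j t)) has_derivative (\<lambda>s. ?D (axis j s))) (at t)" by simp
  moreover have "?D (axis j s) = partial j \<phi> (x + axis j t) * s" for s
    unfolding ax[of s] partial_def
    using linear_scale[OF has_derivative_linear[OF D], of s "axis j 1"] by simp
  ultimately show ?thesis by (simp add: has_field_derivative_def)
qed

lemma cis_difference_quotient:
  "(\<lambda>n. (cis (a * (1 / real (Suc n))) - 1) / complex_of_real (1 / real (Suc n))) \<longlonglongrightarrow> \<i> * complex_of_real a"
proof -
  let ?z = "\<i> * complex_of_real a"
  have "((\<lambda>h. exp (h * ?z)) has_field_derivative ?z) (at 0)"
    by (auto intro!: derivative_eq_intros)
  then have lim: "(\<lambda>h. (exp (h * ?z) - 1) / h) \<midarrow>0\<rightarrow> ?z"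
    by (simp add: DERIV_def)
  have t0: "(\<lambda>n. complex_of_real (1 / real (Suc n))) \<longlonglongrightarrow> complex_of_real 0"
    by (intro tendsto_of_real LIMSEQ_Suc[OF lim_1_over_n])
  have "(\<lambda>n. (exp (complex_of_real (1 / real (Suc n)) * ?z) - 1) / complex_of_real (1 / real (Suc n))) \<longlonglongrightarrow> ?z"
  proof -
    have "complex_of_real (1 / real (Suc n)) \<noteq> 0" for n
      unfolding of_real_eq_0_iff by simp
    then show ?thesis
      using LIMSEQ_SEQ_conv[THEN iffD2, OF lim, rule_format, of "\<lambda>n. complex_of_real (1 / real (Suc n))"] t0 by simp
  qed
  moreover have "exp (complex_of_real t * ?z) = cis (a * t)" for t
    by (simp add: cis_conv_exp mult_ac)
  ultimately show ?thesis by (simp only:)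
qed

text \<open>
  Integration by parts: both sides are derivatives at \<open>t = 0\<close> of the Fourier coefficient of
  the translate of \<open>\<phi>\<close> by \<open>t\<close> in direction \<open>j\<close>.
\<close>
lemma fourier_coeff_partial:
  fixes \<phi> :: "real ^ 'n \<Rightarrow> real"
  assumes \<phi>: "\<phi> \<in> test_functions"
  shows "fourier_coeff (partial j \<phi>) k = \<i> * of_real (2 * pi * of_int (k $ j)) * fourier_coeff \<phi> k"
proof -
  let ?t = "\<lambda>n. 1 / real (Suc n)"
  have per: "periodic \<phi>" and cont: "continuous_on UNIV \<phi>" and pcont: "continuous_on UNIV (partial j \<phi>)"
    using \<phi> test_function_continuous test_function_partial_continuous by (auto simp: test_functions_def)
  have cont_t: "continuous_on UNIV (\<lambda>x. \<phi> (x + axis j t))" for t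
    by (intro continuous_on_compose2[OF cont] continuous_intros) auto
  define Q where "Q n x = (\<phi> (x + axis j (?t n)) - \<phi> x) / ?t n" for n x
  have Qcont: "continuous_on UNIV (Q n)" for n
    unfolding Q_def by (intro continuous_intros cont_t cont) auto
  have shift: "(LINT x|torus. chr (- k) x * complex_of_real (\<phi> (x + axis j t))) = chr k (axis j t) * fourier_coeff \<phi> k"
    if t: "0 \<le> t" "t \<le> 1" for t
  proof -
    have "(LINT x|torus. chr (- k) (x + axis j t) * complex_of_real (\<phi> (x + axis j t))) = fourier_coeff \<phi> k"
      unfolding fourier_coeff_chr
    proof (rule LINT_torus_translate[OF _ _ t])
      show "continuous_on UNIV (\<lambda>x. chr (- k) x * complex_of_real (\<phi> x))"
        by (intro continuous_intros cont)
      show "periodic (\<lambda>x. chr (- k) x * complex_of_real (\<phi> x))"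
        using periodic_chr[of "- k"] per by (auto simp: periodic_def)
    qed
    then have "chr (- k) (axis j t) * (LINT x|torus. chr (- k) x * complex_of_real (\<phi> (x + axis j t))) = fourier_coeff \<phi> k"
    proof -
      have "chr (- k) (x + axis j t) * y = chr (- k) (axis j t) * (chr (- k) x * y)" for x y
        by (simp add: chr_plus)
      with \<open>(LINT x|torus. chr (- k) (x + axis j t) * complex_of_real (\<phi> (x + axis j t))) = fourier_coeff \<phi> k\<close>
      show ?thesis by (simp only: integral_mult_right_zero)
    qed
    then have "chr k (axis j t) * chr (- k) (axis j t) * (LINT x|torus. chr (- k) x * complex_of_real (\<phi> (x + axis j t)))
        = chr k (axis j t) * fourier_coeff \<phi> k" by (simp add: mult.assoc)
    then show ?thesis by (simp add: chr_add[symmetric])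
  qed
  have Qcoeff: "fourier_coeff (Q n) k = (cis (2 * pi * of_int (k $ j) * ?t n) - 1) / complex_of_real (?t n) * fourier_coeff \<phi> k" for n
  proof -
    have "fourier_coeff (Q n) k = fourier_coeff (\<lambda>x. (1 / ?t n) * (\<phi> (x + axis j (?t n)) - \<phi> x)) k"
    proof -
      have "Q n = (\<lambda>x. (1 / ?t n) * (\<phi> (x + axis j (?t n)) - \<phi> x))"
        by (simp add: Q_def fun_eq_iff)
      then show ?thesis by (simp only:)
    qed
    also have "\<dots> = of_real (1 / ?t n) * (fourier_coeff (\<lambda>x. \<phi> (x + axis j (?t n))) k - fourier_coeff \<phi> k)"
      by (simp only: fourier_coeff_scale
        fourier_coeff_diff[OF continuous_integrable_torus[OF cont_t] continuous_integrable_torus[OF cont]])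
    also have "fourier_coeff (\<lambda>x. \<phi> (x + axis j (?t n))) k = chr k (axis j (?t n)) * fourier_coeff \<phi> k"
      unfolding fourier_coeff_chr[of "\<lambda>x. \<phi> (x + axis j (?t n))"] by (rule shift) auto
    finally show ?thesis by (simp add: chr_axis mult.assoc field_simps)
  qed
  \<comment> \<open>The larger cube is taken because the mean value points
    \<open>x + axis j z\<close> may leave the unit cube.\<close>
  have "compact (partial j \<phi> ` cbox (0 :: real ^ 'n) 2)"
    by (rule compact_continuous_image[OF continuous_on_subset[OF pcont]]) auto
  then have "bounded (partial j \<phi> ` cbox (0 :: real ^ 'n) 2)" by (rule compact_imp_bounded)
  then obtain B where B: "\<forall>y\<in>partial j \<phi> ` cbox (0 :: real ^ 'n) 2. norm y \<le> B" unfolding bounded_iff by auto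
  have Qbound: "\<bar>Q n x\<bar> \<le> B" if x: "x \<in> cbox 0 1" for n x
  proof -
    have "\<exists>z>0. z < ?t n \<and> \<phi> (x + axis j (?t n)) - \<phi> (x + axis j 0) = (?t n - 0) * partial j \<phi> (x + axis j z)"
      by (rule MVT2) (auto intro: test_function_line_derivative[OF \<phi>])
    then obtain z where z: "0 < z" "z < ?t n"
      and eq: "\<phi> (x + axis j (?t n)) - \<phi> (x + axis j 0) = (?t n - 0) * partial j \<phi> (x + axis j z)" by auto
    have a0: "axis j 0 = (0 :: real ^ 'n)" by (simp add: vec_eq_iff axis_def)
    have "\<phi> (x + axis j (?t n)) - \<phi> x = ?t n * partial j \<phi> (x + axis j z)"
      using eq by (simp only: a0 add_0_right diff_zero)
    then have "Q n x = partial j \<phi> (x + axis j z)" by (simp add: Q_def)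
    moreover have "x + axis j z \<in> cbox 0 2"
    proof -
      have "?t n \<le> 1" by simp
      then have z1: "z \<le> 1" using z by linarith
      have "0 \<le> x $ i + (axis j z) $ i \<and> x $ i + (axis j z) $ i \<le> 2" for i
      proof -
        have "0 \<le> x $ i" "x $ i \<le> 1" using x by (auto simp: mem_box_cart)
        then show ?thesis using z z1 by (auto simp: axis_def)
      qed
      then show ?thesis by (simp add: mem_box_cart)
    qed
    ultimately show ?thesis using B by auto
  qed
  have "(\<lambda>n. fourier_coeff (Q n) k) \<longlonglongrightarrow> fourier_coeff (partial j \<phi>) k"
    unfolding fourier_coeff_chr
  proof (rule integral_dominated_convergence[where w = "\<lambda>_. B"])
    show "(\<lambda>x. chr (- k) x * complex_of_real (partial j \<phi> x)) \<in> borel_measurable torus"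
      by (intro continuous_measurable_torus continuous_intros pcont)
    show "(\<lambda>x. chr (- k) x * complex_of_real (Q n x)) \<in> borel_measurable torus" for n
      by (intro continuous_measurable_torus continuous_intros Qcont)
    show "AE x in torus. norm (chr (- k) x * complex_of_real (Q n x)) \<le> B" for n
      using Qbound by (intro AE_I2) (simp add: norm_mult)
    show "AE x in torus. (\<lambda>n. chr (- k) x * complex_of_real (Q n x)) \<longlonglongrightarrow> chr (- k) x * complex_of_real (partial j \<phi> x)"
    proof (intro AE_I2 tendsto_mult tendsto_const tendsto_of_real)
      fix x :: "real ^ 'n"
      have a0: "axis j 0 = (0 :: real ^ 'n)" by (simp add: vec_eq_iff axis_def)
      have "(\<lambda>h. (\<phi> (x + axis j (0 + h)) - \<phi> (x + axis j 0)) / h) \<midarrow>0\<rightarrow> partial j \<phi> (x + axis j 0)"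
        using test_function_line_derivative[OF \<phi>, of x j 0] by (simp only: DERIV_def)
      then have lim: "(\<lambda>h. (\<phi> (x + axis j h) - \<phi> x) / h) \<midarrow>0\<rightarrow> partial j \<phi> x" by (simp add: a0)
      show "(\<lambda>n. Q n x) \<longlonglongrightarrow> partial j \<phi> x"
        unfolding Q_def
        using LIMSEQ_SEQ_conv[THEN iffD2, OF lim, rule_format, of ?t] LIMSEQ_Suc[OF lim_1_over_n] by simp
    qed
  qed simp
  moreover have "(\<lambda>n. fourier_coeff (Q n) k) \<longlonglongrightarrow> \<i> * of_real (2 * pi * of_int (k $ j)) * fourier_coeff \<phi> k"
    unfolding Qcoeff by (intro tendsto_mult tendsto_const cis_difference_quotient)
  ultimately show ?thesis by (rule LIMSEQ_unique)
qed

lemma has_sum_finite_sum: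
  fixes f :: "'j \<Rightarrow> 'k \<Rightarrow> real"
  assumes "finite A" "\<And>j. j \<in> A \<Longrightarrow> (f j has_sum s j) U"
  shows "((\<lambda>k. \<Sum>j\<in>A. f j k) has_sum (\<Sum>j\<in>A. s j)) U"
  using assms by (induction A rule: finite_induct) (auto intro: has_sum_add)

text \<open>By \<open>parseval_inner\<close>, the pairing of a field with the gradient of a test
  function depends on the field only through \<open>kdot k\<close> of its coefficients.\<close>

lemma same_divI:
  fixes u v :: "real ^ 'n \<Rightarrow> real ^ 'n"
  assumes u: "\<And>j. (\<lambda>x. u x $ j) \<in> L2" and v: "\<And>j. (\<lambda>x. v x $ j) \<in> L2"
    and eq: "\<And>k. kdot k (coeff_vec (\<lambda>j x. u x $ j) k) = kdot k (coeff_vec (\<lambda>j x. v x $ j) k)"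
  shows "same_div u v"
  unfolding same_div_def
proof
  fix \<phi> :: "real ^ 'n \<Rightarrow> real" assume \<phi>: "\<phi> \<in> test_functions"
  have div: "((\<lambda>k. Re (kdot k (coeff_vec (\<lambda>j x. w x $ j) k) * cnj (\<i> * of_real (2 * pi) * fourier_coeff \<phi> k))) has_sum - distr_div w \<phi>) UNIV"
    if w: "\<And>j. (\<lambda>x. w x $ j) \<in> L2" for w :: "real ^ 'n \<Rightarrow> real ^ 'n"
  proof -
    have "((\<lambda>k. \<Sum>j\<in>UNIV. Re (fourier_coeff (\<lambda>x. w x $ j) k * cnj (fourier_coeff (partial j \<phi>) k)))
        has_sum (\<Sum>j\<in>UNIV. LINT x|torus. w x $ j * partial j \<phi> x)) UNIV"
      by (intro has_sum_finite_sum finite parseval_inner w test_function_partial_L2 \<phi>)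
    moreover have "(\<Sum>j\<in>UNIV. Re (fourier_coeff (\<lambda>x. w x $ j) k * cnj (fourier_coeff (partial j \<phi>) k)))
        = Re (kdot k (coeff_vec (\<lambda>j x. w x $ j) k) * cnj (\<i> * of_real (2 * pi) * fourier_coeff \<phi> k))" for k
      unfolding fourier_coeff_partial[OF \<phi>] kdot_def coeff_vec_def sum_distrib_right Re_sum
      by (intro sum.cong refl) (simp add: algebra_simps)
    moreover have "(\<Sum>j\<in>UNIV. LINT x|torus. w x $ j * partial j \<phi> x) = - distr_div w \<phi>"
      unfolding distr_div_def minus_minus
      by (rule Bochner_Integration.integral_sum[symmetric]) (intro L2_integrable_mult w test_function_partial_L2 \<phi>)
    ultimately show ?thesis by (simp only:)
  qed
  have "- distr_div u \<phi> = - distr_div v \<phi>"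
    using div[of u, OF u] div[of v, OF v] unfolding eq by (rule has_sum_unique)
  then show "distr_div u \<phi> = distr_div v \<phi>" by simp
qed

section \<open>Solving the divergence equation in the critical space\<close>

text \<open>Nonzero integer frequencies satisfy \<open>fnorm k \<ge> 1\<close>, so the homogeneous
  and the inhomogeneous critical weight agree up to a constant.\<close>

lemma fnorm_power_weight:
  fixes k :: "int ^ 'n"
  assumes "k \<noteq> 0"
  shows "fnorm k ^ CARD('n) \<le> weight (real CARD('n) / 2) k"
    and "weight (real CARD('n) / 2) k \<le> 2 powr (real CARD('n) / 2) * fnorm k ^ CARD('n)"
proof -
  let ?s = "real CARD('n) / 2"
  have k1: "fnorm k \<ge> 1" by (rule fnorm_ge_1[OF assms])
  then have k0: "fnorm k > 0" by linarith
  have two: "2 * ?s = real CARD('n)" by simp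
  have "(fnorm k)\<^sup>2 powr ?s = (fnorm k powr 2) powr ?s"
    using k0 by (simp only: powr_numeral)
  also have "\<dots> = fnorm k powr (2 * ?s)" by (rule powr_powr)
  also have "\<dots> = fnorm k powr real CARD('n)" by (simp only: two)
  also have "\<dots> = fnorm k ^ CARD('n)" using k0 by (rule powr_realpow)
  finally have eq: "(fnorm k)\<^sup>2 powr ?s = fnorm k ^ CARD('n)" .
  have "(fnorm k)\<^sup>2 powr ?s \<le> weight ?s k" by (intro powr_mono2) auto
  then show "fnorm k ^ CARD('n) \<le> weight ?s k" unfolding eq .
  have "1 \<le> (fnorm k)\<^sup>2" using power_mono[OF k1, of 2] by simp
  then have "weight ?s k \<le> (2 * (fnorm k)\<^sup>2) powr ?s" by (intro powr_mono2) auto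
  also have "\<dots> = 2 powr ?s * (fnorm k)\<^sup>2 powr ?s" by (simp add: powr_mult)
  finally show "weight ?s k \<le> 2 powr ?s * fnorm k ^ CARD('n)" unfolding eq .
qed

lemma norm_coeff_vec_sq: "(norm (coeff_vec v k))\<^sup>2 = (\<Sum>j\<in>UNIV. (cmod (fourier_coeff (v j) k))\<^sup>2)"
  by (simp add: norm_vec_def L2_set_def coeff_vec_def sum_nonneg)

lemma vsym_coeff_vec: "vsym (coeff_vec v)"
  by (simp add: vsym_def coeff_vec_def fourier_coeff_minus)

lemma smallness_pos: "0 < smallness T"
proof -
  have "0 < 2 * (2 * sqrt (kernel_const T) + 9)"
    by (intro mult_pos_pos add_nonneg_pos mult_nonneg_nonneg) (auto simp: kernel_const_nonneg)
  then show ?thesis unfolding smallness_def by simp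
qed

text \<open>The data are cut to \<open>2 * fnorm k \<le> 2 ^ I\<close> because that is where
  \<open>rho_lower\<close> applies; the tents degenerate towards the edge of the spectrum. The
  factor \<open>e\<close> is the same for all \<open>I\<close>, so that it can be divided out after
  the limit.\<close>

lemma low_freq_data_bound:
  fixes v :: "'n \<Rightarrow> real ^ 'n \<Rightarrow> real"
  assumes v: "\<And>j. v j \<in> Hs (real CARD('n) / 2)"
  obtains e where "e > 0"
    "\<And>I. sqrt (\<Sum>k\<in>spectrum I. (norm (if 2 * fnorm k \<le> 2 ^ I then e *\<^sub>R coeff_vec v k else 0))\<^sup>2 / rho I k) \<le> smallness TYPE('n)"
proof -
  let ?s = "real CARD('n) / 2"
  define L :: real where "L = 2 * 4 ^ (CARD('n) + 2)"
  have L: "0 < L" by (simp add: L_def)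
  define M where "M = (\<Sum>j\<in>UNIV. (Hs_norm ?s (v j))\<^sup>2)"
  have M: "0 \<le> M" unfolding M_def by (intro sum_nonneg) auto
  \<comment> \<open>The added 1 keeps the denominator positive for zero data.\<close>
  define e where "e = smallness TYPE('n) / (sqrt (L * M) + 1)"
  have pos: "0 < sqrt (L * M) + 1" using L M by (intro add_nonneg_pos) auto
  then have e: "e > 0" unfolding e_def by (intro divide_pos_pos smallness_pos)
  have "sqrt (\<Sum>k\<in>spectrum I. (norm (if 2 * fnorm k \<le> 2 ^ I then e *\<^sub>R coeff_vec v k else 0))\<^sup>2 / rho I k) \<le> smallness TYPE('n)" for I
  proof -
    have "(\<Sum>k\<in>spectrum I. (norm (if 2 * fnorm k \<le> 2 ^ I then e *\<^sub>R coeff_vec v k else 0))\<^sup>2 / rho I k)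
        \<le> (\<Sum>k\<in>spectrum I. \<Sum>j\<in>UNIV. e\<^sup>2 * L * sobolev_term ?s (v j) k)"
    proof (rule sum_mono)
      fix k :: "int ^ 'n" assume k: "k \<in> spectrum I"
      have k0: "k \<noteq> 0" by (rule spectrum_nonzero[OF k])
      have rp: "0 < rho I k" by (rule spectrum_rho_pos[OF k])
      have rhs: "(\<Sum>j\<in>UNIV. e\<^sup>2 * L * sobolev_term ?s (v j) k) = e\<^sup>2 * L * weight ?s k * (norm (coeff_vec v k))\<^sup>2"
        unfolding sobolev_term_eq norm_coeff_vec_sq by (simp add: sum_distrib_left mult.assoc)
      show "(norm (if 2 * fnorm k \<le> 2 ^ I then e *\<^sub>R coeff_vec v k else 0))\<^sup>2 / rho I k
          \<le> (\<Sum>j\<in>UNIV. e\<^sup>2 * L * sobolev_term ?s (v j) k)"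
      proof (cases "2 * fnorm k \<le> 2 ^ I")
        case True
        have "1 \<le> rho I k * (L * fnorm k ^ CARD('n))"
          using rho_lower[OF k0 True] by (simp add: L_def)
        also have "\<dots> \<le> rho I k * (L * weight ?s k)"
          using L rp by (intro mult_left_mono fnorm_power_weight(1)[OF k0]) auto
        finally have "1 / rho I k \<le> L * weight ?s k" using rp by (simp add: divide_le_eq mult.commute)
        then have "(e\<^sup>2 * (norm (coeff_vec v k))\<^sup>2) * (1 / rho I k) \<le> (e\<^sup>2 * (norm (coeff_vec v k))\<^sup>2) * (L * weight ?s k)"
          by (intro mult_left_mono) auto
        then show ?thesis unfolding rhs using True by (simp add: power_mult_distrib mult_ac)
      next
        case False
        then show ?thesis unfolding rhs using L by simp
      qed
    qed
    also have "\<dots> = (\<Sum>j\<in>UNIV. e\<^sup>2 * L * (\<Sum>k\<in>spectrum I. sobolev_term ?s (v j) k))"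
      unfolding sum_distrib_left by (rule sum.swap)
    also have "\<dots> \<le> (\<Sum>j\<in>UNIV. e\<^sup>2 * L * (Hs_norm ?s (v j))\<^sup>2)"
      using L by (intro sum_mono mult_left_mono Hs_finite_sum v) auto
    also have "\<dots> = (e * sqrt (L * M))\<^sup>2"
      using L M by (simp add: M_def[symmetric] sum_distrib_left[symmetric] power_mult_distrib)
    finally have "sqrt (\<Sum>k\<in>spectrum I. (norm (if 2 * fnorm k \<le> 2 ^ I then e *\<^sub>R coeff_vec v k else 0))\<^sup>2 / rho I k)
        \<le> e * sqrt (L * M)"
      using e L M by (intro real_le_lsqrt) auto
    also have "\<dots> \<le> e * (sqrt (L * M) + 1)" using e by (intro mult_left_mono) auto
    also have "\<dots> = smallness TYPE('n)" using pos by (simp add: e_def)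
    finally show ?thesis .
  qed
  with e show thesis by (rule that)
qed

lemma vtrig_L2: "vtrig I c j \<in> L2"
  unfolding vtrig_def by (rule trig_L2)

lemma coeff_vec_vtrig:
  assumes "c \<in> admissible I v"
  shows "fourier_coeff (vtrig I c j) k = c k $ j"
  using assms fourier_coeff_trig[OF vsym_sym_coeff finite_spectrum, of c I j k]
  by (auto simp: admissible_def vtrig_def)

text \<open>By Fatou's lemma the lower limit of \<open>U i x ^ p i\<close> is finite almost
  everywhere. Where |u x| > r > 1, these powers eventually exceed \<open>r ^ p i\<close>, which is
  unbounded.\<close>

lemma AE_bounded_of_power_bound:
  fixes U :: "nat \<Rightarrow> real ^ 'n \<Rightarrow> real"
  assumes U: "\<And>i. continuous_on UNIV (U i)" and lim: "AE x in torus. (\<lambda>i. U i x) \<longlonglongrightarrow> u x"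
    and p: "\<And>i. even (p i)" "\<And>i. i \<le> p i" and C: "\<And>i. (LINT x|torus. U i x ^ p i) \<le> C"
  shows "AE x in torus. \<bar>u x\<bar> \<le> 1"
proof -
  have [measurable]: "U i \<in> borel_measurable torus" for i by (rule continuous_measurable_torus[OF U])
  have "(\<integral>\<^sup>+x. liminf (\<lambda>i. ennreal (U i x ^ p i)) \<partial>torus) \<le> liminf (\<lambda>i. \<integral>\<^sup>+x. ennreal (U i x ^ p i) \<partial>torus)"
    by (rule nn_integral_liminf) measurable
  also have "\<dots> \<le> liminf (\<lambda>i. ennreal C)"
  proof (intro Liminf_mono always_eventually allI)
    fix i
    have "(\<integral>\<^sup>+x. ennreal (U i x ^ p i) \<partial>torus) = ennreal (LINT x|torus. U i x ^ p i)"
      using p(1)[of i] by (intro nn_integral_eq_integral continuous_integrable_torus continuous_intros U)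
        (auto simp: zero_le_even_power)
    also have "\<dots> \<le> ennreal C" by (rule ennreal_leI[OF C])
    finally show "(\<integral>\<^sup>+x. ennreal (U i x ^ p i) \<partial>torus) \<le> ennreal C" .
  qed
  also have "\<dots> = ennreal C" by (intro lim_imp_Liminf) auto
  finally have "(\<integral>\<^sup>+x. liminf (\<lambda>i. ennreal (U i x ^ p i)) \<partial>torus) \<noteq> \<infinity>"
    by (auto simp: top_unique)
  then have "AE x in torus. liminf (\<lambda>i. ennreal (U i x ^ p i)) \<noteq> \<infinity>"
    by (intro nn_integral_PInf_AE) auto
  with lim show ?thesis
  proof eventually_elim
    case (elim x)
    show ?case
    proof (rule ccontr)
      assume "\<not> \<bar>u x\<bar> \<le> 1"
      then obtain r where r: "1 < r" "r < \<bar>u x\<bar>" using dense[of 1 "\<bar>u x\<bar>"] by auto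
      have "(\<lambda>i. \<bar>U i x\<bar>) \<longlonglongrightarrow> \<bar>u x\<bar>" using elim(1) by (rule tendsto_rabs)
      then have ev: "\<forall>\<^sub>F i in sequentially. r < \<bar>U i x\<bar>" using r(2) by (rule order_tendstoD(1))
      have "ennreal B \<le> liminf (\<lambda>i. ennreal (U i x ^ p i))" for B
      proof (rule Liminf_bounded)
        obtain N where N: "B < r ^ N" using real_arch_pow[OF r(1)] by blast
        show "\<forall>\<^sub>F i in sequentially. ennreal B \<le> ennreal (U i x ^ p i)"
          using ev eventually_ge_at_top[of N]
        proof eventually_elim
          case (elim i)
          have "B \<le> r ^ N" using N by simp
          also have "\<dots> \<le> r ^ p i" using r elim(2) p(2)[of i] by (intro power_increasing) auto
          also have "\<dots> \<le> \<bar>U i x\<bar> ^ p i" using r elim(1) by (intro power_mono) auto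
          also have "\<dots> = U i x ^ p i" by (rule power_even_abs[OF p(1)])
          finally show ?case by (rule ennreal_leI)
        qed
      qed
      then have "liminf (\<lambda>i. ennreal (U i x ^ p i)) = top"
        by (cases "liminf (\<lambda>i. ennreal (U i x ^ p i))") (auto simp: ennreal_le_iff dest: spec[of _ "_ + 1"], metis add_increasing2 ennreal_le_iff less_add_one not_le zero_le_one)
      with elim(2) show False by simp
    qed
  qed
qed

text \<open>Rellich compactness: the weighted bound makes the high-frequency tails uniformly small,
  and only finitely many coefficients remain, each of which converges.\<close>

lemma coeff_sequence_cauchy:
  fixes c :: "nat \<Rightarrow> int ^ 'n \<Rightarrow> complex ^ 'n" and U :: "nat \<Rightarrow> real ^ 'n \<Rightarrow> real"
  assumes d: "CARD('n) \<ge> 2" and U: "\<And>n. U n \<in> L2" and coeff: "\<And>n k. fourier_coeff (U n) k = c n k $ j"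
    and lim: "\<And>k. (\<lambda>n. c n k) \<longlonglongrightarrow> l k"
    and R: "\<And>n F. finite F \<Longrightarrow> (\<Sum>k\<in>F. weight (real CARD('n) / 2) k * (norm (c n k))\<^sup>2) \<le> R"
    and e: "e > 0"
  shows "\<exists>M. \<forall>m\<ge>M. \<forall>n\<ge>M. sq_int (\<lambda>x. U m x - U n x) < e"
proof -
  let ?s = "real CARD('n) / 2"
  have R0: "0 \<le> R" using R[of "{}" 0] by simp
  \<comment> \<open>The tails of the two terms together cost at most \<open>4 * R / N'\<close>, and
    this choice makes that at most \<open>e / 4\<close>.\<close>
  obtain N :: nat where N: "4 * (4 * R) / e < real N" using reals_Archimedean2 by blast
  define N' where "N' = Suc N"
  have N': "1 \<le> real N'" "4 * (4 * R) / e < real N'" using N by (auto simp: N'_def)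
  have tail: "(norm z)\<^sup>2 \<le> (1 / real N') * (weight ?s k * (norm z)\<^sup>2)" if "k \<notin> freq_box N'" for k :: "int ^ 'n" and z :: "complex ^ 'n"
  proof -
    have kN: "real N' \<le> fnorm k" using fnorm_le_freq_box[of k N'] that by (metis linear)
    then have "real N' \<le> (fnorm k)\<^sup>2" using N'(1) self_le_power[of "fnorm k" 2] by linarith
    also have "\<dots> \<le> (1 + (fnorm k)\<^sup>2) powr 1" by simp
    \<comment> \<open>The exponent \<open>?s\<close> is at least 1 since d \<ge> 2.\<close>
    also have "\<dots> \<le> weight ?s k" using d by (intro powr_mono) auto
    finally have "real N' * (norm z)\<^sup>2 \<le> weight ?s k * (norm z)\<^sup>2" by (intro mult_right_mono) auto
    then show ?thesis using N'(1) by (simp add: field_simps)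
  qed
  define D where "D m n = (\<Sum>k\<in>(freq_box N' :: (int ^ 'n) set). (norm (c m k - c n k))\<^sup>2)" for m n
  have "\<exists>M. \<forall>m\<ge>M. \<forall>n\<ge>M. D m n < e / 2"
  proof -
    have "(\<lambda>n. \<Sum>k\<in>(freq_box N' :: (int ^ 'n) set). (norm (c n k - l k))\<^sup>2) \<longlonglongrightarrow> (\<Sum>k\<in>(freq_box N' :: (int ^ 'n) set). (norm (l k - l k))\<^sup>2)"
      by (intro tendsto_sum tendsto_power tendsto_norm tendsto_diff lim tendsto_const)
    then have "(\<lambda>n. \<Sum>k\<in>(freq_box N' :: (int ^ 'n) set). (norm (c n k - l k))\<^sup>2) \<longlonglongrightarrow> 0" by simp
    from LIMSEQ_D[OF this, of "e / 8"] e
    obtain M where M: "\<And>n. n \<ge> M \<Longrightarrow> (\<Sum>k\<in>(freq_box N' :: (int ^ 'n) set). (norm (c n k - l k))\<^sup>2) < e / 8"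
      by (auto simp: sum_nonneg)
    have "D m n < e / 2" if "m \<ge> M" "n \<ge> M" for m n
    proof -
      have "D m n \<le> (\<Sum>k\<in>(freq_box N' :: (int ^ 'n) set). 2 * (norm (c m k - l k))\<^sup>2 + 2 * (norm (c n k - l k))\<^sup>2)"
        unfolding D_def
      proof (rule sum_mono)
        fix k
        have "norm (c m k - c n k) \<le> norm (c m k - l k) + norm (c n k - l k)"
          using norm_triangle_ineq4[of "c m k - l k" "c n k - l k"] by simp
        then have "(norm (c m k - c n k))\<^sup>2 \<le> (norm (c m k - l k) + norm (c n k - l k))\<^sup>2" by (intro power_mono) auto
        also have "\<dots> \<le> 2 * (norm (c m k - l k))\<^sup>2 + 2 * (norm (c n k - l k))\<^sup>2"
          using sum_squares_bound[of "norm (c m k - l k)" "norm (c n k - l k)"] by (simp add: power2_sum)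
        finally show "(norm (c m k - c n k))\<^sup>2 \<le> 2 * (norm (c m k - l k))\<^sup>2 + 2 * (norm (c n k - l k))\<^sup>2" .
      qed
      also have "\<dots> < e / 2"
        using M[OF that(1)] M[OF that(2)] by (simp add: sum.distrib sum_distrib_left[symmetric])
      finally show ?thesis .
    qed
    then show ?thesis by auto
  qed
  then obtain M where M: "\<forall>m\<ge>M. \<forall>n\<ge>M. D m n < e / 2" by blast
  have "sq_int (\<lambda>x. U m x - U n x) < e" if mn: "m \<ge> M" "n \<ge> M" for m n
  proof -
    have fin: "(\<Sum>k\<in>F. (cmod (fourier_coeff (\<lambda>x. U m x - U n x) k))\<^sup>2) \<le> D m n + e / 4" if F: "finite F" for F
    proof -
      have "(\<Sum>k\<in>F. (cmod (fourier_coeff (\<lambda>x. U m x - U n x) k))\<^sup>2) \<le> (\<Sum>k\<in>F. (norm (c m k - c n k))\<^sup>2)"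
      proof (rule sum_mono)
        fix k
        have "fourier_coeff (\<lambda>x. U m x - U n x) k = (c m k - c n k) $ j"
          by (simp add: fourier_coeff_diff[OF L2_integrable[OF U] L2_integrable[OF U]] coeff)
        then show "(cmod (fourier_coeff (\<lambda>x. U m x - U n x) k))\<^sup>2 \<le> (norm (c m k - c n k))\<^sup>2"
          using Finite_Cartesian_Product.norm_nth_le[of "c m k - c n k" j] by (simp add: power_mono)
      qed
      also have "\<dots> = (\<Sum>k\<in>F \<inter> freq_box N'. (norm (c m k - c n k))\<^sup>2) + (\<Sum>k\<in>F - freq_box N'. (norm (c m k - c n k))\<^sup>2)"
        by (rule sum.Int_Diff[OF F])
      also have "(\<Sum>k\<in>F \<inter> freq_box N'. (norm (c m k - c n k))\<^sup>2) \<le> D m n"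
        unfolding D_def by (intro sum_mono2) auto
      also have "(\<Sum>k\<in>F - freq_box N'. (norm (c m k - c n k))\<^sup>2)
          \<le> (\<Sum>k\<in>F - freq_box N'. (2 / real N') * (weight ?s k * (norm (c m k))\<^sup>2) + (2 / real N') * (weight ?s k * (norm (c n k))\<^sup>2))"
      proof (rule sum_mono)
        fix k assume "k \<in> F - freq_box N'"
        then have k: "k \<notin> freq_box N'" by simp
        have "(norm (c m k - c n k))\<^sup>2 \<le> (norm (c m k) + norm (c n k))\<^sup>2"
          using norm_triangle_ineq4[of "c m k" "c n k"] by (intro power_mono) auto
        also have "\<dots> \<le> 2 * (norm (c m k))\<^sup>2 + 2 * (norm (c n k))\<^sup>2"
          using sum_squares_bound[of "norm (c m k)" "norm (c n k)"] by (simp add: power2_sum)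
        also have "\<dots> \<le> 2 * ((1 / real N') * (weight ?s k * (norm (c m k))\<^sup>2)) + 2 * ((1 / real N') * (weight ?s k * (norm (c n k))\<^sup>2))"
          by (intro add_mono mult_left_mono tail k) auto
        finally show "(norm (c m k - c n k))\<^sup>2 \<le> (2 / real N') * (weight ?s k * (norm (c m k))\<^sup>2) + (2 / real N') * (weight ?s k * (norm (c n k))\<^sup>2)"
          by simp
      qed
      also have "\<dots> = (2 / real N') * (\<Sum>k\<in>F - freq_box N'. weight ?s k * (norm (c m k))\<^sup>2) + (2 / real N') * (\<Sum>k\<in>F - freq_box N'. weight ?s k * (norm (c n k))\<^sup>2)"
        by (simp only: sum.distrib sum_distrib_left)
      also have "\<dots> \<le> (2 / real N') * R + (2 / real N') * R"
        using F by (intro add_mono mult_left_mono R) auto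
      also have "\<dots> = (4 * R) / real N'" by simp
      also have "\<dots> \<le> e / 4" using N' e by (simp add: field_simps)
      finally show ?thesis by simp
    qed
    note par = parseval[OF L2_diff[OF U U], of m n]
    have "infsum (\<lambda>k. (cmod (fourier_coeff (\<lambda>x. U m x - U n x) k))\<^sup>2) UNIV \<le> D m n + e / 4"
      by (rule infsum_le_finite_sums[OF has_sum_imp_summable[OF par]]) (use fin in auto)
    then have "sq_int (\<lambda>x. U m x - U n x) \<le> D m n + e / 4" using infsumI[OF par] by simp
    moreover have "D m n < e / 2" using M mn by auto
    ultimately show ?thesis using e by linarith
  qed
  then show ?thesis by auto
qed

text \<open>The approximate solutions, with cutoff and exponent tied to one index, are bounded in
  the Sobolev norm, so a subsequence converges in L^2. The Sobolev bound, the pointwise bound 1 and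
  the divergence at each fixed frequency survive the limit.\<close>

theorem bounded_solution_critical:
  fixes v :: "'n \<Rightarrow> real ^ 'n \<Rightarrow> real"
  assumes d: "CARD('n) \<ge> 2" and v: "\<And>j. v j \<in> Hs (real CARD('n) / 2)"
  obtains u :: "'n \<Rightarrow> real ^ 'n \<Rightarrow> real" where "\<And>j. u j \<in> Linf" "\<And>j. u j \<in> Hs (real CARD('n) / 2)"
    "\<And>k. kdot k (coeff_vec u k) = kdot k (coeff_vec v k)"
proof -
  let ?s = "real CARD('n) / 2" and ?d = "real CARD('n)"
  obtain e where e: "e > 0" and small: "\<And>I. sqrt (\<Sum>k\<in>spectrum I. (norm (if 2 * fnorm k \<le> 2 ^ I then e *\<^sub>R coeff_vec v k else 0))\<^sup>2 / rho I k) \<le> smallness TYPE('n)"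
    by (rule low_freq_data_bound[of v, OF v]) blast
  define V where "V I k = (if 2 * fnorm k \<le> 2 ^ I then e *\<^sub>R coeff_vec v k else 0)" for I :: nat and k
  \<comment> \<open>Even, positive and growing together with the cutoff, so that one limit removes
    both.\<close>
  define p where "p I = 2 * Suc I" for I :: nat
  define good where "good I c \<longleftrightarrow> c \<in> admissible I (V I) \<and> (\<Sum>k\<in>spectrum I. (norm (c k))\<^sup>2 / rho I k) \<le> ?d + 1
      \<and> (\<forall>j. (LINT x|torus. (vtrig I c j x) ^ p I) \<le> ?d + 1)" for I c
  have ex: "\<exists>c. good I c" for I
  proof -
    have Vs: "vsym (V I)" using vsym_coeff_vec[of v] by (simp add: V_def vsym_def freq_vec_uminus)
    have pI: "even (p I)" "p I > 0" by (auto simp: p_def)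
    obtain c where "c \<in> admissible I (V I)" "(\<Sum>k\<in>spectrum I. (norm (c k))\<^sup>2 / rho I k) \<le> ?d + 1"
      "\<And>j. (LINT x|torus. (vtrig I c j x) ^ p I) \<le> ?d + 1"
    proof (rule approximate_solution[OF d pI Vs small[of I, folded V_def]])
      fix c assume "c \<in> admissible I (V I)" "(\<Sum>k\<in>spectrum I. (norm (c k))\<^sup>2 / rho I k) \<le> ?d + 1"
        "\<And>j. (LINT x|torus. (vtrig I c j x) ^ p I) \<le> ?d + 1"
      then show thesis by (rule that)
    qed
    then have "good I c" unfolding good_def by (intro conjI allI)
    then show ?thesis by (intro exI[of _ c])
  qed
  define c where "c I = (SOME c. good I c)" for I
  have "good I (c I)" for I unfolding c_def by (rule someI_ex[OF ex])
  then have c: "\<And>I. c I \<in> admissible I (V I)"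
    and cA: "\<And>I. (\<Sum>k\<in>spectrum I. (norm (c I k))\<^sup>2 / rho I k) \<le> ?d + 1"
    and cp: "\<And>I j. (LINT x|torus. (vtrig I (c I) j x) ^ p I) \<le> ?d + 1"
    by (auto simp: good_def)
  \<comment> \<open>\<open>2 powr ?s\<close> compares the two Sobolev weights, the next 2 is the
    constant of \<open>rho_upper\<close>, and the rest is the bound of
    \<open>approximate_solution\<close>.\<close>
  define R where "R = 2 powr ?s * 2 * (?d + 1)"
  have R0: "R \<ge> 0" by (simp add: R_def)
  have R: "(\<Sum>k\<in>F. weight ?s k * (norm (c I k))\<^sup>2) \<le> R" if F: "finite F" for F I
  proof -
    have "(\<Sum>k\<in>F. weight ?s k * (norm (c I k))\<^sup>2) \<le> (\<Sum>k\<in>spectrum I. weight ?s k * (norm (c I k))\<^sup>2)"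
    proof -
      have "(\<Sum>k\<in>F. weight ?s k * (norm (c I k))\<^sup>2) = (\<Sum>k\<in>F \<inter> spectrum I. weight ?s k * (norm (c I k))\<^sup>2)"
        using c[of I] by (intro sum.mono_neutral_right F) (auto simp: admissible_def)
      also have "\<dots> \<le> (\<Sum>k\<in>spectrum I. weight ?s k * (norm (c I k))\<^sup>2)"
        by (intro sum_mono2) auto
      finally show ?thesis .
    qed
    also have "\<dots> \<le> (\<Sum>k\<in>spectrum I. 2 powr ?s * 2 * ((norm (c I k))\<^sup>2 / rho I k))"
    proof (rule sum_mono)
      fix k :: "int ^ 'n" assume k: "k \<in> spectrum I"
      have rp: "0 < rho I k" by (rule spectrum_rho_pos[OF k])
      have "weight ?s k \<le> 2 powr ?s * fnorm k ^ CARD('n)"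
        by (rule fnorm_power_weight(2)[OF spectrum_nonzero[OF k]])
      also have "\<dots> \<le> 2 powr ?s * (2 / rho I k)"
        using rho_upper[OF spectrum_nonzero[OF k], of I] rp
        by (intro mult_left_mono) (auto simp: le_divide_eq mult.commute)
      finally have "weight ?s k * (norm (c I k))\<^sup>2 \<le> 2 powr ?s * (2 / rho I k) * (norm (c I k))\<^sup>2"
        by (intro mult_right_mono) auto
      then show "weight ?s k * (norm (c I k))\<^sup>2 \<le> 2 powr ?s * 2 * ((norm (c I k))\<^sup>2 / rho I k)" by simp
    qed
    also have "\<dots> = 2 powr ?s * 2 * (\<Sum>k\<in>spectrum I. (norm (c I k))\<^sup>2 / rho I k)" by (rule sum_distrib_left[symmetric])
    also have "\<dots> \<le> R" unfolding R_def by (intro mult_left_mono cA) auto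
    finally show ?thesis .
  qed
  have "\<exists>B. \<forall>n. norm (c n k) \<le> B" for k
  proof (intro exI allI)
    fix n
    have "1 * (norm (c n k))\<^sup>2 \<le> weight ?s k * (norm (c n k))\<^sup>2" by (intro mult_right_mono weight_ge_1) auto
    also have "\<dots> \<le> R" using R[of "{k}" n] by simp
    finally show "norm (c n k) \<le> sqrt R" by (simp add: real_le_rsqrt)
  qed
  then obtain r l where r: "strict_mono r" and l: "\<And>k. (\<lambda>n. c (r n) k) \<longlonglongrightarrow> l k"
    by (rule pointwise_convergent_subseq[of c]) blast
  define U where "U j n = vtrig (r n) (c (r n)) j" for j n
  have UL2: "U j n \<in> L2" for j n unfolding U_def by (rule vtrig_L2)
  have Uc: "fourier_coeff (U j n) k = c (r n) k $ j" for j n k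
    unfolding U_def by (rule coeff_vec_vtrig[OF c])
  have "\<exists>u. u \<in> Linf \<and> u \<in> Hs ?s \<and> (\<forall>k. fourier_coeff u k = l k $ j)" for j
  proof -
    have cau: "\<exists>M. \<forall>m\<ge>M. \<forall>n\<ge>M. sq_int (\<lambda>x. U j m x - U j n x) < e'" if "e' > 0" for e'
      by (rule coeff_sequence_cauchy[OF d UL2 Uc l R that])
    obtain u q where u: "u \<in> L2" and lim: "(\<lambda>n. sq_int (\<lambda>x. U j n x - u x)) \<longlonglongrightarrow> 0"
      and q: "strict_mono q" and ae: "AE x in torus. (\<lambda>i. U j (q i) x) \<longlonglongrightarrow> u x"
      by (rule L2_complete[of "U j", OF UL2 cau])
    have HsU: "U j n \<in> Hs ?s \<and> Hs_norm ?s (U j n) \<le> sqrt R" for n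
    proof -
      have "(\<Sum>k\<in>F. sobolev_term ?s (U j n) k) \<le> (sqrt R)\<^sup>2" if F: "finite F" for F
      proof -
        have "(\<Sum>k\<in>F. sobolev_term ?s (U j n) k) \<le> (\<Sum>k\<in>F. weight ?s k * (norm (c (r n) k))\<^sup>2)"
          unfolding sobolev_term_eq Uc
          by (intro sum_mono mult_left_mono power_mono Finite_Cartesian_Product.norm_nth_le) auto
        also have "\<dots> \<le> R" by (rule R[OF F])
        finally show ?thesis using R0 by simp
      qed
      from HsI[OF UL2 this] show ?thesis using R0 by simp
    qed
    have "u \<in> Hs ?s"
      by (rule Hs_limit_bound(1)[OF UL2 u lim, of ?s "sqrt R"]) (use HsU R0 in auto)
    moreover have "fourier_coeff u k = l k $ j" for k
    proof (rule LIMSEQ_unique[OF sq_int_tendsto_fourier_coeff[OF UL2 u lim]])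
      show "(\<lambda>n. fourier_coeff (U j n) k) \<longlonglongrightarrow> l k $ j"
        unfolding Uc by (intro tendsto_vec_nth l)
    qed
    moreover have "AE x in torus. \<bar>u x\<bar> \<le> 1"
    proof (rule AE_bounded_of_power_bound[OF _ ae, of "\<lambda>i. p (r (q i))" "?d + 1"])
      show "continuous_on UNIV (U j (q i))" for i unfolding U_def by (rule vtrig_continuous)
      show "even (p (r (q i)))" for i by (simp add: p_def)
      show "i \<le> p (r (q i))" for i
        using seq_suble[OF strict_mono_o[OF r q], of i] by (simp add: p_def)
      show "(LINT x|torus. U j (q i) x ^ p (r (q i))) \<le> ?d + 1" for i unfolding U_def by (rule cp)
    qed
    then have "u \<in> Linf" using u by (auto simp: Linf_iff L2_def)
    ultimately show ?thesis by blast
  qed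
  then obtain u where u: "\<And>j. u j \<in> Linf" "\<And>j. u j \<in> Hs ?s" "\<And>j k. fourier_coeff (u j) k = l k $ j" by metis
  \<comment> \<open>Every nonzero frequency eventually lies in the range where the data are not cut
    off and the constraint is exact; at frequency 0 both sides vanish.\<close>
  have lk: "kdot k (l k) = e *\<^sub>R kdot k (coeff_vec v k)" for k
  proof (cases "k = 0")
    case True
    then show ?thesis by (simp add: kdot_def)
  next
    case False
    obtain N where N: "2 * fnorm k < 2 ^ N" using real_arch_pow[of 2 "2 * fnorm k"] by auto
    have "kdot k (c (r n) k) = e *\<^sub>R kdot k (coeff_vec v k)" if "n \<ge> N" for n
    proof -
      have "N \<le> r n" using that seq_suble[OF r, of n] by linarith
      then have "(2::real) ^ N \<le> 2 ^ r n" by (intro power_increasing) auto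
      then have low: "2 * fnorm k \<le> 2 ^ r n" using N by linarith
      then have "k \<in> spectrum (r n)" by (rule low_freq_in_spectrum[OF False])
      then have "kdot k (c (r n) k) = kdot k (V (r n) k)" using c[of "r n"] by (auto simp: admissible_def)
      then show ?thesis using low by (simp add: V_def kdot_scaleR)
    qed
    then have "(\<lambda>n. kdot k (c (r n) k)) \<longlonglongrightarrow> e *\<^sub>R kdot k (coeff_vec v k)"
      by (intro tendsto_eventually) (auto simp: eventually_sequentially)
    moreover have "(\<lambda>n. kdot k (c (r n) k)) \<longlonglongrightarrow> kdot k (l k)"
      unfolding kdot_def by (intro tendsto_sum tendsto_mult tendsto_const tendsto_vec_nth l)
    ultimately show ?thesis using LIMSEQ_unique by blast
  qed
  show thesis
  \<comment> \<open>Division by \<open>e\<close> undoes the scaling of the data.\<close>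
  proof (rule that[of "\<lambda>j x. (1 / e) * u j x"])
    show "(\<lambda>x. (1 / e) * u j x) \<in> Linf" for j by (rule Linf.scale_mem[OF u(1)])
    show "(\<lambda>x. (1 / e) * u j x) \<in> Hs ?s" for j by (rule Hs.scale_mem[OF u(2)])
    fix k
    have "coeff_vec (\<lambda>j x. (1 / e) * u j x) k = (1 / e) *\<^sub>R l k"
      unfolding coeff_vec_def vec_eq_iff vec_lambda_beta fourier_coeff_scale u(3)
      by (simp, simp add: scaleR_conv_of_real)
    then show "kdot k (coeff_vec (\<lambda>j x. (1 / e) * u j x) k) = kdot k (coeff_vec v k)"
      using e by (simp add: kdot_scaleR lk)
  qed
qed

section \<open>The interpolation spaces\<close>

lemma Linf_subset_L1: "Linf \<subseteq> L1"
  using L2_integrable[OF Linf_L2] by (auto simp: L1_def Linf_torus_fun)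

lemma Hs_subset_L1: "Hs s \<subseteq> L1"
  using L2_integrable[OF Hs_L2] by (auto simp: L1_def Hs_def L2_def)

lemma LINT_abs_le_Hs:
  assumes "0 \<le> s" "f \<in> Hs s"
  shows "(LINT x|torus. \<bar>f x\<bar>) \<le> Hs_norm s f"
proof -
  have "(LINT x|torus. \<bar>f x\<bar>) \<le> sqrt (sq_int f)" by (rule LINT_abs_le_sq_int[OF Hs_L2[OF assms(2)]])
  also have "\<dots> \<le> Hs_norm s f"
    using sq_int_le_Hs[OF assms] Hs_norm_nonneg by (intro real_le_lsqrt) auto
  finally show ?thesis .
qed

theorem corollary3:
  fixes \<theta> q :: real
  assumes "CARD('n::finite) \<ge> 2"
    and "0 < \<theta>" and "\<theta> < 1"
    and "1 \<le> q"
  shows "BB_space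
    (interp_space (Linf :: (real ^ 'n \<Rightarrow> real) set) Linf_norm
       (Hs (real CARD('n) / 2)) (Hs_norm (real CARD('n) / 2)) \<theta> q)
    (interp_norm Linf Linf_norm (Hs (real CARD('n) / 2)) (Hs_norm (real CARD('n) / 2)) \<theta> q)"
proof -
  let ?s = "real CARD('n) / 2"
  let ?H = "Hs ?s :: (real ^ 'n \<Rightarrow> real) set"
  interpret X: real_interp "Linf :: (real ^ 'n \<Rightarrow> real) set" Linf_norm ?H "Hs_norm ?s" \<theta> q
    using assms
    by (simp add: real_interp_def real_interp_axioms_def interp_couple_def fun_seminorm_Linf fun_seminorm_Hs)
  have sum_L1: "X.sum_space \<subseteq> L1"
  proof
    fix f assume "f \<in> X.sum_space"
    then obtain g h where "g \<in> Linf" "h \<in> ?H" "f = (\<lambda>x. g x + h x)" by (rule X.sum_spaceE)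
    then show "f \<in> L1"
      using Linf_subset_L1 Hs_subset_L1[of ?s] by (auto simp: L1_def intro!: torus_fun_add)
  qed
  \<comment> \<open>This gives definiteness: a vanishing interpolation norm forces
    \<open>K 1 f\<close> to vanish, and with it the L^1 norm.\<close>
  have K_L1: "(LINT x|torus. \<bar>f x\<bar>) \<le> X.K 1 f" if "f \<in> X.sum_space" for f
  proof (rule X.K_greatest[OF that])
    fix g h assume gh: "g \<in> Linf" "h \<in> ?H" and f: "f = (\<lambda>x. g x + h x)"
    have int: "integrable torus g" "integrable torus h"
      using gh Linf_subset_L1 Hs_subset_L1[of ?s] by (auto simp: L1_def)
    have "(LINT x|torus. \<bar>f x\<bar>) \<le> (LINT x|torus. \<bar>g x\<bar> + \<bar>h x\<bar>)"
      unfolding f using int by (intro integral_mono) auto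
    also have "\<dots> = (LINT x|torus. \<bar>g x\<bar>) + (LINT x|torus. \<bar>h x\<bar>)" using int by simp
    also have "\<dots> \<le> Linf_norm g + Hs_norm ?s h"
      using gh by (intro add_mono LINT_abs_le_Linf LINT_abs_le_Hs) auto
    finally show "(LINT x|torus. \<bar>f x\<bar>) \<le> Linf_norm g + 1 * Hs_norm ?s h" by simp
  qed
  \<comment> \<open>A function that is zero almost everywhere has L^\<infinity> norm 0, so the
    decomposition \<open>f + 0\<close> makes every \<open>K t f\<close> vanish. Closure under
    changes on null sets follows by adding such functions.\<close>
  have null: "f \<in> X.X \<and> X.NX f = 0" if f: "f \<in> torus_fun" "AE x in torus. f x = 0" for f
  proof -
    have ae: "AE x in torus. \<bar>f x\<bar> \<le> 0" using f(2) by eventually_elim simp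
    have L: "f \<in> Linf" using f(1) ae by (auto simp: Linf_iff)
    have N0: "Linf_norm f \<le> 0" by (rule Linf_norm_le[OF f(1) ae])
    have fs: "f \<in> X.sum_space" using L X.sum_space_0 by auto
    have "X.K t f = 0" if "t > 0" for t
    proof (rule antisym)
      have "X.K t f \<le> Linf_norm f + t * Hs_norm ?s (\<lambda>x :: real ^ 'n. 0)"
        using that by (intro X.K_le L Hs.zero_mem) auto
      then show "X.K t f \<le> 0" using N0 by (simp add: Hs.N_zero)
      show "0 \<le> X.K t f" using that by (intro X.K_nonneg fs) auto
    qed
    then have "X.I f = (\<integral>\<^sup>+t. 0 \<partial>(lborel :: real measure))"
      unfolding X.I_eq by (intro nn_integral_cong) (simp add: X.W_def)
    then have I0: "X.I f = 0" by simp
    then have "f \<in> X.X" using fs by (simp add: X.X_iff)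
    moreover have "X.NX f \<le> 0" by (rule X.NX_le) (use I0 in auto)
    ultimately show ?thesis using X.NX_nonneg[of f] by auto
  qed
  have banach: "banach_function_space X.X X.NX"
    unfolding banach_function_space_def
  proof (intro conjI ballI allI impI)
    show "X.X \<subseteq> L1" using sum_L1 by (auto simp: X.X_iff)
    show "(\<lambda>x. 0) \<in> X.X" by (rule X.zero_X)
  next
    fix f g assume "f \<in> X.X" "g \<in> X.X"
    then show "(\<lambda>x. f x + g x) \<in> X.X" "X.NX (\<lambda>x. f x + g x) \<le> X.NX f + X.NX g" by (rule X.X_add)+
  next
    fix f and a :: real assume "f \<in> X.X"
    then show "(\<lambda>x. a * f x) \<in> X.X" "X.NX (\<lambda>x. a * f x) = \<bar>a\<bar> * X.NX f" by (rule X.X_scale)+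
  next
    fix f g assume f: "f \<in> X.X" and g: "g \<in> torus_fun" and ae: "AE x in torus. f x = g x"
    have "f \<in> torus_fun" using f sum_L1 by (auto simp: X.X_iff L1_def)
    then have "(\<lambda>x. g x - f x) \<in> torus_fun" by (rule torus_fun_diff[OF g])
    moreover have "AE x in torus. g x - f x = 0" using ae by eventually_elim simp
    ultimately have "(\<lambda>x. g x - f x) \<in> X.X" using null by blast
    from X.X_add(1)[OF f this] show "g \<in> X.X" by simp
  next
    fix f assume f: "f \<in> X.X"
    show "0 \<le> X.NX f" by (rule X.NX_nonneg)
    have fs: "f \<in> X.sum_space" using f by (simp add: X.X_iff)
    then have f1: "f \<in> torus_fun" "integrable torus f" using sum_L1 by (auto simp: L1_def)
    show "X.NX f = 0 \<longleftrightarrow> (AE x in torus. f x = 0)"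
    proof
      assume "X.NX f = 0"
      then have "X.K 1 f \<le> 0" using X.K1_le_NX[OF f] by simp
      then have "(LINT x|torus. \<bar>f x\<bar>) = 0" using K_L1[OF fs] by (intro antisym) auto
      then show "AE x in torus. f x = 0"
        using f1 by (subst (asm) integral_nonneg_eq_0_iff_AE) auto
    next
      assume "AE x in torus. f x = 0"
      then show "X.NX f = 0" using null[OF f1(1)] by simp
    qed
  next
    fix F :: "nat \<Rightarrow> real ^ 'n \<Rightarrow> real"
    assume "(\<forall>n. F n \<in> X.X) \<and> (\<forall>e>0. \<exists>M. \<forall>m\<ge>M. \<forall>n\<ge>M. X.NX (\<lambda>x. F m x - F n x) < e)"
    moreover have "seminorm_complete X.X X.NX"
      by (rule X.X_complete[OF Linf_complete Hs_complete]) simp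
    ultimately show "\<exists>f\<in>X.X. (\<lambda>n. X.NX (\<lambda>x. F n x - f x)) \<longlonglongrightarrow> 0"
      unfolding seminorm_complete_def by simp
  qed
  have solve: "\<exists>u\<in>vector_field_in (Linf \<inter> X.X). same_div u v" if v: "v \<in> vector_field_in X.X" for v
  proof -
    have vX: "(\<lambda>x. v x $ j) \<in> X.X" for j using v by (auto simp: vector_field_in_def)
    have ex: "\<exists>gh. fst gh \<in> Linf \<and> snd gh \<in> ?H \<and> (\<lambda>x. v x $ j) = (\<lambda>x. fst gh x + snd gh x)" for j
    proof -
      have "(\<lambda>x. v x $ j) \<in> X.sum_space" using vX[of j] by (simp add: X.X_iff)
      then obtain g h where "g \<in> Linf" "h \<in> ?H" "(\<lambda>x. v x $ j) = (\<lambda>x. g x + h x)" by (rule X.sum_spaceE)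
      then show ?thesis by (intro exI[of _ "(g, h)"]) simp
    qed
    define gh where "gh j = (SOME gh. fst gh \<in> Linf \<and> snd gh \<in> ?H \<and> (\<lambda>x. v x $ j) = (\<lambda>x. fst gh x + snd gh x))" for j
    define g h where "g j = fst (gh j)" and "h j = snd (gh j)" for j
    have g: "g j \<in> Linf" and h: "h j \<in> ?H" and eq: "(\<lambda>x. v x $ j) = (\<lambda>x. g j x + h j x)" for j
      using someI_ex[OF ex[of j]] by (simp_all add: g_def h_def gh_def)
    obtain w where w: "\<And>j. w j \<in> Linf" "\<And>j. w j \<in> ?H"
      "\<And>k. kdot k (coeff_vec w k) = kdot k (coeff_vec h k)"
    proof (rule bounded_solution_critical[of h, OF assms(1) h])
      fix w :: "'n \<Rightarrow> real ^ 'n \<Rightarrow> real"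
      assume "\<And>j. w j \<in> Linf" "\<And>j. w j \<in> ?H" "\<And>k. kdot k (coeff_vec w k) = kdot k (coeff_vec h k)"
      then show thesis by (rule that)
    qed
    define u where "u x = (\<chi> j. g j x + w j x)" for x
    have uj: "(\<lambda>x. u x $ j) = (\<lambda>x. g j x + w j x)" for j by (simp add: u_def)
    have hX: "h j \<in> X.X" for j by (rule X.A1_part_in_X[OF vX g h eq])
    have wX: "w j \<in> X.X" for j using X.inter_subset_X w by blast
    \<comment> \<open>Boundedness alone does not place \<open>g j\<close> in the interpolation
      space; it lies there as the difference of \<open>v\<close> and \<open>h j\<close>.\<close>
    have gX: "g j \<in> X.X" for j
      using X.X_add(1)[OF vX[of j] X.X_scale(1)[OF hX[of j], of "-1"]] fun_cong[OF eq[of j]] by simp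
    have "u \<in> vector_field_in (Linf \<inter> X.X)"
      using Linf.add_mem[OF g w(1)] X.X_add(1)[OF gX wX] by (simp add: vector_field_in_def uj)
    moreover have "same_div u v"
    proof (rule same_divI)
      show uL2: "(\<lambda>x. u x $ j) \<in> L2" for j
        unfolding uj by (intro L2_add Linf_L2 g w)
      show vL2: "(\<lambda>x. v x $ j) \<in> L2" for j
        unfolding eq by (rule L2_add[OF Linf_L2[OF g] Hs_L2[OF h]])
      fix k
      have "coeff_vec (\<lambda>j x. u x $ j) k = coeff_vec g k + coeff_vec w k"
        unfolding coeff_vec_def vec_eq_iff uj
        by (simp add: fourier_coeff_add[OF L2_integrable[OF Linf_L2[OF g]] L2_integrable[OF Linf_L2[OF w(1)]]])
      moreover have "coeff_vec (\<lambda>j x. v x $ j) k = coeff_vec g k + coeff_vec h k"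
        unfolding coeff_vec_def vec_eq_iff eq
        by (simp add: fourier_coeff_add[OF L2_integrable[OF Linf_L2[OF g]] L2_integrable[OF Hs_L2[OF h]]])
      ultimately show "kdot k (coeff_vec (\<lambda>j x. u x $ j) k) = kdot k (coeff_vec (\<lambda>j x. v x $ j) k)"
        by (simp add: kdot_add w(3))
    qed
    ultimately show ?thesis by blast
  qed
  show ?thesis
    unfolding BB_space_def using banach solve by blast
qed

end
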